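(* Let $n\ge 2$. For $1\le i\le n$ let $\theta_i=\theta_i^{D_n}=\sum_{j\ne i}\bigl((ij)+\overline{(ij)}\bigr)\in\Lambda_{quad}(D_n)$. Then $$\epsilon_k\bigl(\theta_1^2,\ldots,\theta_n^2\bigr)=0\qquad(1\le k\le n),$$ where $\epsilon_k$ is the $k$-th elementary symmetric polynomial. Moreover, $$\theta_1\theta_2\cdots\theta_n=0,$$ $$\sum_{i=1}^n(-1)^{i+1}\theta_1\cdots\widehat{\theta_i}\cdots\theta_n=0,$$ where $\widehat{\theta_i}$ means that the factor $\theta_i$ is omitted.
   Context: $K$ is a field of characteristic zero. $\Lambda_{quad}(D_n)$ is the unital associative $K$-algebra generated by symbols $(ij)=(ji)$ and $\overline{(ij)}=\overline{(ji)}$, $1\le i\neq j\le n$ (one for each reflection of the Weyl group of type $D_n$), subject to the relations: $(ij)^2=\overline{(ij)}^2=0$; $(ij)(kl)+(kl)(ij)=(ij)\overline{(kl)}+\overline{(kl)}(ij)=\overline{(ij)}\,\overline{(kl)}+\overline{(kl)}\,\overline{(ij)}=0$ if $\{i,j\}\cap\{k,l\}=\emptyset$; $(ij)\overline{(ij)}+\overline{(ij)}(ij)=0$; $(ij)(jk)+(jk)(ki)+(ki)(ij)=0$ for distinct $i,j,k$; $\overline{(ik)}(ij)+(ji)\overline{(jk)}+\overline{(kj)}\,\overline{(ik)}=0$ for distinct $i,j,k$. Juxtaposition denotes the product in this algebra, not in the group. The elements $\theta_i$ satisfy $\theta_i\theta_j+\theta_j\theta_i=0$ for $i\neq j$, so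 that the squares $\theta_i^2$ commute pairwise and $\epsilon_k(\theta_1^2,\ldots,\theta_n^2)=\sum_{i_1<\cdots<i_k}\theta_{i_1}^2\cdots\theta_{i_k}^2$ is well defined. *)

theory Defs
  imports "HOL-Library.Poly_Mapping" "HOL-Algebra.QuotRing"
begin

text \<open>Words over an alphabet, as a monoid under concatenation.  The monoid is written additively
  because this is what the convolution product of \<^type>\<open>poly_mapping\<close> requires of the exponents;
  with it, \<open>'a word \<Rightarrow>\<^sub>0 'k\<close> is the free associative \<open>'k\<close>-algebra on \<open>'a\<close>.\<close>

datatype 'a word = Word (letters: "'a list")

instantiation word :: (type) monoid_add
begin

definition zero_word :: "'a word" where
  "zero_word = Word []"

definition plus_word :: "'a word \<Rightarrow> 'a word \<Rightarrow> 'a word" where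
  "plus_word u v = Word (letters u @ letters v)"

instance
  by standard (simp_all add: zero_word_def plus_word_def)

end

definition letter :: "'a \<Rightarrow> 'a word \<Rightarrow>\<^sub>0 'k::comm_ring_1" where
  "letter a = Poly_Mapping.single (Word [a]) 1"

text \<open>The free algebra on the set \<open>X\<close>: all elements whose monomials use letters from \<open>X\<close> only.
  It contains the constants \<open>Poly_Mapping.single 0 c\<close>, through which the scalars act; hence its
  two-sided ring ideals are the same as its two-sided algebra ideals.\<close>

definition free_algebra :: "'a set \<Rightarrow> ('a word \<Rightarrow>\<^sub>0 'k::comm_ring_1) ring" where
  "free_algebra X =
    \<lparr>carrier = {p. \<forall>w\<in>Poly_Mapping.keys p. set (letters w) \<subseteq> X},
     mult = (*), one = 1, zero = 0, add = (+)\<rparr>"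

text \<open>The reflection symbols \<open>(ij) = (ji)\<close> (plain) and their overlined counterparts (barred) are indexed
  by the unordered pair \<open>{i, j}\<close>, which builds in their symmetry.\<close>

datatype reflection = Plain "nat set" | Barred "nat set"

definition reflections_D :: "nat \<Rightarrow> reflection set" where
  "reflections_D n =
    {Plain {i, j} | i j. i \<in> {1..n} \<and> j \<in> {1..n} \<and> i \<noteq> j} \<union>
    {Barred {i, j} | i j. i \<in> {1..n} \<and> j \<in> {1..n} \<and> i \<noteq> j}"

definition px :: "nat \<Rightarrow> nat \<Rightarrow> reflection word \<Rightarrow>\<^sub>0 'k::comm_ring_1" where
  "px i j = letter (Plain {i, j})"

definition bx :: "nat \<Rightarrow> nat \<Rightarrow> reflection word \<Rightarrow>\<^sub>0 'k::comm_ring_1" where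
  "bx i j = letter (Barred {i, j})"

definition quad_relators_D :: "nat \<Rightarrow> (reflection word \<Rightarrow>\<^sub>0 'k::comm_ring_1) set" where
  "quad_relators_D n =
    (\<Union>i\<in>{1..n}. \<Union>j\<in>{1..n} - {i}.
       {px i j * px i j, bx i j * bx i j, px i j * bx i j + bx i j * px i j}) \<union>
    (\<Union>i\<in>{1..n}. \<Union>j\<in>{1..n} - {i}. \<Union>k\<in>{1..n} - {i, j}. \<Union>l\<in>{1..n} - {i, j, k}.
       {px i j * px k l + px k l * px i j,
        px i j * bx k l + bx k l * px i j,
        bx i j * bx k l + bx k l * bx i j}) \<union>
    (\<Union>i\<in>{1..n}. \<Union>j\<in>{1..n} - {i}. \<Union>k\<in>{1..n} - {i, j}.
       {px i j * px j k + px j k * px k i + px k i * px i j,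
        bx i k * px i j + px j i * bx j k + bx k j * bx i k})"

definition quad_ideal_D :: "nat \<Rightarrow> (reflection word \<Rightarrow>\<^sub>0 'k::comm_ring_1) set" where
  "quad_ideal_D n = Idl\<^bsub>free_algebra (reflections_D n)\<^esub> (quad_relators_D n)"

definition Lambda_quad_D ::
    "'k itself \<Rightarrow> nat \<Rightarrow> (reflection word \<Rightarrow>\<^sub>0 'k::comm_ring_1) set ring" where
  "Lambda_quad_D K n = free_algebra (reflections_D n) Quot quad_ideal_D n"

definition Lambda_class ::
    "nat \<Rightarrow> (reflection word \<Rightarrow>\<^sub>0 'k::comm_ring_1) \<Rightarrow> (reflection word \<Rightarrow>\<^sub>0 'k) set" where
  "Lambda_class n p = quad_ideal_D n +>\<^bsub>free_algebra (reflections_D n)\<^esub> p"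

definition theta_D ::
    "'k itself \<Rightarrow> nat \<Rightarrow> nat \<Rightarrow> (reflection word \<Rightarrow>\<^sub>0 'k::comm_ring_1) set" where
  "theta_D K n i =
    (\<Oplus>\<^bsub>Lambda_quad_D K n\<^esub> j\<in>{1..n} - {i}.
       Lambda_class n (px i j) \<oplus>\<^bsub>Lambda_quad_D K n\<^esub> Lambda_class n (bx i j))"

definition ordered_prod :: "('a, 'b) ring_scheme \<Rightarrow> (nat \<Rightarrow> 'a) \<Rightarrow> nat set \<Rightarrow> 'a" where
  "ordered_prod R f S = foldr (\<otimes>\<^bsub>R\<^esub>) (map f (sorted_list_of_set S)) \<one>\<^bsub>R\<^esub>"

text \<open>The \<open>k\<close>-th elementary symmetric polynomial in \<open>f 1, \<dots>, f n\<close>, each monomial being multiplied in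
  increasing order of the indices (which is immaterial if the \<open>f i\<close> commute pairwise).\<close>

definition elem_sym :: "('a, 'b) ring_scheme \<Rightarrow> nat \<Rightarrow> nat \<Rightarrow> (nat \<Rightarrow> 'a) \<Rightarrow> 'a" where
  "elem_sym R n k f = (\<Oplus>\<^bsub>R\<^esub> S\<in>{S. S \<subseteq> {1..n} \<and> card S = k}. ordered_prod R f S)"


text \<open>Well-definedness of the quotient: the relators lie in the free algebra, so
  \<^const>\<open>quad_ideal_D\<close> is a proper use of \<^const>\<open>genideal\<close> and the quotient is a ring.\<close>

lemma keys_mult_letters:
  fixes p q :: "'a word \<Rightarrow>\<^sub>0 'k::comm_ring_1"
  assumes "\<forall>w\<in>Poly_Mapping.keys p. set (letters w) \<subseteq> X"
    and "\<forall>w\<in>Poly_Mapping.keys q. set (letters w) \<subseteq> X"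
  shows "\<forall>w\<in>Poly_Mapping.keys (p * q). set (letters w) \<subseteq> X"
proof
  fix w assume "w \<in> Poly_Mapping.keys (p * q)"
  then obtain u v where "w = u + v" "u \<in> Poly_Mapping.keys p" "v \<in> Poly_Mapping.keys q"
    using keys_mult[of p q] by auto
  then show "set (letters w) \<subseteq> X"
    using assms by (simp add: plus_word_def)
qed

lemma ring_free_algebra: "ring (free_algebra X :: ('a word \<Rightarrow>\<^sub>0 'k::comm_ring_1) ring)"
proof (rule ringI)
  show "abelian_group (free_algebra X :: ('a word \<Rightarrow>\<^sub>0 'k::comm_ring_1) ring)"
  proof (rule abelian_groupI)
    fix p q :: "'a word \<Rightarrow>\<^sub>0 'k"
    assume "p \<in> carrier (free_algebra X)" "q \<in> carrier (free_algebra X)"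
    then show "p \<oplus>\<^bsub>free_algebra X\<^esub> q \<in> carrier (free_algebra X)"
      using keys_add[of p q] by (auto simp: free_algebra_def)
  next
    fix p :: "'a word \<Rightarrow>\<^sub>0 'k"
    assume "p \<in> carrier (free_algebra X)"
    then show "\<exists>q\<in>carrier (free_algebra X). q \<oplus>\<^bsub>free_algebra X\<^esub> p = \<zero>\<^bsub>free_algebra X\<^esub>"
      by (intro bexI[of _ "- p"]) (auto simp: free_algebra_def)
  qed (auto simp: free_algebra_def algebra_simps)
  show "Group.monoid (free_algebra X :: ('a word \<Rightarrow>\<^sub>0 'k::comm_ring_1) ring)"
  proof (rule monoidI)
    fix p q :: "'a word \<Rightarrow>\<^sub>0 'k"
    assume "p \<in> carrier (free_algebra X)" "q \<in> carrier (free_algebra X)"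
    then show "p \<otimes>\<^bsub>free_algebra X\<^esub> q \<in> carrier (free_algebra X)"
      unfolding free_algebra_def using keys_mult_letters[of p X q] by simp
  qed (auto simp: free_algebra_def mult.assoc zero_word_def)
qed (auto simp: free_algebra_def distrib_left distrib_right)

lemma quad_relators_D_carrier:
  "(quad_relators_D n :: (reflection word \<Rightarrow>\<^sub>0 'k::comm_ring_1) set)
    \<subseteq> carrier (free_algebra (reflections_D n))"
proof -
  let ?F = "free_algebra (reflections_D n) :: (reflection word \<Rightarrow>\<^sub>0 'k) ring"
  interpret ring ?F by (rule ring_free_algebra)
  have add: "p + q \<in> carrier ?F" if "p \<in> carrier ?F" "q \<in> carrier ?F" for p q
    using a_closed[OF that] by (simp add: free_algebra_def)
  have mult: "p * q \<in> carrier ?F" if "p \<in> carrier ?F" "q \<in> carrier ?F" for p q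
    using m_closed[OF that] by (simp add: free_algebra_def)
  have letter: "px i j \<in> carrier ?F" "bx i j \<in> carrier ?F"
    if "i \<in> {1..n}" "j \<in> {1..n}" "i \<noteq> j" for i j
    using that by (auto simp: free_algebra_def px_def bx_def letter_def reflections_D_def)
  show ?thesis
    unfolding quad_relators_D_def
    by (intro Un_least UN_least insert_subsetI empty_subsetI add mult letter) auto
qed

lemma ideal_quad_ideal_D:
  "ideal (quad_ideal_D n :: (reflection word \<Rightarrow>\<^sub>0 'k::comm_ring_1) set) (free_algebra (reflections_D n))"
  unfolding quad_ideal_D_def
  by (rule ring.genideal_ideal[OF ring_free_algebra quad_relators_D_carrier])

lemma ring_Lambda_quad_D: "ring (Lambda_quad_D K n)"
  unfolding Lambda_quad_D_def by (rule ideal.quotient_is_ring[OF ideal_quad_ideal_D])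

end

theory Submission
  imports Defs "HOL-Computational_Algebra.Formal_Power_Series" "HOL-Combinatorics.Perm"
begin

text \<open>The elements \<open>x_ij = (ij) + bar(ij)\<close> satisfy the relations of type A: \<open>x_ij\<^sup>2 = 0\<close>, disjoint ones
  anticommute, and \<open>x_ij x_jk + x_jk x_ki + x_ki x_ij = 0\<close>; and \<open>\<theta>_i\<close> is the sum of the \<open>x_ij\<close>. Adjoin
  anticommuting variables with \<open>x_ij z_k = - z_(ij)k x_ij\<close>. Then the deformed elements \<open>z_i + h \<theta>_i\<close> still
  anticommute, and the claim is that their product, its alternating version with one factor omitted,
  and the elementary symmetric functions of their squares do not depend on \<open>h\<close>; the coefficient of the
  highest power of \<open>h\<close> is the theorem.

  Let \<open>\<epsilon>\<close> be the difference between the deformed and the undeformed expression. It commutes with all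
  \<open>(z_i + h \<theta>_i)\<^sup>2\<close>, so its lowest coefficient in \<open>h\<close> commutes with all \<open>z_i\<^sup>2\<close> and is a combination of words
  in the \<open>x_ij\<close> whose product of transpositions is the identity. By induction on the number of indices
  (set the \<open>x_ij\<close> joining two complementary index sets to zero) these words connect all \<open>n\<close> indices, so
  they have at least \<open>2 n - 2\<close> letters. The expressions of smaller degree in \<open>h\<close> therefore vanish,
  and the remaining elementary symmetric functions, of index \<open>n\<close> and \<open>n - 1\<close>, are up to sign the squares of
  the product and of the alternating sum.\<close>

section \<open>Anticommuting families\<close>

text \<open>Only the relations among the \<open>x i j\<close> are given, so the extension by the
  variables z has to be built, and no information about the \<open>x i j\<close> may be lost in it.
  It is realized by additive operators on functions. The permutation in a point turns the square of
  z_i into multiplication by the integer (v i)^2. Distinct naturals have distinct squares and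
  nonzero integers are invertible, so an operator that commutes with all these squares cannot move
  the permutation. The family of index sets remembers which cuts a word has crossed, hence its
  connectivity; the Clifford coordinate supplies all signs. Evaluation at the function
  \<open>vacuum\<close> leads back to the original ring, at the price of a power of -2. The number 2
  n - 2 comes from the Riemann-Hurwitz inequality for factorizations of the identity into
  transpositions. It has to exceed the degree in h strictly: this degree is n for the product, n - 1
  for the alternating sum and 2 k for the k-th symmetric function. The product therefore misses the
  bound only for n = 2, where it is computed by hand.\<close>

fun omit_prod :: "('i \<Rightarrow> 'a::ring_1) \<Rightarrow> 'i list \<Rightarrow> 'a" where
  "omit_prod u [] = 0"
| "omit_prod u (a # l) = prod_list (map u l) - u a * omit_prod u l"

fun esym :: "nat \<Rightarrow> 'a::ring_1 list \<Rightarrow> 'a" where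
  "esym 0 l = 1"
| "esym (Suc k) [] = 0"
| "esym (Suc k) (a # l) = a * esym k l + esym (Suc k) l"

definition anticommuting_on :: "'i set \<Rightarrow> ('i \<Rightarrow> 'a::ring_1) \<Rightarrow> bool" where
  "anticommuting_on I u \<longleftrightarrow> (\<forall>i\<in>I. \<forall>j\<in>I. i \<noteq> j \<longrightarrow> u i * u j = - (u j * u i))"

lemma anticommuting_onD:
  "anticommuting_on I u \<Longrightarrow> i \<in> I \<Longrightarrow> j \<in> I \<Longrightarrow> i \<noteq> j \<Longrightarrow> u i * u j = - (u j * u i)"
  unfolding anticommuting_on_def by blast

lemma anticommuting_on_subset: "anticommuting_on I u \<Longrightarrow> J \<subseteq> I \<Longrightarrow> anticommuting_on J u"
  unfolding anticommuting_on_def by blast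

lemma omit_prod_cong: "map u l = map w l \<Longrightarrow> omit_prod u l = omit_prod w l"
  by (induction l) (auto intro!: arg_cong[of _ _ prod_list])

text \<open>\<open>omit_prod\<close> is the odd derivation that sends every \<open>u i\<close> to 1,
  in other words the alternating sum of the products with one factor left out. This is its graded
  Leibniz rule, needed to split an index list into two blocks.\<close>

lemma omit_prod_append:
  "omit_prod u (l @ m) = omit_prod u l * prod_list (map u m)
     + (- 1) ^ length l * prod_list (map u l) * omit_prod u m"
proof (induction l)
  case (Cons a l)
  then show ?case by (cases "even (length l)") (simp_all add: right_diff_distrib left_diff_distrib distrib_left mult.assoc)
qed simp

lemma esym_append: "esym k (l @ m) = (\<Sum>a\<le>k. esym a l * esym (k - a) m)"
proof (induction l arbitrary: k)
  case Nil
  have "(\<Sum>a\<le>k. esym a [] * esym (k - a) m) = (\<Sum>a\<in>{0}. esym a [] * esym (k - a) m)"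
    by (rule sum.mono_neutral_right) (auto, metis esym.simps(2) mult_zero_left not0_implies_Suc)
  then show ?case by simp
next
  case (Cons x l)
  show ?case
  proof (cases k)
    case (Suc k')
    have "(\<Sum>a\<le>Suc k'. esym a (x # l) * esym (Suc k' - a) m)
        = esym (Suc k') m + (\<Sum>a\<le>k'. (x * esym a l + esym (Suc a) l) * esym (k' - a) m)"
      by (subst sum.atMost_Suc_shift) simp
    also have "\<dots> = x * (\<Sum>a\<le>k'. esym a l * esym (k' - a) m)
        + (esym (Suc k') m + (\<Sum>a\<le>k'. esym (Suc a) l * esym (k' - a) m))"
      by (simp add: distrib_right sum.distrib sum_distrib_left mult.assoc)
    also have "esym (Suc k') m + (\<Sum>a\<le>k'. esym (Suc a) l * esym (k' - a) m)
        = (\<Sum>a\<le>Suc k'. esym a l * esym (Suc k' - a) m)"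
      by (simp add: sum.atMost_Suc_shift del: sum.atMost_Suc)
    finally show ?thesis using Cons Suc by simp
  qed simp
qed

lemma esym_eq_0: "length l < k \<Longrightarrow> esym k l = 0"
proof (induction l arbitrary: k)
  case Nil then show ?case by (cases k) auto
next
  case (Cons a l) then show ?case by (cases k) auto
qed

lemma esym_swap: "a * b = b * a \<Longrightarrow> esym k (a # b # l) = esym k (b # a # l)"
proof (cases k)
  case (Suc k')
  assume "a * b = b * a"
  then have "a * (b * c) = b * (a * c)" for c by (metis mult.assoc)
  then show ?thesis using Suc by (cases k') (auto simp: algebra_simps)
qed simp

text \<open>Rearrangements are generated by exchanges of neighbours. As an induction rule this
  serves both for the invariance of \<open>esym\<close> and for the signs of products and
  alternating sums.\<close>

lemma mset_swap_induct [consumes 1, case_names refl Cons swap trans]: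
  assumes "mset l = mset m"
    and refl: "\<And>l. P l l"
    and Cons: "\<And>a l m. mset l = mset m \<Longrightarrow> P l m \<Longrightarrow> P (a # l) (a # m)"
    and swap: "\<And>a b l. P (a # b # l) (b # a # l)"
    and trans: "\<And>l m k. mset l = mset m \<Longrightarrow> mset m = mset k \<Longrightarrow> P l m \<Longrightarrow> P m k \<Longrightarrow> P l k"
  shows "P l m"
  using assms(1)
proof (induction "length l" arbitrary: l m rule: less_induct)
  case less
  show ?case
  proof (cases l)
    case Nil then show ?thesis using less refl by simp
  next
    case l: (Cons a l')
    show ?thesis
    proof (cases m)
      case Nil then show ?thesis using less l by simp
    next
      case m: (Cons b m')
      show ?thesis
      proof (cases "a = b")
        case True
        then show ?thesis using less l m Cons by simp
      next
        case False
        \<comment> \<open>If the heads differ, the way from \<open>l\<close> to \<open>m\<close>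
          leads through \<open>a # b # c\<close> and \<open>b # a # c\<close>, where
          \<open>c\<close> is what remains when both heads are removed. The induction hypothesis is
          applied to the tails only.\<close>
        from less.prems False obtain K where "mset l' = add_mset b K" "mset m' = add_mset a K"
          unfolding l m by (auto simp: add_eq_conv_ex)
        moreover obtain c where "mset c = K" using ex_mset by blast
        ultimately have 1: "mset l' = mset (b # c)" and 2: "mset (a # c) = mset m'"
          by simp_all
        have "P l' (b # c)" "P (a # c) m'"
          using 1 2 less.hyps[of l' "b # c"] less.hyps[of "a # c" m'] l mset_eq_length[OF 1] mset_eq_length[OF 2] less.prems m
          by auto
        then have "P l (a # b # c)" "P (b # a # c) m"
          using l m 1 2 by (auto intro!: Cons)
        moreover have "mset l = mset (a # b # c)" "mset (b # a # c) = mset m"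
          using l m 1 2 by simp_all
        moreover have "P l (b # a # c)"
          by (rule trans[OF _ _ _ swap]) (use calculation in \<open>simp_all add: add_mset_commute\<close>)
        ultimately show ?thesis using less.prems by (intro trans[of l "b # a # c" m]) (simp_all add: add_mset_commute)
      qed
    qed
  qed
qed

lemma esym_mset:
  assumes "mset l = mset m" "\<And>a b. a \<in> set l \<Longrightarrow> b \<in> set l \<Longrightarrow> a * b = b * a"
  shows "esym k l = esym k m"
  using assms
proof (induction arbitrary: k rule: mset_swap_induct)
  case (Cons a l m)
  then show ?case by (cases k) auto
next
  case (swap a b l)
  then show ?case by (simp add: esym_swap)
next
  case (trans l m k')
  then show ?case by (metis mset_eq_setD)
qed simp

text \<open>The sign depends only on the two lists, so it can be compared across families.\<close>
lemma anticommuting_reorder: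
  assumes "mset l = mset m" "distinct l"
  shows "\<exists>c\<in>{1, -1::int}. \<forall>u :: 'i \<Rightarrow> 'a::ring_1. anticommuting_on (set l) u \<longrightarrow>
    prod_list (map u m) = of_int c * prod_list (map u l) \<and> omit_prod u m = of_int c * omit_prod u l"
  using assms
proof (induction rule: mset_swap_induct)
  case (refl l)
  show ?case by (rule bexI[of _ 1]) auto
next
  case (Cons a l m)
  then have "\<exists>c\<in>{1, -1::int}. \<forall>u :: 'i \<Rightarrow> 'a. anticommuting_on (set l) u \<longrightarrow>
    prod_list (map u m) = of_int c * prod_list (map u l) \<and> omit_prod u m = of_int c * omit_prod u l" by simp
  then obtain c where c: "c \<in> {1, -1::int}" and *: "\<forall>u :: 'i \<Rightarrow> 'a. anticommuting_on (set l) u \<longrightarrow>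
    prod_list (map u m) = of_int c * prod_list (map u l) \<and> omit_prod u m = of_int c * omit_prod u l" by blast
  show ?case
  proof (rule bexI[OF _ c], intro allI impI)
    fix u :: "'i \<Rightarrow> 'a" assume "anticommuting_on (set (a # l)) u"
    then have "anticommuting_on (set l) u" by (rule anticommuting_on_subset) auto
    from *[rule_format, OF this] show "prod_list (map u (a # m)) = of_int c * prod_list (map u (a # l)) \<and>
        omit_prod u (a # m) = of_int c * omit_prod u (a # l)"
      using c by (auto simp: algebra_simps)
  qed
next
  case (swap a b l)
  show ?case
  proof (rule bexI[of _ "-1"], intro allI impI)
    fix u :: "'i \<Rightarrow> 'a" assume "anticommuting_on (set (a # b # l)) u"
    then have ab: "u a * u b = - (u b * u a)" by (rule anticommuting_onD) (use swap in auto)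
    have "u a * (u b * c) = - (u b * (u a * c))" for c
      using ab by (metis mult.assoc mult_minus_left)
    then show "prod_list (map u (b # a # l)) = of_int (-1) * prod_list (map u (a # b # l)) \<and>
        omit_prod u (b # a # l) = of_int (-1) * omit_prod u (a # b # l)"
      by (simp add: algebra_simps)
  qed simp
next
  case (trans l m k)
  then have d: "distinct m" and s: "set l = set m" by (metis mset_eq_imp_distinct_iff, metis mset_eq_setD)
  obtain c c' where c: "c \<in> {1, -1::int}" "c' \<in> {1, -1::int}"
    and *: "\<forall>u :: 'i \<Rightarrow> 'a. anticommuting_on (set l) u \<longrightarrow>
    prod_list (map u m) = of_int c * prod_list (map u l) \<and> omit_prod u m = of_int c * omit_prod u l"
    and **: "\<forall>u :: 'i \<Rightarrow> 'a. anticommuting_on (set m) u \<longrightarrow>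
    prod_list (map u k) = of_int c' * prod_list (map u m) \<and> omit_prod u k = of_int c' * omit_prod u m"
    using trans.IH(1)[OF trans.prems] trans.IH(2)[OF d] by blast
  show ?case
  proof (rule bexI[of _ "c' * c"], intro allI impI)
    fix u :: "'i \<Rightarrow> 'a" assume "anticommuting_on (set l) u"
    then show "prod_list (map u k) = of_int (c' * c) * prod_list (map u l) \<and>
        omit_prod u k = of_int (c' * c) * omit_prod u l"
      using *[rule_format, of u] **[rule_format, of u] s by (simp add: mult.assoc)
  qed (use c in auto)
qed

lemma anticommute_prod_list:
  assumes "\<And>i. i \<in> set l \<Longrightarrow> a * u i = - (u i * (a::'a::ring_1))"
  shows "a * prod_list (map u l) = (- 1) ^ length l * (prod_list (map u l) * a)"
  using assms
proof (induction l)
  case (Cons b l)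
  have "a * prod_list (map u (b # l)) = - (u b * (a * prod_list (map u l)))"
    using Cons.prems[of b] by (simp add: mult.assoc[symmetric])
  also have "\<dots> = - (u b * ((- 1) ^ length l * (prod_list (map u l) * a)))"
    using Cons by simp
  finally show ?case by (cases "even (length l)") (simp_all add: mult.assoc)
qed simp

lemma anticommute_omit_prod:
  assumes "\<And>i. i \<in> set l \<Longrightarrow> a * u i = - (u i * (a::'a::ring_1))"
  shows "a * omit_prod u l = - ((- 1) ^ length l * (omit_prod u l * a))"
  using assms
proof (induction l)
  case (Cons b l)
  have b: "a * (u b * c) = - (u b * (a * c))" for c
    using Cons.prems[of b] by (simp add: mult.assoc[symmetric])
  have "a * prod_list (map u l) = (- 1) ^ length l * (prod_list (map u l) * a)"
    by (rule anticommute_prod_list) (use Cons.prems in auto)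
  then show ?case using Cons b
    by (cases "even (length l)") (simp_all add: algebra_simps)
qed simp

text \<open>Makes the mixed terms cancel when the recursion for \<open>omit_prod\<close> is squared
  in \<open>omit_prod_square\<close>.\<close>

lemma omit_prod_prod_list_commute:
  assumes "anticommuting_on (set l) u" "distinct l"
  shows "omit_prod u l * prod_list (map u l) = - ((- 1) ^ length l * (prod_list (map u l) * omit_prod u l))"
  using assms
proof (induction l)
  case (Cons a l)
  let ?w = "prod_list (map u l)" and ?w' = "omit_prod u l"
  have a: "u a * u i = - (u i * u a)" if "i \<in> set l" for i
    by (rule anticommuting_onD[OF Cons.prems(1)]) (use that Cons.prems(2) in auto)
  have "anticommuting_on (set l) u" by (rule anticommuting_on_subset[OF Cons.prems(1)]) auto
  with Cons have IH: "?w' * ?w = - ((- 1) ^ length l * (?w * ?w'))" by simp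
  have w: "u a * ?w = (- 1) ^ length l * (?w * u a)" by (rule anticommute_prod_list[OF a])
  have w': "u a * ?w' = - ((- 1) ^ length l * (?w' * u a))" by (rule anticommute_omit_prod[OF a])
  show ?case
  proof (cases "even (length l)")
    case True
    then have 1: "?w * u a = u a * ?w" "?w' * u a = - (u a * ?w')" "?w' * ?w = - (?w * ?w')"
      using w w' IH by simp_all
    have "?w * (u a * c) = u a * (?w * c)" "?w' * (u a * c) = - (u a * (?w' * c))" for c
      using 1 by (metis mult.assoc mult_minus_left)+
    then show ?thesis using True 1 by (simp add: algebra_simps)
  next
    case False
    then have 1: "?w * u a = - (u a * ?w)" "?w' * u a = u a * ?w'" "?w' * ?w = ?w * ?w'"
      using w w' IH by simp_all
    have "?w * (u a * c) = - (u a * (?w * c))" "?w' * (u a * c) = u a * (?w' * c)" for c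
      using 1 by (metis mult.assoc mult_minus_left)+
    then show ?thesis using False 1 by (simp add: algebra_simps)
  qed
qed simp

text \<open>This is (-1)^(n (n - 1) / 2), the sign of reversing n anticommuting factors.\<close>

fun square_sign :: "nat \<Rightarrow> int" where
  "square_sign 0 = 1"
| "square_sign (Suc n) = (- 1) ^ n * square_sign n"

lemma square_sign_cases: "square_sign n = 1 \<or> square_sign n = - 1"
  by (induction n) (auto simp: minus_one_power_iff)

text \<open>Moving the second copy of the first factor next to the first copy passes all other
  factors, which is one step of \<open>square_sign\<close>. The result is the product of the
  squares, the top elementary symmetric function.\<close>

lemma prod_list_square:
  assumes "anticommuting_on (set l) u" "distinct l"
  shows "prod_list (map u l) * prod_list (map u l)
      = of_int (square_sign (length l)) * esym (length l) (map (\<lambda>i. u i * u i) l)"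
  using assms
proof (induction l)
  case (Cons a l)
  let ?w = "prod_list (map u l)"
  have a: "u a * u i = - (u i * u a)" if "i \<in> set l" for i
    by (rule anticommuting_onD[OF Cons.prems(1)]) (use that Cons.prems(2) in auto)
  have "anticommuting_on (set l) u" by (rule anticommuting_on_subset[OF Cons.prems(1)]) auto
  with Cons have IH: "?w * ?w = of_int (square_sign (length l)) * esym (length l) (map (\<lambda>i. u i * u i) l)" by simp
  have w: "u a * ?w = (- 1) ^ length l * (?w * u a)" by (rule anticommute_prod_list[OF a])
  have "(u a * ?w) * (u a * ?w) = (- 1) ^ length l * ((u a * u a) * (?w * ?w))"
  proof -
    have "?w * u a = (- 1) ^ length l * (u a * ?w)" using w by (cases "even (length l)") simp_all
    then show ?thesis by (cases "even (length l)") (simp_all add: mult.assoc, simp_all add: mult.assoc[symmetric])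
  qed
  then show ?case
    using IH square_sign_cases[of "length l"]
    by (cases "even (length l)") (auto simp: esym_eq_0 mult.assoc)
qed simp

text \<open>Without mixed terms the square is w^2 - (-1)^n u_a^2 w'^2, where w is the product and w'
  the alternating sum of the tail, of length n. These two terms are the two terms of the recursion
  for \<open>esym\<close>, with matching signs. The empty list is different: there
  \<open>omit_prod\<close> is 0, while \<open>esym 0\<close> is 1.\<close>

lemma omit_prod_square:
  assumes "anticommuting_on (set l) u" "distinct l" "l \<noteq> []"
  shows "omit_prod u l * omit_prod u l
      = of_int (square_sign (length l - 1)) * esym (length l - 1) (map (\<lambda>i. u i * u i) l)"
  using assms
proof (induction l)
  case (Cons a l)
  let ?w = "prod_list (map u l)" and ?w' = "omit_prod u l" and ?n = "length l"
  let ?e = "\<lambda>k. esym k (map (\<lambda>i. u i * u i) l)"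
  have a: "u a * u i = - (u i * u a)" if "i \<in> set l" for i
    by (rule anticommuting_onD[OF Cons.prems(1)]) (use that Cons.prems(2) in auto)
  have ac: "anticommuting_on (set l) u" by (rule anticommuting_on_subset[OF Cons.prems(1)]) auto
  have d: "distinct l" using Cons.prems by simp
  have w: "u a * ?w = (- 1) ^ length l * (?w * u a)" by (rule anticommute_prod_list[OF a])
  have w': "u a * ?w' = - ((- 1) ^ length l * (?w' * u a))" by (rule anticommute_omit_prod[OF a])
  have ww': "?w' * ?w = - ((- 1) ^ ?n * (?w * ?w'))" by (rule omit_prod_prod_list_commute[OF ac d])
  have *: "(?w - u a * ?w') * (?w - u a * ?w') = ?w * ?w - (- 1) ^ ?n * ((u a * u a) * (?w' * ?w'))"
  proof (cases "even ?n")
    case True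
    then have 1: "?w * u a = u a * ?w" "?w' * u a = - (u a * ?w')" "?w' * ?w = - (?w * ?w')"
      using w w' ww' by simp_all
    have "?w * (u a * c) = u a * (?w * c)" "?w' * (u a * c) = - (u a * (?w' * c))" for c
      using 1 by (metis mult.assoc mult_minus_left)+
    then show ?thesis using True 1 by (simp add: algebra_simps)
  next
    case False
    then have 1: "?w * u a = - (u a * ?w)" "?w' * u a = u a * ?w'" "?w' * ?w = ?w * ?w'"
      using w w' ww' by simp_all
    have "?w * (u a * c) = - (u a * (?w * c))" "?w' * (u a * c) = u a * (?w' * c)" for c
      using 1 by (metis mult.assoc mult_minus_left)+
    then show ?thesis using False 1 by (simp add: algebra_simps)
  qed
  show ?case
  proof (cases l)
    case (Cons b l')
    then obtain m where m: "?n = Suc m" by simp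
    have IH: "?w' * ?w' = of_int (square_sign m) * ?e m" using Cons.IH[OF ac d] Cons m by simp
    have "?w * ?w = of_int (square_sign ?n) * ?e ?n" by (rule prod_list_square[OF ac d])
    then show ?thesis using * IH m square_sign_cases[of m]
      by (cases "even m") (auto simp: mult.assoc)
  qed simp
qed simp

section \<open>Words of transpositions\<close>

definition swaps :: "('v \<times> 'v) list \<Rightarrow> 'v perm" where
  "swaps es = prod_list (map (\<lambda>(i, j). Perm.swap i j) es)"

text \<open>For edges inside \<open>P\<close> these are the unions of connected components of the
  graph \<open>es\<close>, so their number is 2 to the number of components. Set families stand in
  for counts of components and cycles because they are vector spaces over the two-element field
  under symmetric difference.\<close>

definition saturated :: "'v set \<Rightarrow> ('v \<times> 'v) list \<Rightarrow> 'v set set" where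
  "saturated P es = {S. S \<subseteq> P \<and> (\<forall>(i, j)\<in>set es. i \<in> S \<longleftrightarrow> j \<in> S)}"

text \<open>The unions of cycles: if \<open>p\<close> preserves the finite set \<open>P\<close>,
  their number is 2 to the number of cycles on \<open>P\<close>.\<close>

definition invariant_sets :: "'v set \<Rightarrow> 'v perm \<Rightarrow> 'v set set" where
  "invariant_sets P p = {S. S \<subseteq> P \<and> Perm.apply p ` S = S}"

lemma swaps_simps [simp]: "swaps [] = 1" "swaps ((i, j) # es) = Perm.swap i j * swaps es"
  by (simp_all add: swaps_def)

lemma swaps_append: "swaps (es @ fs) = swaps es * swaps fs"
  by (simp add: swaps_def)

lemma apply_swap_image: "Perm.apply (Perm.swap i j) ` S = (if i \<in> S \<longleftrightarrow> j \<in> S then S else if i \<in> S then insert j (S - {i}) else insert i (S - {j}))"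
proof -
  have *: "Perm.apply (Perm.swap i j) k = (if k = i then j else if k = j then i else k)" for k
    by (transfer, simp add: transpose_def)
  show ?thesis by (auto simp: * image_iff)
qed

lemma apply_times_image: "Perm.apply (p * q) ` S = Perm.apply p ` (Perm.apply q ` S)"
  by (simp add: apply_times image_comp)

lemma apply_swap_image_twice: "Perm.apply (Perm.swap i j) ` Perm.apply (Perm.swap i j) ` S = S"
  by (auto simp: apply_swap_image)

lemma apply_inj_on: "inj_on (Perm.apply p) A"
  by (simp add: inj_on_def apply_inj)

lemma saturated_invariant: "S \<in> saturated P es \<Longrightarrow> Perm.apply (swaps es) ` S = S"
proof (induction es)
  case Nil then show ?case by simp
next
  case (Cons e es)
  obtain i j where e: "e = (i, j)" by force
  from Cons have "Perm.apply (swaps es) ` S = S" by (auto simp: saturated_def)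
  moreover have "i \<in> S \<longleftrightarrow> j \<in> S" using Cons.prems by (auto simp: saturated_def e)
  ultimately show ?case by (simp add: e apply_times_image apply_swap_image)
qed

lemma finite_saturated: "finite P \<Longrightarrow> finite (saturated P es)"
  by (rule finite_subset[of _ "Pow P"]) (auto simp: saturated_def)

lemma finite_invariant_sets: "finite P \<Longrightarrow> finite (invariant_sets P p)"
  by (rule finite_subset[of _ "Pow P"]) (auto simp: invariant_sets_def)

lemma sym_diff_saturated: "S \<in> saturated P es \<Longrightarrow> T \<in> saturated P es \<Longrightarrow> sym_diff S T \<in> saturated P es"
  by (auto simp: saturated_def)

lemma sym_diff_invariant:
  "S \<in> invariant_sets P p \<Longrightarrow> T \<in> invariant_sets P p \<Longrightarrow> sym_diff S T \<in> invariant_sets P p"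
  unfolding invariant_sets_def
  by (simp add: image_Un image_set_diff[OF apply_inj_on]) blast

lemma inj_sym_diff: "inj_on (\<lambda>S. sym_diff S C) A"
  by (rule inj_onI) blast

text \<open>The hyperplane argument of linear algebra over the two-element field, for set families.\<close>
lemma card_le_twice:
  assumes "finite F" "\<And>S T. S \<in> F \<Longrightarrow> T \<in> F \<Longrightarrow> \<not> Q S \<Longrightarrow> \<not> Q T \<Longrightarrow> sym_diff S T \<in> F \<and> Q (sym_diff S T)"
  shows "card F \<le> 2 * card {S\<in>F. Q S}"
proof (cases "\<exists>C\<in>F. \<not> Q C")
  case True
  then obtain C where C: "C \<in> F" "\<not> Q C" by auto
  have "card {S\<in>F. \<not> Q S} \<le> card {S\<in>F. Q S}"
    by (rule card_inj_on_le[OF inj_sym_diff[of C]]) (use C assms in auto)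
  moreover have "card F = card {S\<in>F. Q S} + card {S\<in>F. \<not> Q S}"
    by (subst card_Un_disjoint[symmetric]) (auto simp: assms(1) intro: arg_cong[where f=card])
  ultimately show ?thesis by simp
next
  case False
  then have "{S\<in>F. Q S} = F" by auto
  then show ?thesis by simp
qed

text \<open>In exponents of 2: |P| + cycles <= letters + 2 * components, the Riemann-Hurwitz
  inequality (the genus is not negative). A new letter inside a component creates at most one cycle;
  a letter linking two components merges two cycles.\<close>

lemma transposition_word_bound:
  assumes "finite P" "\<And>i j. (i, j) \<in> set es \<Longrightarrow> i \<in> P \<and> j \<in> P"
  shows "2 ^ card P * card (invariant_sets P (swaps es)) \<le> 2 ^ length es * card (saturated P es) ^ 2"
  using assms(2)
proof (induction es)
  case Nil
  have "invariant_sets P 1 = Pow P" "saturated P [] = Pow P"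
    by (auto simp: invariant_sets_def saturated_def)
  then show ?case using assms(1) by (simp add: card_Pow power2_eq_square)
next
  case (Cons e es)
  obtain i j where e: "e = (i, j)" by force
  let ?p = "swaps es" and ?F = "saturated P es" and ?Q = "\<lambda>S. i \<in> S \<longleftrightarrow> j \<in> S"
  let ?I = "invariant_sets P ?p" and ?I' = "invariant_sets P (swaps (e # es))"
  have IH: "2 ^ card P * card ?I \<le> 2 ^ length es * card ?F ^ 2" using Cons by auto
  have F': "saturated P (e # es) = {S\<in>?F. ?Q S}" by (auto simp: saturated_def e)
  have I'Q: "{S\<in>?I'. ?Q S} = {S\<in>?I. ?Q S}"
  proof -
    \<comment> \<open>A set that does not separate \<open>i\<close> from \<open>j\<close> is fixed
      by their exchange, so for such sets the longer and the shorter word impose the same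
      condition.\<close>
    have *: "Perm.apply (Perm.swap i j) ` T = S \<longleftrightarrow> T = S" if "?Q S" for S T
    proof -
      from that have "Perm.apply (Perm.swap i j) ` S = S" by (simp add: apply_swap_image)
      then show ?thesis by (metis apply_swap_image_twice)
    qed
    have "S \<in> ?I' \<longleftrightarrow> S \<in> ?I" if "?Q S" for S
      unfolding invariant_sets_def e swaps_simps apply_times_image mem_Collect_eq *[OF that] ..
    then show ?thesis by blast
  qed
  have fin: "finite ?F" "finite ?I" "finite ?I'" using assms(1) by (auto intro: finite_saturated finite_invariant_sets)
  show ?case
  proof (cases "\<forall>S\<in>?F. ?Q S")
    \<comment> \<open>The new edge stays within a component: the saturated sets are unchanged, and
      the extra letter pays for an at most doubled number of invariant sets.\<close>
    case True
    then have "saturated P (e # es) = ?F" using F' by auto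
    moreover have "card ?I' \<le> 2 * card {S\<in>?I'. ?Q S}"
      by (rule card_le_twice[OF fin(3)]) (intro conjI sym_diff_invariant; blast)
    moreover have "card {S\<in>?I'. ?Q S} \<le> card ?I"
      unfolding I'Q by (rule card_mono) (use fin in auto)
    ultimately have 1: "card ?I' \<le> 2 * card ?I" and 2: "saturated P (e # es) = ?F" by simp_all
    have "2 ^ card P * card ?I' \<le> 2 ^ card P * (2 * card ?I)" using 1 by (rule mult_le_mono2)
    also have "\<dots> \<le> 2 * (2 ^ length es * card ?F ^ 2)" using IH by simp
    finally show ?thesis unfolding 2 by simp
  next
    \<comment> \<open>The new edge links two components, separated by the saturated set
      \<open>C\<close>. The saturated sets may drop to half, so their squared number may lose a
      factor 4. The new letter regains only 2, and the missing factor 2 comes from the invariant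
      sets, which also drop to half or less.\<close>
    case False
    then obtain C where C: "C \<in> ?F" "\<not> ?Q C" by auto
    have pC: "Perm.apply ?p ` C = C" by (rule saturated_invariant[OF C(1)])
    have CP: "C \<subseteq> P" using C(1) by (simp add: saturated_def)
    have Q: "?Q S" if "S \<in> ?I'" for S
    proof (rule ccontr)
      \<comment> \<open>The shorter word preserves \<open>C\<close>, hence also the size of a set's
        intersection with \<open>C\<close>. But exchanging \<open>i\<close> and \<open>j\<close>
        changes the size of \<open>S \<inter> C\<close> by one, since \<open>C\<close> and
        \<open>S\<close> each contain exactly one of the two.\<close>
      assume nQ: "\<not> ?Q S"
      from that have S: "S \<subseteq> P" "Perm.apply (Perm.swap i j) ` Perm.apply ?p ` S = S"
        unfolding invariant_sets_def e swaps_simps apply_times_image by blast+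
      then have "Perm.apply ?p ` S = Perm.apply (Perm.swap i j) ` S"
        by (metis apply_swap_image_twice)
      then have "Perm.apply ?p ` (S \<inter> C) = Perm.apply (Perm.swap i j) ` S \<inter> C"
        using pC by (simp add: image_Int[OF apply_inj_on])
      then have "card (Perm.apply (Perm.swap i j) ` S \<inter> C) = card (S \<inter> C)"
        by (metis apply_inj_on card_image inj_on_subset subset_UNIV)
      moreover have "finite (S \<inter> C)" using CP assms(1) by (meson finite_Int finite_subset)
      moreover have "Perm.apply (Perm.swap i j) ` S \<inter> C =
          (if i \<in> S then (if i \<in> C then (S \<inter> C) - {i} else insert j (S \<inter> C))
           else (if i \<in> C then insert i (S \<inter> C) else (S \<inter> C) - {j}))"
        using nQ C(2) by (auto simp: apply_swap_image)
      ultimately show False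
        using nQ C(2) card_Diff1_less[of "S \<inter> C" i] card_Diff1_less[of "S \<inter> C" j]
        by (cases "i \<in> S"; cases "i \<in> C") simp_all
    qed
    then have I': "?I' = {S\<in>?I. ?Q S}" using I'Q by blast
    have "card ?F \<le> 2 * card (saturated P (e # es))"
      unfolding F' by (rule card_le_twice[OF fin(1)]) (intro conjI sym_diff_saturated; blast)
    then have "card ?F ^ 2 \<le> (2 * card (saturated P (e # es))) ^ 2" by (rule power_mono) simp
    then have 1: "2 ^ length es * card ?F ^ 2 \<le> 2 ^ length es * (4 * card (saturated P (e # es)) ^ 2)"
      by (simp add: power_mult_distrib)
    have "2 * card ?I' \<le> card ?I"
    proof -
      have "card {S\<in>?I. ?Q S} \<le> card {S\<in>?I. \<not> ?Q S}"
      proof (rule card_inj_on_le[OF inj_sym_diff[of C]])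
        have "C \<in> ?I" using CP pC by (simp add: invariant_sets_def)
        then show "(\<lambda>S. sym_diff S C) ` {S\<in>?I. ?Q S} \<subseteq> {S\<in>?I. \<not> ?Q S}"
          using C(2) sym_diff_invariant[of _ P "swaps es" C] by blast
      qed (use fin in auto)
      moreover have "card ?I = card {S\<in>?I. ?Q S} + card {S\<in>?I. \<not> ?Q S}"
        by (subst card_Un_disjoint[symmetric]) (auto simp: fin intro: arg_cong[where f=card])
      ultimately show ?thesis using I' by simp
    qed
    then have "2 ^ card P * (2 * card ?I') \<le> 2 ^ card P * card ?I" by simp
    then have "2 ^ card P * (2 * card ?I') \<le> 2 ^ length es * (4 * card (saturated P (e # es)) ^ 2)"
      using 1 IH by linarith
    then show ?thesis by simp
  qed
qed

text \<open>Connectedness leaves two saturated sets and the identity leaves every subset invariant,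
  so the general bound reads 2^(2 |P|) <= 2^(length + 2). It is attained by the edges of a spanning
  tree followed by the same edges in reverse order.\<close>

corollary transitive_factorization_length:
  assumes "finite P" "P \<noteq> {}" "\<And>i j. (i, j) \<in> set es \<Longrightarrow> i \<in> P \<and> j \<in> P"
    and "swaps es = 1" and "\<And>S. S \<in> saturated P es \<Longrightarrow> S = {} \<or> S = P"
  shows "2 * card P - 2 \<le> length es"
proof -
  have "saturated P es = {{}, P}"
    using assms(3,5) by (auto simp: saturated_def)
  then have "card (saturated P es) = 2" using assms(2) by simp
  moreover have "invariant_sets P 1 = Pow P" by (auto simp: invariant_sets_def)
  ultimately have "2 ^ card P * 2 ^ card P \<le> 2 ^ length es * (2::nat) ^ 2"
    using transposition_word_bound[OF assms(1), of es] assms by (simp add: card_Pow)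
  then have "(2::nat) ^ (2 * card P) \<le> 2 ^ (length es + 2)" by (simp add: power_add mult_2)
  then have "2 * card P \<le> length es + 2" by (subst (asm) power_increasing_iff) auto
  then show ?thesis by simp
qed

section \<open>Operators on functions\<close>

text \<open>Since only additivity is demanded, what commutes with an arbitrary operator is
  multiplication by integers. This is why the scalars that are to separate permutations are
  integers.\<close>

typedef (overloaded) ('i, 'a) operator =
    "{f :: ('i \<Rightarrow> 'a::ring_1) \<Rightarrow> 'i \<Rightarrow> 'a. \<forall>x y. f (\<lambda>i. x i + y i) = (\<lambda>i. f x i + f y i)}"
  morphisms ap Operator
  by (rule exI[of _ "\<lambda>x. x"]) simp

setup_lifting type_definition_operator

instantiation operator :: (type, ring_1) ring_1
begin

lift_definition zero_operator :: "('a, 'b) operator" is "\<lambda>x i. 0" by simp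
lift_definition one_operator :: "('a, 'b) operator" is "\<lambda>x. x" by simp
lift_definition plus_operator :: "('a, 'b) operator \<Rightarrow> ('a, 'b) operator \<Rightarrow> ('a, 'b) operator"
  is "\<lambda>f g x i. f x i + g x i" by (simp add: algebra_simps)
lift_definition minus_operator :: "('a, 'b) operator \<Rightarrow> ('a, 'b) operator \<Rightarrow> ('a, 'b) operator"
  is "\<lambda>f g x i. f x i - g x i" by (simp add: algebra_simps)
lift_definition uminus_operator :: "('a, 'b) operator \<Rightarrow> ('a, 'b) operator"
  is "\<lambda>f x i. - f x i" by (simp add: algebra_simps)
lift_definition times_operator :: "('a, 'b) operator \<Rightarrow> ('a, 'b) operator \<Rightarrow> ('a, 'b) operator"
  is "\<lambda>f g x. f (g x)" by simp

instance
proof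
  show "(0::('a, 'b) operator) \<noteq> 1"
    by transfer (auto simp: fun_eq_iff intro!: exI[of _ "\<lambda>_. 1"])
qed (transfer; simp add: fun_eq_iff algebra_simps)+

end

lemmas ap_simps [simp] = zero_operator.rep_eq one_operator.rep_eq plus_operator.rep_eq
  minus_operator.rep_eq uminus_operator.rep_eq times_operator.rep_eq

lemma ap_add: "ap f (\<lambda>i. x i + y i) = (\<lambda>i. ap f x i + ap f y i)"
  by transfer simp

lemma ap_zero [simp]: "ap f (\<lambda>i. 0) = (\<lambda>i. 0)"
  using ap_add[of f "\<lambda>_. 0" "\<lambda>_. 0"] by (simp add: fun_eq_iff)

lemma ap_sum: "ap (sum f A) F p = (\<Sum>a\<in>A. ap (f a) F p)"
  by (induction A rule: infinite_finite_induct) auto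

lemma operator_eqI: "(\<And>F p. ap f F p = ap g F p) \<Longrightarrow> f = g"
  by (simp add: ap_inject[symmetric] fun_eq_iff)

text \<open>Weighted substitution. In a product of such operators the leftmost point map acts first,
  so a point travels along a word in the order in which the word is written.\<close>

lift_definition pull :: "('i \<Rightarrow> 'a::ring_1) \<Rightarrow> ('i \<Rightarrow> 'i) \<Rightarrow> ('i, 'a) operator"
  is "\<lambda>c f F i. c i * F (f i)" by (simp add: algebra_simps)

lemmas ap_pull [simp] = pull.rep_eq

text \<open>A point consists of a permutation, whose values are the scalars of the \<open>opZ\<close>; of a family of index
  sets, from which each \<open>x i j\<close> removes those separating \<open>i\<close> from \<open>j\<close>; and of a basis index of a Clifford module.\<close>
type_synonym point = "nat perm \<times> nat set set \<times> nat set"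

text \<open>The Jordan-Wigner sign, which makes the toggling operators \<open>opC\<close>
  anticommute.\<close>

definition sgn_below :: "nat \<Rightarrow> nat set \<Rightarrow> 'a::ring_1" where
  "sgn_below m b = (- 1) ^ card {s\<in>b. s < m}"

definition opL :: "'a \<Rightarrow> (point, 'a::ring_1) operator" where
  "opL a = pull (\<lambda>_. a) (\<lambda>p. p)"
definition opC :: "nat \<Rightarrow> (point, 'a::ring_1) operator" where
  "opC m = pull (\<lambda>(v, A, b). sgn_below m b) (\<lambda>(v, A, b). (v, A, sym_diff b {m}))"
text \<open>The grading sign of one index. It anticommutes with \<open>opC m\<close> alone among the
  \<open>opC\<close>, and so yields a second family of Clifford generators.\<close>

definition opN :: "nat \<Rightarrow> (point, 'a::ring_1) operator" where
  "opN m = pull (\<lambda>(v, A, b). if m \<in> b then - 1 else 1) (\<lambda>p. p)"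
definition opS :: "nat \<Rightarrow> nat \<Rightarrow> (point, 'a::ring_1) operator" where
  "opS i j = pull (\<lambda>_. 1) (\<lambda>(v, A, b). (v * Perm.swap i j, A, b))"
definition opH :: "nat \<Rightarrow> nat \<Rightarrow> (point, 'a::ring_1) operator" where
  "opH i j = pull (\<lambda>_. 1) (\<lambda>(v, A, b). (v, A \<inter> {S. i \<in> S \<longleftrightarrow> j \<in> S}, b))"
definition opZ :: "nat \<Rightarrow> (point, 'a::ring_1) operator" where
  "opZ k = pull (\<lambda>(v, A, b). of_nat (Perm.apply v k)) (\<lambda>p. p)"
definition opM :: "(nat perm \<Rightarrow> nat set set \<Rightarrow> bool) \<Rightarrow> (point, 'a::ring_1) operator" where
  "opM Q = pull (\<lambda>(v, A, b). if Q v A then 1 else 0) (\<lambda>p. p)"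
text \<open>Commutes with the lifted \<open>x\<close> and z, so that a statement about points with
  the family \<open>UNIV\<close> carries over to every family.\<close>

definition opR :: "nat set set \<Rightarrow> (point, 'a::ring_1) operator" where
  "opR A' = pull (\<lambda>_. 1) (\<lambda>(v, A, b). (v, A \<inter> A', b))"

lemmas op_defs = opL_def opC_def opN_def opS_def opH_def opZ_def opM_def opR_def

lemma sgn_below_square [simp]: "sgn_below m b * sgn_below m b = (1::'a::ring_1)"
  by (simp add: sgn_below_def power_mult_distrib[symmetric] minus_one_power_iff)

lemma sgn_below_flip: "sgn_below k (sym_diff b {m}) = (if m < k then - sgn_below k b else (sgn_below k b :: 'a::ring_1))"
proof -
  have fin: "finite {s\<in>b. s < k}" by simp
  show ?thesis
  proof (cases "m < k")
    case mk: True
    show ?thesis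
    proof (cases "m \<in> b")
      case True
      then have eq: "{s\<in>sym_diff b {m}. s < k} = {s\<in>b. s < k} - {m}" by auto
      have "card {s\<in>b. s < k} = Suc (card ({s\<in>b. s < k} - {m}))"
        using mk True fin by (subst card_Suc_Diff1) auto
      then show ?thesis using mk by (simp only: sgn_below_def eq) simp
    next
      case False
      then have eq: "{s\<in>sym_diff b {m}. s < k} = insert m {s\<in>b. s < k}" using mk by auto
      have "card (insert m {s\<in>b. s < k}) = Suc (card {s\<in>b. s < k})"
        using False fin by simp
      then show ?thesis using mk by (simp only: sgn_below_def eq) simp
    qed
  next
    case False
    then have "{s\<in>sym_diff b {m}. s < k} = {s\<in>b. s < k}" by auto
    then show ?thesis using False by (simp add: sgn_below_def)
  qed
qed

lemma sgn_below_commute: "sgn_below m b * a = a * (sgn_below m b :: 'a::ring_1)"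
  by (simp add: sgn_below_def minus_one_power_iff)

lemma opC_square [simp]: "opC m * opC m = 1"
proof (rule operator_eqI)
  fix F :: "point \<Rightarrow> 'a" and p :: point
  obtain v A b where p: "p = (v, A, b)" by (cases p)
  have "sym_diff (sym_diff b {m}) {m} = b" by blast
  then show "ap (opC m * opC m) F p = ap 1 F p"
    by (simp add: opC_def p sgn_below_flip mult.assoc[symmetric])
qed

lemma opC_anticommute: "m \<noteq> k \<Longrightarrow> opC m * opC k = - (opC k * opC m)"
proof (rule operator_eqI)
  fix F :: "point \<Rightarrow> 'a" and p :: point
  assume "m \<noteq> k"
  obtain v A b where p: "p = (v, A, b)" by (cases p)
  have "sym_diff (sym_diff b {m}) {k} = sym_diff (sym_diff b {k}) {m}" by blast
  then show "ap (opC m * opC k) F p = ap (- (opC k * opC m)) F p"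
    using \<open>m \<noteq> k\<close> sgn_below_commute[of m b "sgn_below k b :: 'a"]
    by (cases "m < k") (simp_all add: opC_def p sgn_below_flip mult.assoc[symmetric])
qed

lemma op_commute:
  "opC m * opL a = opL a * opC m"
  "opN m * opL a = opL a * opN m"
  "opS i j * opN m = opN m * opS i j"
  "opH i j * opN m = opN m * opH i j"
  "opN m * opZ k = opZ k * opN m"
  "opM Q * opN m = opN m * opM Q"
  "opR A * opN m = opN m * opR A"
  "opS i j * opL a = opL a * opS i j"
  "opH i j * opL a = opL a * opH i j"
  "opZ k * opL a = opL a * opZ k"
  "opM Q * opL a = opL a * opM Q"
  "opR A * opL a = opL a * opR A"
  "opS i j * opC m = opC m * opS i j"
  "opH i j * opC m = opC m * opH i j"
  "opC m * opZ k = opZ k * opC m"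
  "opM Q * opC m = opC m * opM Q"
  "opR A * opC m = opC m * opR A"
  "opH k l * opS i j = opS i j * opH k l"
  "opR A * opS i j = opS i j * opR A"
  "opH i j * opZ k = opZ k * opH i j"
  "opR A * opH i j = opH i j * opR A"
  "opR A * opZ k = opZ k * opR A"
  "opM Q * opZ k = opZ k * opM Q"
  by (rule operator_eqI;
      auto simp: op_defs sgn_below_def minus_one_power_iff mult.assoc[symmetric] mult_of_nat_commute Int_ac)+

lemma opN_square [simp]: "opN m * opN m = 1"
  and opN_commute: "opN m * opN k = opN k * opN m"
  and opC_opN: "opC m * opN k = (if m = k then - (opN k * opC m) else opN k * opC m)"
  by (rule operator_eqI; auto simp: op_defs)+

text \<open>The square \<open>- 1\<close>, in place of \<open>1\<close>, is what gives the operators \<open>opT i j\<close> below a common eigenvector.\<close>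
definition opC' :: "nat \<Rightarrow> (point, 'a::ring_1) operator" where
  "opC' m = opN m * opC m"

lemma opC'_square: "opC' m * opC' m = - 1"
proof -
  have "opC m * (opN m * b) = - (opN m * (opC m * b))" for b :: "(point, 'a) operator"
    by (simp add: opC_opN mult.assoc[symmetric])
  moreover have "opN m * (opN m * b) = b" for b :: "(point, 'a) operator"
    by (simp add: mult.assoc[symmetric])
  ultimately show ?thesis by (simp add: opC'_def mult.assoc)
qed

lemma opC'_opC: "opC' m * opC k = - (opC k * opC' m)"
proof (cases "m = k")
  case False
  have "opC k * (opN m * b) = opN m * (opC k * b)" for b :: "(point, 'a) operator"
    using False by (simp add: opC_opN mult.assoc[symmetric])
  then show ?thesis using False by (simp add: opC'_def mult.assoc opC_anticommute[of m k])
next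
  case True
  have "opC k * (opN k * b) = - (opN k * (opC k * b))" for b :: "(point, 'a) operator"
    by (simp add: opC_opN mult.assoc[symmetric])
  then show ?thesis using True by (simp add: opC'_def mult.assoc)
qed

lemma opC'_anticommute: "m \<noteq> k \<Longrightarrow> opC' m * opC' k = - (opC' k * opC' m)"
proof -
  assume mk: "m \<noteq> k"
  have "opC m * (opN k * b) = opN k * (opC m * b)" "opC k * (opN m * b) = opN m * (opC k * b)"
    "opN k * (opN m * b) = opN m * (opN k * b)" for b :: "(point, 'a) operator"
    using mk by (simp_all only: mult.assoc[symmetric] opC_opN opN_commute[of k m]) simp_all
  then show ?thesis using mk by (simp add: opC'_def mult.assoc opC_anticommute[of m k])
qed

lemma opS_opZ: "opS i j * opZ k = opZ (Perm.apply (Perm.swap i j) k) * opS i j"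
  by (rule operator_eqI) (auto simp: op_defs apply_times)

lemma opL_mult: "opL a * opL b = opL (a * b)" and opL_add: "opL (a + b) = opL a + opL b"
  and opL_zero [simp]: "opL 0 = 0" and opL_uminus: "opL (- a) = - opL a"
  by (rule operator_eqI; simp add: op_defs algebra_simps)+

section \<open>The equivariant deformation\<close>

locale quadratic_relations =
  fixes x :: "nat \<Rightarrow> nat \<Rightarrow> 'a::ring_1"
  assumes sym: "x i j = x j i"
    and square_zero: "i \<noteq> j \<Longrightarrow> x i j * x i j = 0"
    and disjoint_anticommute: "distinct [i, j, k, l] \<Longrightarrow> x i j * x k l = - (x k l * x i j)"
    and triangle: "distinct [i, j, k] \<Longrightarrow> x i j * x j k + x j k * x k i + x k i * x i j = 0"
begin

definition dunkl :: "nat set \<Rightarrow> nat \<Rightarrow> 'a" where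
  "dunkl P i = (\<Sum>j\<in>P - {i}. x i j)"

text \<open>Products with four different indices cancel by \<open>disjoint_anticommute\<close>.
  Those that share a third index k combine with the mixed terms in \<open>x i j\<close> to two
  triangle relations, one for (i, j, k) and one for (j, i, k).\<close>

lemma dunkl_anticommute:
  assumes P: "finite P" "i \<in> P" "j \<in> P" "i \<noteq> j"
  shows "dunkl P i * dunkl P j + dunkl P j * dunkl P i = 0"
proof -
  define Q where "Q = P - {i, j}"
  have fin: "finite Q" using P by (simp add: Q_def)
  have Q: "i \<notin> Q" "j \<notin> Q" by (auto simp: Q_def)
  have "P - {i} = insert j Q" "P - {j} = insert i Q" using P by (auto simp: Q_def)
  then have d: "dunkl P i = x i j + (\<Sum>k\<in>Q. x i k)" "dunkl P j = x i j + (\<Sum>k\<in>Q. x j k)"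
    using fin Q by (simp_all add: dunkl_def sym[of j i])
  have "(\<Sum>k\<in>Q. x i k) * (\<Sum>l\<in>Q. x j l) + (\<Sum>k\<in>Q. x j k) * (\<Sum>l\<in>Q. x i l)
      = (\<Sum>k\<in>Q. \<Sum>l\<in>Q. x i k * x j l + x j l * x i k)"
  proof -
    have "(\<Sum>k\<in>Q. x j k) * (\<Sum>l\<in>Q. x i l) = (\<Sum>k\<in>Q. \<Sum>l\<in>Q. x j l * x i k)"
      unfolding sum_product by (rule sum.swap)
    then show ?thesis by (simp add: sum_product sum.distrib)
  qed
  also have "\<dots> = (\<Sum>k\<in>Q. \<Sum>l\<in>Q. if l = k then x i k * x j k + x j k * x i k else 0)"
  proof (intro sum.cong refl)
    fix k l assume "k \<in> Q" "l \<in> Q"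
    then show "x i k * x j l + x j l * x i k = (if l = k then x i k * x j k + x j k * x i k else 0)"
    proof (cases "l = k")
      case False
      then have "distinct [i, k, j, l]" using Q P \<open>k \<in> Q\<close> \<open>l \<in> Q\<close> by auto
      from disjoint_anticommute[OF this] False show ?thesis by simp
    qed simp
  qed
  also have "\<dots> = (\<Sum>k\<in>Q. x i k * x j k + x j k * x i k)" using fin by simp
  finally have "dunkl P i * dunkl P j + dunkl P j * dunkl P i
      = (\<Sum>k\<in>Q. (x i j * x j k + x j k * x i k + x i k * x i j) + (x i j * x i k + x i k * x j k + x j k * x i j))"
    unfolding d using square_zero[OF P(4)]
    by (simp add: algebra_simps sum.distrib sum_distrib_left sum_distrib_right)
  also have "\<dots> = 0"
  proof (intro sum.neutral ballI)
    fix k assume "k \<in> Q"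
    then have "distinct [i, j, k]" "distinct [j, i, k]" using P Q by auto
    from this[THEN triangle]
    show "(x i j * x j k + x j k * x i k + x i k * x i j) + (x i j * x i k + x i k * x j k + x j k * x i j) = 0"
      by (simp only: sym[of j i] sym[of k i] sym[of k j] add_0_left)
  qed
  finally show ?thesis .
qed

lemma dunkl_disjoint_anticommute:
  assumes "P \<inter> Q = {}" "i \<in> P" "j \<in> Q"
  shows "dunkl P i * dunkl Q j + dunkl Q j * dunkl P i = 0"
proof -
  have "dunkl Q j * dunkl P i = (\<Sum>k\<in>P - {i}. \<Sum>l\<in>Q - {j}. x j l * x i k)"
    unfolding dunkl_def sum_product by (rule sum.swap)
  then have "dunkl P i * dunkl Q j + dunkl Q j * dunkl P i
      = (\<Sum>k\<in>P - {i}. \<Sum>l\<in>Q - {j}. x i k * x j l + x j l * x i k)"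
    by (simp add: dunkl_def sum_product sum.distrib)
  also have "\<dots> = 0"
  proof (intro sum.neutral ballI)
    fix k l assume "k \<in> P - {i}" "l \<in> Q - {j}"
    then have "distinct [i, k, j, l]" using assms by auto
    from disjoint_anticommute[OF this] show "x i k * x j l + x j l * x i k = 0" by simp
  qed
  finally show ?thesis .
qed

end

locale equivariant_relations = quadratic_relations x for x :: "nat \<Rightarrow> nat \<Rightarrow> 'a::ring_1" +
  fixes z :: "nat \<Rightarrow> 'a"
  assumes z_anticommute: "i \<noteq> j \<Longrightarrow> z i * z j = - (z j * z i)"
    and x_z: "i \<noteq> j \<Longrightarrow> x i j * z k = - (z (Perm.apply (Perm.swap i j) k) * x i j)"
begin

lemma x_z_same: "i \<noteq> j \<Longrightarrow> x i j * z i = - (z j * x i j)" "i \<noteq> j \<Longrightarrow> x i j * z j = - (z i * x i j)"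
  and x_z_other: "i \<noteq> j \<Longrightarrow> k \<noteq> i \<Longrightarrow> k \<noteq> j \<Longrightarrow> x i j * z k = - (z k * x i j)"
  by (simp_all add: x_z)

lemma z_dunkl_disjoint:
  assumes "i \<notin> P" "j \<in> P"
  shows "z i * dunkl P j + dunkl P j * z i = 0"
proof -
  have "z i * dunkl P j + dunkl P j * z i = (\<Sum>k\<in>P - {j}. z i * x j k + x j k * z i)"
    by (simp add: dunkl_def sum_distrib_left sum_distrib_right sum.distrib)
  also have "\<dots> = 0"
  proof (intro sum.neutral ballI)
    fix k assume "k \<in> P - {j}"
    then have "x j k * z i = - (z i * x j k)" by (intro x_z_other) (use assms in auto)
    then show "z i * x j k + x j k * z i = 0" by simp
  qed
  finally show ?thesis .
qed

text \<open>Only the summand \<open>x j i\<close> fails to anticommute with \<open>z i\<close>. The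
  result changes sign when \<open>i\<close> and \<open>j\<close> are exchanged, and this cancels the
  linear coefficient in \<open>deformed_anticommute\<close>.\<close>

lemma z_dunkl:
  assumes "finite P" "i \<in> P" "j \<in> P" "i \<noteq> j"
  shows "z i * dunkl P j + dunkl P j * z i = (z i - z j) * x i j"
proof -
  have P: "P - {j} = insert i (P - {i, j})" using assms by auto
  have d: "dunkl P j = x i j + (\<Sum>k\<in>P - {i, j}. x j k)"
    unfolding dunkl_def P using assms by (simp add: sym[of j i])
  have "z i * (\<Sum>k\<in>P - {i, j}. x j k) + (\<Sum>k\<in>P - {i, j}. x j k) * z i
      = (\<Sum>k\<in>P - {i, j}. z i * x j k + x j k * z i)"
    by (simp add: sum_distrib_left sum_distrib_right sum.distrib)
  also have "\<dots> = 0"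
  proof (intro sum.neutral ballI)
    fix k assume "k \<in> P - {i, j}"
    then have "x j k * z i = - (z i * x j k)" by (intro x_z_other) (use assms in auto)
    then show "z i * x j k + x j k * z i = 0" by simp
  qed
  finally show ?thesis unfolding d using x_z_same(1)[OF assms(4)] by (simp add: algebra_simps)
qed

lemma z_dunkl_self: "z i * dunkl P i + dunkl P i * z i = (\<Sum>j\<in>P - {i}. (z i - z j) * x i j)"
proof -
  have "z i * dunkl P i + dunkl P i * z i = (\<Sum>k\<in>P - {i}. z i * x i k + x i k * z i)"
    by (simp add: dunkl_def sum_distrib_left sum_distrib_right sum.distrib)
  also have "\<dots> = (\<Sum>j\<in>P - {i}. (z i - z j) * x i j)"
    by (intro sum.cong refl) (auto simp: x_z_same algebra_simps)
  finally show ?thesis .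
qed

text \<open>\<open>fps_X\<close> is the parameter h, so the coefficient index counts the letters
  \<open>x i j\<close>. The index set is a parameter because the induction compares the deformation
  on \<open>P\<close> with those on two complementary blocks.\<close>

definition deformed :: "nat set \<Rightarrow> nat \<Rightarrow> 'a fps" where
  "deformed P i = fps_const (z i) + fps_X * fps_const (dunkl P i)"

lemma deformed_nth: "fps_nth (deformed P i) 0 = z i" "fps_nth (deformed P i) (Suc 0) = dunkl P i" "fps_nth (deformed P i) (Suc (Suc d)) = 0"
  by (simp_all add: deformed_def)

lemma deformed_product:
  "deformed P i * deformed Q j = fps_const (z i * z j) + fps_X * fps_const (z i * dunkl Q j + dunkl P i * z j)
     + fps_X * (fps_X * fps_const (dunkl P i * dunkl Q j))"
proof -
  have X: "fps_const a * (fps_X * b) = fps_X * (fps_const a * b)" for a :: 'a and b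
    by (metis fps_mult_fps_X_commute mult.assoc)
  show ?thesis
    by (simp add: deformed_def algebra_simps X flip: fps_const_add fps_const_mult)
qed

lemma deformed_anticommute_aux:
  assumes "i \<noteq> j" "z i * dunkl Q j + dunkl Q j * z i + (z j * dunkl P i + dunkl P i * z j) = 0"
    and "dunkl P i * dunkl Q j + dunkl Q j * dunkl P i = 0"
  shows "deformed P i * deformed Q j = - (deformed Q j * deformed P i)"
proof -
  have 1: "z i * dunkl Q j + dunkl P i * z j = - (z j * dunkl P i + dunkl Q j * z i)"
    using assms(2) by (simp add: eq_neg_iff_add_eq_0 algebra_simps)
  have 2: "dunkl P i * dunkl Q j = - (dunkl Q j * dunkl P i)"
    using assms(3) by (simp add: eq_neg_iff_add_eq_0)
  have "fps_const (- a) + fps_X * fps_const (- b) + fps_X * (fps_X * fps_const (- c))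
      = - (fps_const a + fps_X * fps_const b + fps_X * (fps_X * fps_const c))" for a b c :: 'a
    by (simp flip: fps_const_neg)
  then show ?thesis
    unfolding deformed_product 1 2 z_anticommute[OF assms(1)] .
qed

lemma deformed_anticommute:
  assumes "finite P" "i \<in> P" "j \<in> P" "i \<noteq> j"
  shows "deformed P i * deformed P j = - (deformed P j * deformed P i)"
proof (rule deformed_anticommute_aux[OF assms(4)])
  show "z i * dunkl P j + dunkl P j * z i + (z j * dunkl P i + dunkl P i * z j) = 0"
    using assms(4) unfolding z_dunkl[OF assms] z_dunkl[OF assms(1,3,2) assms(4)[THEN not_sym]] sym[of j i]
    by (simp add: left_diff_distrib)
qed (rule dunkl_anticommute[OF assms])

lemma deformed_disjoint_anticommute:
  assumes "P \<inter> Q = {}" "i \<in> P" "j \<in> Q"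
  shows "deformed P i * deformed Q j = - (deformed Q j * deformed P i)"
proof (rule deformed_anticommute_aux)
  have "i \<notin> Q" "j \<notin> P" using assms by auto
  then show "z i * dunkl Q j + dunkl Q j * z i + (z j * dunkl P i + dunkl P i * z j) = 0"
    using z_dunkl_disjoint assms by simp
qed (use assms dunkl_disjoint_anticommute in auto)

text \<open>By \<open>z_dunkl_self\<close> the linear coefficient of the square is a sum of products
  (z i - z j) * x i j, and the quadratic one is the square of a sum of \<open>x i j\<close>. A sign
  \<open>c\<close> produced by each factor thus occurs twice and disappears. The undeformed
  expressions in m factors enter as \<open>w\<close>, with \<open>c\<close> equal to -(-1)^m for the
  product, (-1)^m for the alternating sum and 1 for the symmetric functions.\<close>

lemma deformed_square_commute:
  assumes c: "c = 1 \<or> c = - 1" and i: "i \<in> P"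
    and 1: "z i * z i * w = w * (z i * z i)"
    and 2: "\<And>j. j \<in> P \<Longrightarrow> j \<noteq> i \<Longrightarrow> x i j * w = c * (w * x i j)"
    and 3: "\<And>j. j \<in> P \<Longrightarrow> j \<noteq> i \<Longrightarrow> (z i - z j) * w = c * (w * (z i - z j))"
  shows "deformed P i * deformed P i * fps_const w = fps_const w * (deformed P i * deformed P i)"
proof -
  have cc: "c * (c * a) = a" for a using c by auto
  have ca: "a * (c * b) = c * (a * b)" for a b using c by auto
  have "(z i - z j) * x i j * w = w * ((z i - z j) * x i j)" if "j \<in> P - {i}" for j
  proof -
    have "(z i - z j) * x i j * w = c * ((z i - z j) * w * x i j)"
      using 2[of j] that by (simp add: mult.assoc ca)
    also have "\<dots> = w * ((z i - z j) * x i j)"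
      using 3[of j] that by (simp add: mult.assoc cc)
    finally show ?thesis .
  qed
  then have B: "(z i * dunkl P i + dunkl P i * z i) * w = w * (z i * dunkl P i + dunkl P i * z i)"
    unfolding z_dunkl_self sum_distrib_left sum_distrib_right by (intro sum.cong) auto
  have d: "dunkl P i * w = c * (w * dunkl P i)"
    unfolding dunkl_def sum_distrib_left sum_distrib_right by (intro sum.cong) (use 2 in auto)
  have "dunkl P i * dunkl P i * w = dunkl P i * (c * (w * dunkl P i))"
    unfolding mult.assoc d ..
  also have "\<dots> = c * (dunkl P i * w * dunkl P i)" by (simp only: ca mult.assoc)
  also have "\<dots> = w * (dunkl P i * dunkl P i)" unfolding d by (simp only: cc mult.assoc)
  finally have C: "dunkl P i * dunkl P i * w = w * (dunkl P i * dunkl P i)" .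
  have X: "fps_const a * (fps_X * b) = fps_X * (fps_const a * b)" for a :: 'a and b
    by (metis fps_mult_fps_X_commute mult.assoc)
  have L: "(fps_const a + fps_X * fps_const b + fps_X * (fps_X * fps_const c)) * fps_const w
      = fps_const (a * w) + fps_X * fps_const (b * w) + fps_X * (fps_X * fps_const (c * w))" for a b c
    by (simp add: distrib_right mult.assoc)
  have R: "fps_const w * (fps_const a + fps_X * fps_const b + fps_X * (fps_X * fps_const c))
      = fps_const (w * a) + fps_X * fps_const (w * b) + fps_X * (fps_X * fps_const (w * c))" for a b c
    by (simp add: distrib_left X)
  show ?thesis unfolding deformed_product L R 1 B C ..
qed

end

section \<open>Commutation of the undeformed expressions with the squares of the deformed
  elements\<close>

lemma commute_prod_list:
  "(\<And>i. i \<in> set l \<Longrightarrow> a * u i = u i * (a::'a::ring_1)) \<Longrightarrow> a * prod_list (map u l) = prod_list (map u l) * a"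
proof (induction l)
  case (Cons b l)
  have "a * (u b * prod_list (map u l)) = u b * (a * prod_list (map u l))"
    using Cons.prems[of b] by (simp add: mult.assoc[symmetric])
  with Cons show ?case by (simp add: mult.assoc)
qed simp

lemma commute_omit_prod:
  "(\<And>i. i \<in> set l \<Longrightarrow> a * u i = u i * (a::'a::ring_1)) \<Longrightarrow> a * omit_prod u l = omit_prod u l * a"
proof (induction l)
  case (Cons b l)
  have "a * (u b * omit_prod u l) = u b * (a * omit_prod u l)"
    using Cons.prems[of b] by (simp add: mult.assoc[symmetric])
  moreover have "a * prod_list (map u l) = prod_list (map u l) * a"
    by (rule commute_prod_list) (use Cons.prems in auto)
  ultimately show ?case using Cons by (simp add: mult.assoc algebra_simps)
qed simp

lemma commute_esym:
  "(\<And>b. b \<in> set l \<Longrightarrow> a * b = b * (a::'a::ring_1)) \<Longrightarrow> a * esym k l = esym k l * a"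
proof (induction l arbitrary: k)
  case Nil then show ?case by (cases k) auto
next
  case (Cons b l)
  show ?case
  proof (cases k)
    case (Suc k')
    have "a * (b * esym k' l) = b * (a * esym k' l)"
      using Cons.prems[of b] by (simp add: mult.assoc[symmetric])
    moreover have "a * esym k' l = esym k' l * a" "a * esym (Suc k') l = esym (Suc k') l * a"
      by (rule Cons.IH; use Cons.prems in auto)+
    ultimately show ?thesis using Suc by (simp add: mult.assoc distrib_left distrib_right)
  qed simp
qed

lemma obtain_mset_front:
  assumes "i \<in> set l" "j \<in> set l" "i \<noteq> j"
  obtains m where "mset l = mset (i # j # m)"
proof -
  have "i \<in># mset l" "j \<in># mset l - {#i#}" using assms by (simp_all add: in_diff_count)
  then have "mset l = add_mset i (add_mset j (mset l - {#i#} - {#j#}))"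
    by (metis insert_DiffM set_mset_mset assms(1))
  moreover obtain m where "mset m = mset l - {#i#} - {#j#}" using ex_mset by blast
  ultimately show thesis using that[of m] by simp
qed

context equivariant_relations
begin

lemma z_square_commute: "z i * z i * z k = z k * (z i * z i)"
proof (cases "i = k")
  case False
  have "z i * z i * z k = z i * (z i * z k)" by (simp add: mult.assoc)
  also have "\<dots> = - (z i * z k * z i)" by (subst z_anticommute[OF False]) (simp add: mult.assoc)
  also have "\<dots> = z k * (z i * z i)" by (subst z_anticommute[OF False]) (simp add: mult.assoc)
  finally show ?thesis .
qed (simp add: mult.assoc)

lemma z_anticommuting_on: "anticommuting_on I z"
  unfolding anticommuting_on_def using z_anticommute by blast

text \<open>Both \<open>x i j\<close> and \<open>z i - z j\<close> anticommute with z i * z j and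
  with the z of every other index, and commute with z j - z i. These rules alone determine the
  signs, so one argument, \<open>gen\<close>, covers both elements.\<close>

lemma x_z_words:
  assumes "distinct (i # j # m)"
  shows "x i j * prod_list (map z (i # j # m)) = - ((- 1) ^ length m * (prod_list (map z (i # j # m)) * x i j))"
    and "x i j * omit_prod z (i # j # m) = (- 1) ^ length m * (omit_prod z (i # j # m) * x i j)"
    and "(z i - z j) * prod_list (map z (i # j # m)) = - ((- 1) ^ length m * (prod_list (map z (i # j # m)) * (z i - z j)))"
    and "(z i - z j) * omit_prod z (i # j # m) = (- 1) ^ length m * (omit_prod z (i # j # m) * (z i - z j))"
proof -
  have ij: "i \<noteq> j" and m: "k \<in> set m \<Longrightarrow> k \<noteq> i \<and> k \<noteq> j" for k using assms by auto
  define W where "W = prod_list (map z m)"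
  define W' where "W' = omit_prod z m"
  define X where "X = x i j"
  define d where "d = z i - z j"
  define s where "s = (- 1 :: 'a) ^ length m"
  have s: "s = 1 \<or> s = - 1" by (simp add: s_def minus_one_power_iff)
  have X: "X * z k = - (z k * X)" if "k \<in> set m" for k
    unfolding X_def by (rule x_z_other) (use ij m[OF that] in auto)
  have d: "d * z k = - (z k * d)" if "k \<in> set m" for k
    using z_anticommute[of i k] z_anticommute[of j k] m[OF that] by (auto simp: d_def algebra_simps)
  have XW: "X * W = s * (W * X)" "X * W' = - (s * (W' * X))"
    unfolding W_def W'_def s_def by (rule anticommute_prod_list anticommute_omit_prod; fact X)+
  have dW: "d * W = s * (W * d)" "d * W' = - (s * (W' * d))"
    unfolding W_def W'_def s_def by (rule anticommute_prod_list anticommute_omit_prod; fact d)+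
  have Xz: "X * z i = - (z j * X)" "X * z j = - (z i * X)" unfolding X_def using x_z_same[OF ij] by auto
  have ji: "z j * z i = - (z i * z j)" using z_anticommute[of j i] ij by auto
  have "X * (z i * z j) = - (z j * (X * z j))" using Xz(1) by (simp add: mult.assoc[symmetric])
  also have "\<dots> = z j * z i * X" by (simp add: Xz(2) mult.assoc)
  finally have Xp: "X * (z i * z j) = - (z i * z j * X)" by (simp add: ji)
  have Xm: "X * (z j - z i) = (z j - z i) * X" by (simp add: Xz algebra_simps)
  have zz: "z i * z i * z j = z j * (z i * z i)" "z j * z j * z i = z i * (z j * z j)" by (rule z_square_commute)+
  have "d * (z i * z j) = z i * z i * z j - z j * z i * z j" by (simp add: d_def algebra_simps)
  also have "\<dots> = z i * z i * z j + z i * z j * z j" by (simp add: ji)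
  finally have 1: "d * (z i * z j) = z i * z i * z j + z i * z j * z j" .
  have "z i * z j * d = z i * (z j * z i) - z i * z j * z j" by (simp add: d_def algebra_simps)
  also have "\<dots> = - (z i * z i * z j) - z i * z j * z j" unfolding ji by (simp add: mult.assoc)
  finally have dp: "d * (z i * z j) = - (z i * z j * d)" using 1 by simp
  have dm: "d * (z j - z i) = (z j - z i) * d" by (simp add: d_def algebra_simps)
  have w: "prod_list (map z (i # j # m)) = z i * z j * W" "omit_prod z (i # j # m) = (z j - z i) * W + z i * z j * W'"
    by (simp_all add: W_def W'_def algebra_simps)
  have gen: "Y * (z i * z j * W) = - (s * (z i * z j * W * Y))"
    "Y * ((z j - z i) * W + z i * z j * W') = s * (((z j - z i) * W + z i * z j * W') * Y)"
    if "Y * W = s * (W * Y)" "Y * W' = - (s * (W' * Y))" "Y * (z i * z j) = - (z i * z j * Y)" "Y * (z j - z i) = (z j - z i) * Y" for Y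
  proof -
    have a: "Y * (z i * z j * V) = - (z i * z j * (Y * V))" "Y * ((z j - z i) * V) = (z j - z i) * (Y * V)" for V
      using that(3,4) by (simp_all only: mult.assoc[symmetric] mult_minus_left)
    have sc: "c * (s * V) = s * (c * V)" for c V using s by auto
    show "Y * (z i * z j * W) = - (s * (z i * z j * W * Y))"
      unfolding a that(1) sc by (simp only: mult.assoc)
    show "Y * ((z j - z i) * W + z i * z j * W') = s * (((z j - z i) * W + z i * z j * W') * Y)"
      unfolding distrib_left a that(1,2) mult_minus_right sc minus_minus distrib_right by (simp only: mult.assoc)
  qed
  show "x i j * prod_list (map z (i # j # m)) = - ((- 1) ^ length m * (prod_list (map z (i # j # m)) * x i j))"
    "x i j * omit_prod z (i # j # m) = (- 1) ^ length m * (omit_prod z (i # j # m) * x i j)"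
    using gen[OF XW Xp Xm] unfolding w s_def X_def by blast+
  show "(z i - z j) * prod_list (map z (i # j # m)) = - ((- 1) ^ length m * (prod_list (map z (i # j # m)) * (z i - z j)))"
    "(z i - z j) * omit_prod z (i # j # m) = (- 1) ^ length m * (omit_prod z (i # j # m) * (z i - z j))"
    using gen[OF dW dp dm] unfolding w s_def d_def by blast+
qed

text \<open>Bringing \<open>i\<close> and \<open>j\<close> to the front multiplies the product and
  the alternating sum by one common sign, which cancels from each equation.\<close>

lemma x_z_word_commute:
  assumes l: "distinct l" "i \<in> set l" "j \<in> set l" "i \<noteq> j"
  shows "x i j * prod_list (map z l) = - ((- 1) ^ length l * (prod_list (map z l) * x i j))"
    and "x i j * omit_prod z l = (- 1) ^ length l * (omit_prod z l * x i j)"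
    and "(z i - z j) * prod_list (map z l) = - ((- 1) ^ length l * (prod_list (map z l) * (z i - z j)))"
    and "(z i - z j) * omit_prod z l = (- 1) ^ length l * (omit_prod z l * (z i - z j))"
proof -
  obtain m where m: "mset l = mset (i # j # m)" using obtain_mset_front[OF l(2-4)] .
  then have len: "length l = Suc (Suc (length m))" using mset_eq_length by fastforce
  have d: "distinct (i # j # m)" using l(1) mset_eq_imp_distinct_iff[OF m] by simp
  obtain c where c: "c \<in> {1, -1::int}" "prod_list (map z l) = of_int c * prod_list (map z (i # j # m))"
    "omit_prod z l = of_int c * omit_prod z (i # j # m)"
    using anticommuting_reorder[OF m[symmetric] d, where ?'a = 'a] z_anticommuting_on by blast
  have cc: "a * (of_int c * b) = of_int c * (a * b)" for a b :: 'a using c(1) by auto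
  have s: "(- 1 :: 'a) ^ length m * (of_int c * b) = of_int c * ((- 1) ^ length m * b)" for b by (rule cc)
  show "x i j * prod_list (map z l) = - ((- 1) ^ length l * (prod_list (map z l) * x i j))"
   "x i j * omit_prod z l = (- 1) ^ length l * (omit_prod z l * x i j)"
   "(z i - z j) * prod_list (map z l) = - ((- 1) ^ length l * (prod_list (map z l) * (z i - z j)))"
   "(z i - z j) * omit_prod z l = (- 1) ^ length l * (omit_prod z l * (z i - z j))"
    unfolding c(2,3) cc x_z_words[OF d] len power_Suc mult_minus1 minus_minus mult.assoc
    by (simp_all only: cc mult_minus_right mult_minus_left minus_minus mult_1_left)
qed

lemma x_z_square: "i \<noteq> j \<Longrightarrow> x i j * (z k * z k) = z (Perm.apply (Perm.swap i j) k) * z (Perm.apply (Perm.swap i j) k) * x i j"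
proof -
  assume ij: "i \<noteq> j"
  have "x i j * (z k * b) = - (z (Perm.apply (Perm.swap i j) k) * (x i j * b))" for b
    unfolding mult.assoc[symmetric] x_z[OF ij] by simp
  then show ?thesis by (simp only: x_z[OF ij] mult_minus_right minus_minus mult.assoc)
qed

text \<open>Moving \<open>x i j\<close> across exchanges the squares of \<open>z i\<close> and
  \<open>z j\<close> and leaves the other squares alone; a symmetric function does not
  notice.\<close>

lemma x_esym_commute:
  assumes l: "distinct l" "i \<in> set l" "j \<in> set l" "i \<noteq> j"
  shows "x i j * esym k (map (\<lambda>i. z i * z i) l) = esym k (map (\<lambda>i. z i * z i) l) * x i j"
proof -
  define q where "q = (\<lambda>i. z i * z i)"
  obtain m where m: "mset l = mset (i # j # m)" using obtain_mset_front[OF l(2-4)] .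
  have d: "distinct (i # j # m)" using l(1) mset_eq_imp_distinct_iff[OF m] by simp
  have qq: "q a * q b = q b * q a" for a b
    unfolding q_def mult.assoc[of "z b" "z b", symmetric] by (metis mult.assoc z_square_commute)
  have "esym k (map q l) = esym k (map q (i # j # m))"
    by (rule esym_mset) (use m in \<open>auto simp: qq\<close>)
  also have "\<dots> = (\<Sum>a\<le>k. esym a [q i, q j] * esym (k - a) (map q m))"
    using esym_append[of k "[q i, q j]" "map q m"] by simp
  finally have e: "esym k (map q l) = (\<Sum>a\<le>k. esym a [q i, q j] * esym (k - a) (map q m))" .
  have xi: "x i j * q i = q j * x i j" "x i j * q j = q i * x i j"
    using x_z_square[OF l(4), of i] x_z_square[OF l(4), of j] by (simp_all add: q_def)
  have xm: "x i j * esym b (map q m) = esym b (map q m) * x i j" for b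
  proof (rule commute_esym)
    fix c assume "c \<in> set (map q m)"
    then obtain k where "c = q k" "k \<in> set m" by auto
    moreover from this have "k \<noteq> i" "k \<noteq> j" using d by auto
    ultimately show "x i j * c = c * x i j"
      using x_z_square[OF l(4), of k] by (simp add: q_def)
  qed
  have xa: "x i j * esym a [q i, q j] = esym a [q i, q j] * x i j" for a
  proof -
    consider "a = 0" | "a = 1" | "a = 2" | b where "a = Suc (Suc (Suc b))"
      by (metis One_nat_def Suc_1 not0_implies_Suc)
    then show ?thesis
    proof cases
      case 3
      have "x i j * (q i * q j) = q j * (x i j * q j)" using xi(1) by (simp add: mult.assoc[symmetric])
      then show ?thesis using 3 xi qq[of i j] by (simp add: numeral_2_eq_2 mult.assoc[symmetric])
    qed (simp_all add: xi distrib_left distrib_right add.commute)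
  qed
  have "x i j * (esym a [q i, q j] * esym b (map q m)) = esym a [q i, q j] * esym b (map q m) * x i j" for a b
    unfolding mult.assoc[symmetric] xa unfolding mult.assoc xm ..
  then show ?thesis unfolding q_def[symmetric] e sum_distrib_left sum_distrib_right by (intro sum.cong refl)
qed

lemma deformed_square_z_words:
  assumes l: "distinct l" "set l = P" "i \<in> P"
  shows "deformed P i * deformed P i * fps_const (prod_list (map z l)) = fps_const (prod_list (map z l)) * (deformed P i * deformed P i)"
    and "deformed P i * deformed P i * fps_const (omit_prod z l) = fps_const (omit_prod z l) * (deformed P i * deformed P i)"
    and "deformed P i * deformed P i * fps_const (esym k (map (\<lambda>i. z i * z i) l)) = fps_const (esym k (map (\<lambda>i. z i * z i) l)) * (deformed P i * deformed P i)"
proof -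
  have s: "(- 1 :: 'a) ^ length l = 1 \<or> (- 1 :: 'a) ^ length l = - 1" by (simp add: minus_one_power_iff)
  show "deformed P i * deformed P i * fps_const (prod_list (map z l)) = fps_const (prod_list (map z l)) * (deformed P i * deformed P i)"
  proof (rule deformed_square_commute[where c = "- ((- 1) ^ length l)"])
    show "z i * z i * prod_list (map z l) = prod_list (map z l) * (z i * z i)"
      by (rule commute_prod_list) (rule z_square_commute)
  qed (use s l x_z_word_commute(1,3)[OF l(1)] in auto)
  show "deformed P i * deformed P i * fps_const (omit_prod z l) = fps_const (omit_prod z l) * (deformed P i * deformed P i)"
  proof (rule deformed_square_commute[where c = "(- 1) ^ length l"])
    show "z i * z i * omit_prod z l = omit_prod z l * (z i * z i)"
      by (rule commute_omit_prod) (rule z_square_commute)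
  qed (use s l x_z_word_commute(2,4)[OF l(1)] in auto)
  have e: "z k' * esym k (map (\<lambda>i. z i * z i) l) = esym k (map (\<lambda>i. z i * z i) l) * z k'" for k'
    by (rule commute_esym) (auto simp: z_square_commute)
  show "deformed P i * deformed P i * fps_const (esym k (map (\<lambda>i. z i * z i) l)) = fps_const (esym k (map (\<lambda>i. z i * z i) l)) * (deformed P i * deformed P i)"
  proof (rule deformed_square_commute[where c = 1])
    show "z i * z i * esym k (map (\<lambda>i. z i * z i) l) = esym k (map (\<lambda>i. z i * z i) l) * (z i * z i)"
      unfolding mult.assoc e unfolding mult.assoc[symmetric] e ..
  qed (use l x_esym_commute[OF l(1)] e in \<open>auto simp: left_diff_distrib right_diff_distrib\<close>)
qed

lemma deformed_square_commute_deformed: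
  assumes "finite P" "i \<in> P" "j \<in> P"
  shows "deformed P i * deformed P i * deformed P j = deformed P j * (deformed P i * deformed P i)"
proof (cases "i = j")
  case False
  note * = deformed_anticommute[OF assms False]
  have "deformed P i * (deformed P j * b) = - (deformed P j * (deformed P i * b))" for b
    unfolding mult.assoc[symmetric] * by simp
  then show ?thesis by (simp only: * mult_minus_right minus_minus mult.assoc)
qed (simp add: mult.assoc)

end

section \<open>The operator model\<close>

lemma apply_swap: "Perm.apply (Perm.swap i j) k = (if k = i then j else if k = j then i else k)"
  by (transfer, simp add: transpose_def)

text \<open>The differences u i - u j are multiples of spin reflections in the root vectors, and up
  to sign they obey the relations of transpositions. The common square \<open>q\<close> is a
  parameter because families with square 1 and with square -1 are combined later.\<close>

locale clifford =
  fixes u :: "nat \<Rightarrow> 'a::ring_1" and q :: 'a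
  assumes square: "u i * u i = q" and anticommute: "i \<noteq> j \<Longrightarrow> u i * u j = - (u j * u i)"
begin

lemma diff_anticommute:
  assumes "distinct [i, j, k, l]"
  shows "(u i - u j) * (u k - u l) = - ((u k - u l) * (u i - u j))"
  using anticommute[of i k] anticommute[of i l] anticommute[of j k] anticommute[of j l] assms
  by (simp add: algebra_simps)

lemma diff_triangle:
  assumes "distinct [i, j, k]"
  shows "(u i - u j) * (u j - u k) = (u j - u k) * (u k - u i)"
  using anticommute[of j i] anticommute[of k i] assms by (simp add: algebra_simps square)

lemma diff_move:
  assumes "i \<noteq> j"
  shows "(u i - u j) * u k = - (u (Perm.apply (Perm.swap i j) k) * (u i - u j))"
proof -
  consider "k = i" | "k = j" | "k \<noteq> i" "k \<noteq> j" by auto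
  then show ?thesis
  proof cases
    case 3
    then show ?thesis using anticommute[of i k] anticommute[of j k] by (simp add: algebra_simps)
  qed (use assms in \<open>simp_all add: algebra_simps square\<close>)
qed

end

text \<open>The shift by \<open>Suc\<close> keeps the generator \<open>opC 0\<close> free; it
  anticommutes with all \<open>opJ\<close> and \<open>opJ'\<close> and completes
  \<open>opT\<close>.\<close>

definition opJ :: "nat \<Rightarrow> (point, 'a::ring_1) operator" where "opJ i = opC (Suc i)"
definition opJ' :: "nat \<Rightarrow> (point, 'a::ring_1) operator" where "opJ' i = opC' (Suc i)"

interpretation J: clifford opJ 1
  by standard (auto simp: opJ_def intro: opC_anticommute)
interpretation J': clifford opJ' "- 1"
  by standard (auto simp: opJ'_def opC'_square intro: opC'_anticommute)

definition opD :: "nat \<Rightarrow> nat \<Rightarrow> (point, 'a::ring_1) operator" where "opD i j = opJ i - opJ j"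
definition opD' :: "nat \<Rightarrow> nat \<Rightarrow> (point, 'a::ring_1) operator" where "opD' i j = opJ' i - opJ' j"

text \<open>The spin reflection \<open>opD i j\<close> conjugates \<open>opJ\<close> by minus the transposition, but obeys the relations of
  transpositions only up to sign; the second spin reflection and \<open>opC 0\<close> correct the signs.\<close>
definition opT :: "nat \<Rightarrow> nat \<Rightarrow> (point, 'a::ring_1) operator" where "opT i j = opD i j * (opD' i j * opC 0)"

lemma opJ'_opJ: "opJ' a * opJ b = - (opJ b * opJ' a)"
  unfolding opJ_def opJ'_def by (rule opC'_opC)

lemma opC0_opJ: "opC 0 * opJ b = - (opJ b * opC 0)"
  unfolding opJ_def by (rule opC_anticommute) simp

lemma opC0_opJ': "opC 0 * opJ' b = - (opJ' b * opC 0)"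
  unfolding opJ'_def by (simp add: opC'_opC)

lemma opD_opD': "opD' i j * opD k l = - (opD k l * opD' i j)"
  and opD'_opJ: "opD' i j * opJ b = - (opJ b * opD' i j)"
  and opC0_opD: "opC 0 * opD i j = - (opD i j * opC 0)"
  and opC0_opD': "opC 0 * opD' i j = - (opD' i j * opC 0)"
  by (simp_all add: opD_def opD'_def algebra_simps opJ'_opJ opC0_opJ opC0_opJ')

lemmas opD_anticommute = J.diff_anticommute[folded opD_def]
lemmas opD'_anticommute = J'.diff_anticommute[folded opD'_def]
lemmas opD_triangle = J.diff_triangle[folded opD_def]
lemmas opD'_triangle = J'.diff_triangle[folded opD'_def]
lemmas opD_opJ = J.diff_move[folded opD_def]

text \<open>The inner \<open>opC 0\<close> crosses two odd factors without a net sign; the minus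
  comes from one crossing of \<open>opD'\<close> with \<open>opD\<close>. Since \<open>opD\<close>
  and \<open>opD'\<close> now enter side by side, a sign in their relations occurs twice, and
  \<open>opT\<close> obeys the relations of transpositions exactly.\<close>

lemma opT_product: "opT i j * opT k l = - (opD i j * opD k l * (opD' i j * opD' k l))"
proof -
  have a: "opC 0 * (opD i j * b) = - (opD i j * (opC 0 * b))" for i j and b :: "(point, 'a) operator"
    by (simp add: opC0_opD mult.assoc[symmetric])
  have b: "opC 0 * (opD' i j * b) = - (opD' i j * (opC 0 * b))" for i j and b :: "(point, 'a) operator"
    by (simp add: opC0_opD' mult.assoc[symmetric])
  have c: "opD' i j * (opD k l * b) = - (opD k l * (opD' i j * b))" for i j k l and b :: "(point, 'a) operator"
    by (simp add: opD_opD' mult.assoc[symmetric])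
  show ?thesis
    by (simp add: opT_def mult.assoc a b c)
qed

lemma opT_sym: "opT i j = opT j i"
proof -
  have "opD i j = (- opD j i :: (point, 'a) operator)" "opD' i j = (- opD' j i :: (point, 'a) operator)"
    by (simp_all add: opD_def opD'_def)
  then show ?thesis by (simp add: opT_def)
qed

lemma opT_commute: "distinct [i, j, k, l] \<Longrightarrow> opT i j * opT k l = opT k l * opT i j"
  by (simp add: opT_product opD_anticommute[of i j k l] opD'_anticommute[of i j k l])

lemma opT_triangle: "distinct [i, j, k] \<Longrightarrow> opT i j * opT j k = opT j k * opT k i"
  by (simp add: opT_product opD_triangle[of i j k] opD'_triangle[of i j k])

lemma opT_opJ: "i \<noteq> j \<Longrightarrow> opT i j * opJ k = - (opJ (Perm.apply (Perm.swap i j) k) * opT i j)"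
proof -
  assume ij: "i \<noteq> j"
  have a: "opD' i j * (opJ b * c) = - (opJ b * (opD' i j * c))" for b and c :: "(point, 'a) operator"
    by (simp add: opD'_opJ mult.assoc[symmetric])
  have b: "opD i j * (opJ k * c) = - (opJ (Perm.apply (Perm.swap i j) k) * (opD i j * c))" for c :: "(point, 'a) operator"
    by (simp add: opD_opJ[OF ij] mult.assoc[symmetric])
  show ?thesis by (simp add: opT_def mult.assoc opC0_opJ a b)
qed

section \<open>Operators for transpositions and the lift of the quadratic relations\<close>

lemma swap_triangle:
  assumes "distinct [i, j, k]"
  shows "Perm.swap i j * Perm.swap j k = Perm.swap j k * Perm.swap k i"
  using assms by (intro perm_eqI) (auto simp: apply_times apply_swap)

lemma swap_commute:
  assumes "distinct [i, j, k, l]"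
  shows "Perm.swap i j * Perm.swap k l = Perm.swap k l * Perm.swap i j"
  using assms by (intro perm_eqI) (auto simp: apply_times apply_swap)

lemma opS_mult_eq:
  "Perm.swap i j * Perm.swap k l = Perm.swap a b * Perm.swap c d \<Longrightarrow>
    opS i j * opS k l = (opS a b * opS c d :: (point, 'a::ring_1) operator)"
proof (rule operator_eqI)
  fix F :: "point \<Rightarrow> 'a" and p :: point
  assume *: "Perm.swap i j * Perm.swap k l = Perm.swap a b * Perm.swap c d"
  obtain v A t where "p = (v, A, t)" by (cases p)
  then show "ap (opS i j * opS k l) F p = ap (opS a b * opS c d) F p"
    using * by (simp add: opS_def mult.assoc)
qed

lemma opH_mult_eq:
  "{S. i \<in> S \<longleftrightarrow> j \<in> S} \<inter> {S. k \<in> S \<longleftrightarrow> l \<in> S} = {S. a \<in> S \<longleftrightarrow> b \<in> S} \<inter> {S. c \<in> S \<longleftrightarrow> d \<in> S} \<Longrightarrow>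
    opH i j * opH k l = (opH a b * opH c d :: (point, 'a::ring_1) operator)"
proof (rule operator_eqI)
  fix F :: "point \<Rightarrow> 'a" and p :: point
  assume *: "{S. i \<in> S \<longleftrightarrow> j \<in> S} \<inter> {S. k \<in> S \<longleftrightarrow> l \<in> S} = {S. a \<in> S \<longleftrightarrow> b \<in> S} \<inter> {S. c \<in> S \<longleftrightarrow> d \<in> S}"
  obtain v A t where "p = (v, A, t)" by (cases p)
  then show "ap (opH i j * opH k l) F p = ap (opH a b * opH c d) F p"
    by (simp only: opH_def ap_simps ap_pull split Int_assoc *)
qed

text \<open>A transposition acting on all three coordinates of a point. Products of two obey the
  commutation and triangle rules without signs, so the signs in the relations remain entirely with
  the factors \<open>x i j\<close>.\<close>

definition opU :: "nat \<Rightarrow> nat \<Rightarrow> (point, 'a::ring_1) operator" where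
  "opU i j = opT i j * (opS i j * opH i j)"

lemma opT_commuteI:
  assumes X: "\<And>m. X * opC m = opC m * X" and XN: "\<And>m. X * opN m = opN m * X"
  shows "X * opT k l = opT k l * X"
proof -
  have "X * (opN m * b) = opN m * (X * b)" for m b
    by (simp only: mult.assoc[symmetric] XN)
  then have X': "X * opC' m = opC' m * X" for m
    by (simp add: opC'_def mult.assoc X)
  have XD: "X * opD k l = opD k l * X" "X * opD' k l = opD' k l * X"
    by (simp_all add: opD_def opD'_def opJ_def opJ'_def algebra_simps X X')
  have "X * (opD k l * b) = opD k l * (X * b)" "X * (opD' k l * b) = opD' k l * (X * b)" for b
    by (simp_all only: mult.assoc[symmetric] XD)
  then show ?thesis by (simp add: opT_def mult.assoc X)
qed

lemma opT_opS: "opS i j * opT k l = opT k l * opS i j" and opT_opH: "opH i j * opT k l = opT k l * opH i j"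
  and opT_opL: "opT k l * opL a = opL a * opT k l" and opT_opZ: "opT k l * opZ m = opZ m * opT k l"
  by (rule opT_commuteI opT_commuteI[symmetric]; simp add: op_commute)+

lemma opU_product: "opU i j * opU k l = (opT i j * opT k l) * ((opS i j * opS k l) * (opH i j * opH k l))"
proof -
  have "opS i j * (opT k l * b) = opT k l * (opS i j * b)" "opH i j * (opT k l * b) = opT k l * (opH i j * b)"
    "opH i j * (opS k l * b) = opS k l * (opH i j * b)" for b :: "(point, 'a) operator"
    by (simp_all only: mult.assoc[symmetric] opT_opS opT_opH op_commute)
  then show ?thesis by (simp add: opU_def mult.assoc)
qed

lemma opU_sym: "opU i j = opU j i"
proof -
  have "{S. (i \<in> S) = (j \<in> S)} = {S. (j \<in> S) = (i \<in> S)}" by auto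
  then have "opH i j = (opH j i :: (point, 'a) operator)" by (simp add: opH_def)
  moreover have "opS i j = (opS j i :: (point, 'a) operator)" by (simp add: opS_def swap_sym[of i j])
  ultimately show ?thesis by (simp add: opU_def opT_sym[of i j])
qed

lemma opU_commute: "distinct [i, j, k, l] \<Longrightarrow> opU i j * opU k l = opU k l * opU i j"
  unfolding opU_product by (simp add: opT_commute opS_mult_eq[OF swap_commute] opH_mult_eq[OF Int_commute])

lemma opU_triangle: "distinct [i, j, k] \<Longrightarrow> opU i j * opU j k = opU j k * opU k i"
proof -
  assume d: "distinct [i, j, k]"
  have "opH i j * opH j k = (opH j k * opH k i :: (point, 'a) operator)"
    by (rule opH_mult_eq) auto
  then show ?thesis
    by (simp add: opU_product opT_triangle[OF d] opS_mult_eq[OF swap_triangle[OF d]])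
qed

lemma opU_opL: "opU i j * opL a = opL a * opU i j"
  by (simp add: opU_def mult.assoc op_commute) (simp add: mult.assoc[symmetric] op_commute opT_opL)

text \<open>The Clifford factor makes these elements anticommute, the scalar factor makes their
  squares distinguish permutations.\<close>

definition zhat :: "nat \<Rightarrow> (point, 'a::ring_1) operator" where
  "zhat k = opZ k * opJ k"

lemma opJ_opZ: "opJ m * opZ k = opZ k * opJ m"
  by (simp add: opJ_def op_commute)

lemma opZ_commute: "opZ i * opZ j = opZ j * opZ i"
  by (rule operator_eqI) (auto simp: opZ_def mult.assoc[symmetric] mult.commute simp flip: of_nat_mult)

lemma zhat_product: "zhat i * zhat j = opZ i * opZ j * (opJ i * opJ j)"
proof -
  have "opJ i * (opZ j * b) = opZ j * (opJ i * b)" for b :: "(point, 'a) operator"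
    by (simp only: mult.assoc[symmetric] opJ_opZ)
  then show ?thesis by (simp add: zhat_def mult.assoc)
qed

lemma zhat_square: "zhat i * zhat i = opZ i * opZ i"
  by (simp add: zhat_product J.square)

definition xhat :: "(nat \<Rightarrow> nat \<Rightarrow> 'a) \<Rightarrow> nat \<Rightarrow> nat \<Rightarrow> (point, 'a::ring_1) operator" where
  "xhat x i j = opL (x i j) * opU i j"

lemma xhat_product: "xhat x i j * xhat x k l = opL (x i j * x k l) * (opU i j * opU k l)"
proof -
  have "opU i j * (opL a * b) = opL a * (opU i j * b)" for a and b :: "(point, 'a) operator"
    by (simp only: mult.assoc[symmetric] opU_opL)
  then show ?thesis by (simp add: xhat_def mult.assoc flip: opL_mult)
qed

lemma opU_zhat: "i \<noteq> j \<Longrightarrow> opU i j * zhat k = - (zhat (Perm.apply (Perm.swap i j) k) * opU i j)"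
proof -
  assume ij: "i \<noteq> j"
  let ?k = "Perm.apply (Perm.swap i j) k"
  have H: "opH i j * (opZ k * b) = opZ k * (opH i j * b)" "opS i j * (opZ k * b) = opZ ?k * (opS i j * b)"
    "opH i j * (opJ k * b) = opJ k * (opH i j * b)" "opS i j * (opJ k * b) = opJ k * (opS i j * b)"
    "opT i j * (opZ ?k * b) = opZ ?k * (opT i j * b)" "opT i j * (opJ k * b) = - (opJ ?k * (opT i j * b))"
    for b :: "(point, 'a) operator"
    by (simp_all only: mult.assoc[symmetric] op_commute opS_opZ opT_opZ opT_opJ[OF ij] opJ_def[symmetric]
        mult_minus_left)
      (simp_all add: opJ_def op_commute)
  have H0: "opH i j * opJ k = opJ k * opH i j" by (simp add: opJ_def op_commute)
  show ?thesis by (simp add: opU_def zhat_def mult.assoc H H0)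
qed

lemma zhat_opL: "zhat k * opL a = opL a * zhat k"
proof -
  have "opJ k * opL a = opL a * opJ k" by (simp add: opJ_def op_commute)
  then show ?thesis unfolding zhat_def
    by (simp add: mult.assoc) (simp add: mult.assoc[symmetric] op_commute)
qed

context quadratic_relations
begin

text \<open>Each relation among the \<open>x i j\<close> is homogeneous for the product of
  transpositions: its monomials carry the same product of two \<open>opU\<close>, which factors out
  and leaves the original relation inside \<open>opL\<close>.\<close>

lemma equivariant_hat: "equivariant_relations (xhat x) zhat"
proof
  show "xhat x i j = xhat x j i" for i j
    by (simp add: xhat_def sym[of i j] opU_sym[of i j])
  show "xhat x i j * xhat x i j = 0" if "i \<noteq> j" for i j
    using square_zero[OF that] by (simp add: xhat_product)
  show "xhat x i j * xhat x k l = - (xhat x k l * xhat x i j)" if "distinct [i, j, k, l]" for i j k l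
    using disjoint_anticommute[OF that] by (simp add: xhat_product opL_uminus opU_commute[OF that])
  show "xhat x i j * xhat x j k + xhat x j k * xhat x k i + xhat x k i * xhat x i j = 0"
    if d: "distinct [i, j, k]" for i j k
  proof -
    have d': "distinct [j, k, i]" using d by auto
    have "opU k i * opU i j = (opU i j * opU j k :: (point, 'a) operator)"
      by (simp add: opU_triangle[OF d] opU_triangle[OF d'])
    moreover have "opU j k * opU k i = (opU i j * opU j k :: (point, 'a) operator)"
      by (simp add: opU_triangle[OF d])
    ultimately show ?thesis
      using triangle[OF d] unfolding xhat_product by (simp flip: distrib_right opL_add)
  qed
  show "zhat i * zhat j = - (zhat j * zhat i :: (point, 'a) operator)" if "i \<noteq> j" for i j
    by (simp add: zhat_product J.anticommute[OF that] opZ_commute[of i j])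
  show "xhat x i j * zhat k = - (zhat (Perm.apply (Perm.swap i j) k) * xhat x i j)" if "i \<noteq> j" for i j k
    unfolding xhat_def mult.assoc opU_zhat[OF that]
    by (simp add: mult.assoc[symmetric] zhat_opL)
qed

end

section \<open>Rigidity\<close>

text \<open>The sets that survive in the family of a point when the operators \<open>opH\<close> are
  applied along the word, starting from \<open>UNIV\<close>.\<close>

definition respecting :: "(nat \<times> nat) list \<Rightarrow> nat set set" where
  "respecting es = {S. \<forall>(i, j)\<in>set es. i \<in> S \<longleftrightarrow> j \<in> S}"

lemma respecting_append: "respecting (es @ fs) = respecting es \<inter> respecting fs"
  by (auto simp: respecting_def)

text \<open>\<open>local_op P d M\<close>: the value of \<open>ap M F\<close> at a point depends only on the values of \<open>F\<close> at the
  points reached from it by words of \<open>d\<close> transpositions of \<open>P\<close>.\<close>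
definition local_op :: "nat set \<Rightarrow> nat \<Rightarrow> (point, 'a::ring_1) operator \<Rightarrow> bool" where
  "local_op P d M \<longleftrightarrow> (\<forall>A. opR A * M = M * opR A) \<and>
    (\<forall>F v A b. (\<forall>es b'. length es = d \<longrightarrow> set es \<subseteq> P \<times> P \<longrightarrow>
        F (v * swaps es, A \<inter> respecting es, b') = 0) \<longrightarrow> ap M F (v, A, b) = 0)"

lemma local_opI:
  assumes "\<And>A. opR A * M = M * opR A"
    and "\<And>F v A b. (\<And>es b'. length es = d \<Longrightarrow> set es \<subseteq> P \<times> P \<Longrightarrow>
        F (v * swaps es, A \<inter> respecting es, b') = 0) \<Longrightarrow> ap M F (v, A, b) = 0"
  shows "local_op P d M"
  unfolding local_op_def using assms by blast

lemma local_opD: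
  assumes "local_op P d M" "\<And>es b'. length es = d \<Longrightarrow> set es \<subseteq> P \<times> P \<Longrightarrow> F (v * swaps es, A \<inter> respecting es, b') = 0"
  shows "ap M F (v, A, b) = 0"
  using assms unfolding local_op_def by blast

lemma local_op_commute: "local_op P d M \<Longrightarrow> opR A * M = M * opR A"
  unfolding local_op_def by blast

lemma local_op_0 [simp]: "local_op P d 0"
  by (rule local_opI) auto

lemma local_op_add: "local_op P d M \<Longrightarrow> local_op P d N \<Longrightarrow> local_op P d (M + N)"
  by (rule local_opI) (simp_all add: distrib_left distrib_right local_op_commute local_opD[of P d M] local_opD[of P d N])

lemma local_op_uminus: "local_op P d M \<Longrightarrow> local_op P d (- M)"
  by (rule local_opI) (simp_all add: local_op_commute local_opD[of P d M])

lemma local_op_diff: "local_op P d M \<Longrightarrow> local_op P d N \<Longrightarrow> local_op P d (M - N)"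
  using local_op_add[of P d M "- N"] local_op_uminus[of P d N] by simp

lemma local_op_sum: "(\<And>a. a \<in> B \<Longrightarrow> local_op P d (f a)) \<Longrightarrow> local_op P d (sum f B)"
  by (induction B rule: infinite_finite_induct) (auto intro: local_op_add)

lemma local_op_mult:
  assumes M: "local_op P d M" and N: "local_op P e N"
  shows "local_op P (d + e) (M * N)"
proof (rule local_opI)
  show "opR A * (M * N) = M * N * opR A" for A
    unfolding mult.assoc[symmetric] local_op_commute[OF M] unfolding mult.assoc local_op_commute[OF N] ..
next
  fix F :: "point \<Rightarrow> 'a" and v A b
  assume F: "\<And>es b'. length es = d + e \<Longrightarrow> set es \<subseteq> P \<times> P \<Longrightarrow> F (v * swaps es, A \<inter> respecting es, b') = 0"
  have "ap M (ap N F) (v, A, b) = 0"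
  proof (rule local_opD[OF M])
    fix es b' assume es: "length es = d" "set es \<subseteq> P \<times> P"
    show "ap N F (v * swaps es, A \<inter> respecting es, b') = 0"
    proof (rule local_opD[OF N])
      fix fs b'' assume "length fs = e" "set fs \<subseteq> P \<times> P"
      then show "F (v * swaps es * swaps fs, A \<inter> respecting es \<inter> respecting fs, b'') = 0"
        using F[of "es @ fs" b''] es by (simp add: swaps_append respecting_append mult.assoc Int_assoc)
    qed
  qed
  then show "ap (M * N) F (v, A, b) = 0" by simp
qed

lemma local_op_pointwise:
  assumes "\<And>A. opR A * M = M * opR A" "\<And>F v A b. (\<And>b'. F (v, A, b') = 0) \<Longrightarrow> ap M F (v, A, b) = 0"
  shows "local_op P 0 M"
proof (rule local_opI)
  fix F :: "point \<Rightarrow> 'a" and v A b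
  assume *: "\<And>es b'. length es = 0 \<Longrightarrow> set es \<subseteq> P \<times> P \<Longrightarrow> F (v * swaps es, A \<inter> respecting es, b') = 0"
  have "F (v, A, b') = 0" for b' using *[of "[]" b'] by (simp add: respecting_def)
  then show "ap M F (v, A, b) = 0" by (rule assms(2))
qed (rule assms(1))

lemma local_op_basic:
  "local_op P 0 (opL a)" "local_op P 0 (opC m)" "local_op P 0 (opN m)" "local_op P 0 (opZ k)" "local_op P 0 1"
  by (rule local_op_pointwise, simp add: op_commute, simp add: op_defs)+

lemma local_op_opT: "local_op P 0 (opT i j)"
proof -
  have C': "local_op P 0 (opC' m)" for m
    using local_op_mult[OF local_op_basic(3,2)] by (simp add: opC'_def)
  have "local_op P 0 (opD i j)" "local_op P 0 (opD' i j)"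
    unfolding opD_def opD'_def opJ_def opJ'_def by (intro local_op_diff local_op_basic C')+
  then show ?thesis
    unfolding opT_def using local_op_mult[of P 0 _ 0] local_op_basic(2) by (metis add_0)
qed

lemma local_op_opSH:
  assumes "i \<in> P" "j \<in> P"
  shows "local_op P 1 (opS i j * opH i j)"
proof (rule local_opI)
  show "opR A * (opS i j * opH i j) = opS i j * opH i j * opR A" for A
    by (simp add: mult.assoc[symmetric] op_commute) (simp add: mult.assoc op_commute)
next
  fix F :: "point \<Rightarrow> 'a" and v A b
  assume *: "\<And>es b'. length es = 1 \<Longrightarrow> set es \<subseteq> P \<times> P \<Longrightarrow> F (v * swaps es, A \<inter> respecting es, b') = 0"
  show "ap (opS i j * opH i j) F (v, A, b) = 0"
    using *[of "[(i, j)]" b] assms by (simp add: opS_def opH_def respecting_def)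
qed

lemma local_op_xhat: "i \<in> P \<Longrightarrow> j \<in> P \<Longrightarrow> local_op P 1 (xhat x i j)"
  using local_op_mult[OF local_op_basic(1) local_op_mult[OF local_op_opT local_op_opSH]]
  by (simp add: xhat_def opU_def)

lemma local_op_zhat: "local_op P 0 (zhat k)"
  using local_op_mult[OF local_op_basic(4,2)] by (simp add: zhat_def opJ_def)

section \<open>Power series graded by the number of transpositions\<close>

definition filtered :: "nat set \<Rightarrow> nat \<Rightarrow> (point, 'a::ring_1) operator fps \<Rightarrow> bool" where
  "filtered P D f \<longleftrightarrow> (\<forall>d. local_op P d (fps_nth f d)) \<and> (\<forall>d>D. fps_nth f d = 0)"

lemma filtered_0: "filtered P D 0"
  by (simp add: filtered_def)

lemma filtered_mono: "filtered P D f \<Longrightarrow> D \<le> E \<Longrightarrow> filtered P E f"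
  by (auto simp: filtered_def)

lemma filtered_add: "filtered P D f \<Longrightarrow> filtered P D g \<Longrightarrow> filtered P D (f + g)"
  and filtered_diff: "filtered P D f \<Longrightarrow> filtered P D g \<Longrightarrow> filtered P D (f - g)"
  by (auto simp: filtered_def intro: local_op_add local_op_diff)

lemma filtered_const: "local_op P 0 M \<Longrightarrow> filtered P 0 (fps_const M)"
  by (auto simp: filtered_def)

lemma fps_nth_mult_high:
  fixes f g :: "'a::ring_1 fps"
  assumes f: "\<And>d. d > D \<Longrightarrow> fps_nth f d = 0" and g: "\<And>d. d > E \<Longrightarrow> fps_nth g d = 0"
  shows "d > D + E \<Longrightarrow> fps_nth (f * g) d = 0" and "fps_nth (f * g) (D + E) = fps_nth f D * fps_nth g E"
proof -
  show "fps_nth (f * g) d = 0" if "d > D + E"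
  proof -
    have "fps_nth f i * fps_nth g (d - i) = 0" if "i \<le> d" for i
      using f[of i] g[of "d - i"] that \<open>d > D + E\<close> by (cases "i > D") auto
    then show ?thesis by (simp add: fps_mult_nth)
  qed
  have "fps_nth (f * g) (D + E) = (\<Sum>i\<in>{D}. fps_nth f i * fps_nth g (D + E - i))"
    unfolding fps_mult_nth
  proof (rule sum.mono_neutral_right)
    show "\<forall>i\<in>{0..D + E} - {D}. fps_nth f i * fps_nth g (D + E - i) = 0"
    proof
      fix i assume "i \<in> {0..D + E} - {D}"
      then consider "i > D" | "D + E - i > E" by fastforce
      then show "fps_nth f i * fps_nth g (D + E - i) = 0"
        by cases (simp_all add: f g)
    qed
  qed auto
  then show "fps_nth (f * g) (D + E) = fps_nth f D * fps_nth g E" by simp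
qed

lemma filtered_mult: 
  assumes "filtered P D f" "filtered P E g"
  shows "filtered P (D + E) (f * g)"
  unfolding filtered_def
proof (intro conjI allI impI)
  show "local_op P d (fps_nth (f * g) d)" for d
    unfolding fps_mult_nth
  proof (rule local_op_sum)
    fix i assume "i \<in> {0..d}"
    then show "local_op P d (fps_nth f i * fps_nth g (d - i))"
      using local_op_mult[of P i "fps_nth f i" "d - i" "fps_nth g (d - i)"] assms
      by (simp add: filtered_def)
  qed
  show "fps_nth (f * g) d = 0" if "d > D + E" for d
    by (rule fps_nth_mult_high(1)[OF _ _ that]) (use assms in \<open>auto simp: filtered_def\<close>)
qed

lemma filtered_prod_list:
  "(\<And>i. i \<in> set l \<Longrightarrow> filtered P 1 (u i)) \<Longrightarrow> filtered P (length l) (prod_list (map u l))"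
proof (induction l)
  case Nil
  show ?case using filtered_const[OF local_op_basic(5), of P] by simp
next
  case (Cons a l)
  then show ?case using filtered_mult[of P 1 "u a" "length l" "prod_list (map u l)"] by simp
qed

lemma filtered_omit_prod:
  "(\<And>i. i \<in> set l \<Longrightarrow> filtered P 1 (u i)) \<Longrightarrow> filtered P (length l - 1) (omit_prod u l)"
proof (induction l)
  case Nil
  show ?case by (simp add: filtered_0)
next
  case (Cons a l)
  have "filtered P (length l) (u a * omit_prod u l)"
    using Cons filtered_mult[of P 1 "u a" "length l - 1" "omit_prod u l"]
    by (cases l) (auto simp: filtered_0)
  then show ?case using filtered_prod_list[of l P u] Cons.prems by (auto intro: filtered_diff)
qed

lemma filtered_esym:
  "(\<And>a. a \<in> set l \<Longrightarrow> filtered P 2 a) \<Longrightarrow> filtered P (2 * k) (esym k l)"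
proof (induction l arbitrary: k)
  case Nil
  show ?case using filtered_const[OF local_op_basic(5), of P] by (cases k) (auto simp: filtered_0)
next
  case (Cons a l)
  show ?case
  proof (cases k)
    case (Suc k')
    moreover have "filtered P (2 * Suc k') (esym (Suc k') l)" by (rule Cons.IH) (use Cons.prems in auto)
    ultimately show ?thesis
      using filtered_mult[of P 2 a "2 * k'" "esym k' l"] Cons by (auto intro!: filtered_add)
  qed (use filtered_const[OF local_op_basic(5), of P] in auto)
qed

lemma ap_diff: "ap f (\<lambda>i. x i - y i) = (\<lambda>i. ap f x i - ap f y i)"
proof -
  have "ap f x = (\<lambda>i. ap f (\<lambda>i. x i - y i) i + ap f y i)"
    using ap_add[of f "\<lambda>i. x i - y i" y] by simp
  then show ?thesis by (subst \<open>ap f x = _\<close>) simp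
qed

lemma ap_of_nat: "ap f (\<lambda>i. of_nat m * x i) = (\<lambda>i. of_nat m * ap f x i)"
  by (induction m) (simp_all add: distrib_right ap_add)

text \<open>Commuting with the \<open>zhat i * zhat i\<close>, which act by the scalars \<open>(v i)\<^sup>2\<close>, confines an operator to the
  identity permutation; the cut condition confines it to transitive words. Those are too long.\<close>
lemma rigidity_step:
  fixes M :: "(point, 'a::ring_1) operator"
  assumes div: "\<And>m::int. m \<noteq> 0 \<Longrightarrow> \<exists>r::'a. of_int m * r = 1"
    and P: "finite P" "P \<noteq> {}" and d: "d < 2 * card P - 2"
    and M: "local_op P d M"
    and z: "\<And>i. i \<in> P \<Longrightarrow> M * (zhat i * zhat i) = zhat i * zhat i * M"
    and cut: "\<And>S. S \<subseteq> P \<Longrightarrow> S \<noteq> {} \<Longrightarrow> S \<noteq> P \<Longrightarrow> M * opM (\<lambda>v A. S \<in> A) = 0"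
  shows "M = 0"
proof -
  have zap: "ap (zhat i * zhat i) F (v, A, b) = of_nat ((Perm.apply v i)\<^sup>2) * F (v, A, b)" for i and F :: "point \<Rightarrow> 'a" and v A b
    by (simp add: zhat_square opZ_def power2_eq_square mult.assoc)
  \<comment> \<open>Such a \<open>G\<close> is obtained from some \<open>G'\<close> by the operator
    \<open>zhat i * zhat i\<close> minus its value \<open>c\<close> at \<open>v\<close>. Commuted
    past \<open>M\<close>, this operator is evaluated at \<open>v\<close> itself and gives
    zero.\<close>
  have 1: "ap M G (v, UNIV, b) = 0"
    if i: "i \<in> P" and G: "\<And>v' A b'. Perm.apply v' i = Perm.apply v i \<Longrightarrow> G (v', A, b') = 0" for i G v b
  proof -
    define c where "c = (Perm.apply v i)\<^sup>2"
    \<comment> \<open>\<open>r m\<close> inverts m - c. Its value at m = c does not matter: equal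
      squares of naturals give v' i = v i, where \<open>G\<close> vanishes.\<close>
    have "\<exists>r::'a. m \<noteq> c \<longrightarrow> of_int (int m - int c) * r = 1" for m
      using div[of "int m - int c"] by (cases "m = c") auto
    then obtain r :: "nat \<Rightarrow> 'a" where r: "\<And>m. m \<noteq> c \<Longrightarrow> of_int (int m - int c) * r m = 1" by metis
    define G' where "G' = (\<lambda>(v', A, b'). r ((Perm.apply v' i)\<^sup>2) * G (v', A, b'))"
    have "G p = ap (zhat i * zhat i) G' p - of_nat c * G' p" for p
    proof -
      obtain v' A b' where p: "p = (v', A, b')" by (cases p)
      let ?m = "(Perm.apply v' i)\<^sup>2"
      have "ap (zhat i * zhat i) G' p = of_nat ?m * (r ?m * G p)"
        unfolding p zap by (simp add: G'_def)
      moreover have "G' p = r ?m * G p" by (simp add: p G'_def)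
      ultimately have "ap (zhat i * zhat i) G' p - of_nat c * G' p = of_int (int ?m - int c) * r ?m * G p"
        by (simp add: left_diff_distrib mult.assoc)
      also have "\<dots> = G p"
      proof (cases "?m = c")
        case True
        then have "Perm.apply v' i = Perm.apply v i" by (simp add: c_def)
        then show ?thesis using G p by simp
      next
        case False
        from r[OF False] show ?thesis by (simp only: mult_1_left)
      qed
      finally show ?thesis ..
    qed
    then have "G = (\<lambda>p. ap (zhat i * zhat i) G' p - of_nat c * G' p)" by auto
    then have "ap M G (v, UNIV, b) = ap (M * (zhat i * zhat i)) G' (v, UNIV, b) - of_nat c * ap M G' (v, UNIV, b)"
      by (simp only: ap_diff ap_of_nat ap_simps)
    also have "\<dots> = 0" unfolding z[OF i] times_operator.rep_eq[of "zhat i * zhat i"] zap c_def by simp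
    finally show ?thesis .
  qed
  \<comment> \<open>Index by index, the values of \<open>F\<close> at permutations that differ from
    \<open>v\<close> on \<open>Q\<close> can be discarded.\<close>
  have 2: "ap M F (v, UNIV, b) = ap M (\<lambda>(v', A, b'). if \<forall>i\<in>Q. Perm.apply v' i = Perm.apply v i then F (v', A, b') else 0) (v, UNIV, b)"
    if "finite Q" "Q \<subseteq> P" for Q F v b
    using that
  proof (induction Q)
    case empty
    have "(\<lambda>(v', A, b'). F (v', A, b')) = F" by auto
    then show ?case by simp
  next
    case (insert i Q)
    define F1 where "F1 = (\<lambda>(v', A, b'). if \<forall>i\<in>Q. Perm.apply v' i = Perm.apply v i then F (v', A, b') else 0)"
    define F2 where "F2 = (\<lambda>(v', A, b'). if \<forall>i\<in>insert i Q. Perm.apply v' i = Perm.apply v i then F (v', A, b') else 0)"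
    have "ap M (\<lambda>p. F1 p - F2 p) (v, UNIV, b) = 0"
      by (rule 1[of i]) (use insert.prems in \<open>auto simp: F1_def F2_def\<close>)
    then have "ap M F1 (v, UNIV, b) = ap M F2 (v, UNIV, b)" by (simp add: ap_diff)
    moreover have "ap M F (v, UNIV, b) = ap M F1 (v, UNIV, b)"
      unfolding F1_def by (rule insert.IH) (use insert.prems in auto)
    ultimately show ?case unfolding F2_def by (rule trans[rotated])
  qed
  \<comment> \<open>Cut by cut, the values of \<open>F\<close> at points whose family still contains
    a proper nonempty subset of \<open>P\<close> can be discarded.\<close>
  have 3: "ap M F p = ap M (\<lambda>(v', A, b'). if \<forall>S\<in>W. S \<notin> A then F (v', A, b') else 0) p"
    if "finite W" "W \<subseteq> {S. S \<subseteq> P \<and> S \<noteq> {} \<and> S \<noteq> P}" for W F p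
    using that
  proof (induction W)
    case empty
    have "(\<lambda>(v', A, b'). F (v', A, b')) = F" by auto
    then show ?case by simp
  next
    case (insert S W)
    define F1 where "F1 = (\<lambda>(v' :: nat perm, A, b'). if \<forall>S\<in>W. S \<notin> A then F (v', A, b') else 0)"
    define F2 where "F2 = (\<lambda>(v' :: nat perm, A, b'). if \<forall>S\<in>insert S W. S \<notin> A then F (v', A, b') else 0)"
    have "(\<lambda>p. F1 p - F2 p) = ap (opM (\<lambda>v A. S \<in> A)) F1"
      by (auto simp: F1_def F2_def opM_def)
    then have "ap M (\<lambda>p. F1 p - F2 p) p = ap (M * opM (\<lambda>v A. S \<in> A)) F1 p" by simp
    also have "\<dots> = 0" using cut[of S] insert.prems by simp
    finally have "ap M F1 p = ap M F2 p" by (simp add: ap_diff)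
    moreover have "ap M F p = ap M F1 p"
      unfolding F1_def by (rule insert.IH) (use insert.prems in auto)
    ultimately show ?case unfolding F2_def by (rule trans[rotated])
  qed
  have "ap M F (v, UNIV, b) = 0" for F v b
  proof -
    let ?W = "{S. S \<subseteq> P \<and> S \<noteq> {} \<and> S \<noteq> P}"
    have "finite ?W" by (rule finite_subset[of _ "Pow P"]) (use P in auto)
    have "ap M F (v, UNIV, b) = ap M (\<lambda>(v', A, b'). if \<forall>S\<in>?W. S \<notin> A then
        (\<lambda>(v', A, b'). if \<forall>i\<in>P. Perm.apply v' i = Perm.apply v i then F (v', A, b') else 0) (v', A, b') else 0) (v, UNIV, b)"
      unfolding 2[OF P(1) subset_refl, of F] by (rule 3) (use \<open>finite ?W\<close> in auto)
    also have "\<dots> = 0"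
    proof (rule local_opD[OF M])
      fix es b' assume es: "length es = d" "set es \<subseteq> P \<times> P"
      \<comment> \<open>A point that survives both restrictions would be reached by a word of
        \<open>d\<close> letters whose product is the identity and which crosses every cut of
        \<open>P\<close>; such words have at least 2 * card P - 2 letters.\<close>
      have "\<not> ((\<forall>S\<in>?W. S \<notin> UNIV \<inter> respecting es) \<and> (\<forall>i\<in>P. Perm.apply (v * swaps es) i = Perm.apply v i))"
      proof
        assume *: "(\<forall>S\<in>?W. S \<notin> UNIV \<inter> respecting es) \<and> (\<forall>i\<in>P. Perm.apply (v * swaps es) i = Perm.apply v i)"
        have out: "Perm.apply (swaps es) i = i" if "i \<notin> P" for i
          using es(2) that
        proof (induction es)
          case (Cons e es)
          then show ?case by (cases e) (auto simp: apply_times apply_swap)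
        qed simp
        have "swaps es = 1"
        proof (rule perm_eqI)
          fix i show "Perm.apply (swaps es) i = Perm.apply 1 i"
            using * out[of i] by (cases "i \<in> P") (auto simp: apply_times apply_inj)
        qed
        then have "2 * card P - 2 \<le> length es"
        proof (rule transitive_factorization_length[OF P, rotated])
          fix S assume "S \<in> saturated P es"
          then have "S \<subseteq> P" "S \<in> respecting es" by (auto simp: saturated_def respecting_def)
          then show "S = {} \<or> S = P" using * by auto
        qed (use es in auto)
        then show False using d es by simp
      qed
      then show "(\<lambda>(v', A, b'). if \<forall>S\<in>?W. S \<notin> A then
        (\<lambda>(v', A, b'). if \<forall>i\<in>P. Perm.apply v' i = Perm.apply v i then F (v', A, b') else 0) (v', A, b') else 0)
          (v * swaps es, UNIV \<inter> respecting es, b') = 0"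
        by auto
    qed
    finally show ?thesis .
  qed
  \<comment> \<open>The family \<open>UNIV\<close> was enough: \<open>opR A\<close> replaces it by
    \<open>A\<close> and commutes with \<open>M\<close>.\<close>
  moreover have "ap M F (v, A, b) = ap M (ap (opR A) F) (v, UNIV, b)" for F v A b
  proof -
    have "ap M F (v, A, b) = ap (opR A * M) F (v, UNIV, b)" by (simp add: opR_def)
    then show ?thesis unfolding local_op_commute[OF M] by simp
  qed
  ultimately show ?thesis by (intro operator_eqI) (metis ap_simps(1) prod_cases3)
qed

lemma prod_list_intertwine:
  "(\<And>i. i \<in> set l \<Longrightarrow> u i * e = e * w i) \<Longrightarrow> prod_list (map u l) * e = e * (prod_list (map w l) :: 'a::ring_1)"
proof (induction l)
  case (Cons a l)
  have "u a * (prod_list (map u l) * e) = e * (w a * prod_list (map w l))"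
    using Cons by (simp add: mult.assoc[symmetric])
  then show ?case by (simp add: mult.assoc)
qed simp

lemma omit_prod_intertwine:
  "(\<And>i. i \<in> set l \<Longrightarrow> u i * e = e * w i) \<Longrightarrow> omit_prod u l * e = e * (omit_prod w l :: 'a::ring_1)"
proof (induction l)
  case (Cons a l)
  have "u a * (omit_prod u l * e) = e * (w a * omit_prod w l)"
    using Cons by (simp add: mult.assoc[symmetric])
  then show ?case using prod_list_intertwine[of l u e w] Cons.prems
    by (simp add: mult.assoc left_diff_distrib right_diff_distrib)
qed simp

lemma esym_intertwine:
  "(\<And>i. i \<in> set l \<Longrightarrow> u i * e = e * w i) \<Longrightarrow> esym k (map u l) * e = e * (esym k (map w l) :: 'a::ring_1)"
proof (induction l arbitrary: k)
  case Nil then show ?case by (cases k) auto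
next
  case (Cons a l)
  show ?case
  proof (cases k)
    case (Suc k')
    have "u a * (esym k' (map u l) * e) = e * (w a * esym k' (map w l))"
      using Cons by (simp add: mult.assoc[symmetric])
    then show ?thesis using Suc Cons by (simp add: mult.assoc distrib_left distrib_right)
  qed simp
qed

lemma fps_const_prod_list: "prod_list (map (\<lambda>i. fps_const (z i)) l) = fps_const (prod_list (map z l))"
  by (induction l) auto

lemma fps_const_omit_prod: "omit_prod (\<lambda>i. fps_const (z i)) l = fps_const (omit_prod z l)"
  by (induction l) (auto simp: fps_const_prod_list)

lemma fps_const_esym: "esym k (map (\<lambda>i. fps_const (z i)) l) = fps_const (esym k (map z l))"
proof (induction l arbitrary: k)
  case Nil then show ?case by (cases k) auto
next
  case (Cons a l) then show ?case by (cases k) auto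
qed

lemma of_int_sign_cancel: "s = 1 \<or> s = - 1 \<Longrightarrow> of_int s * a = of_int s * b \<Longrightarrow> a = (b::'a::ring_1)"
  by auto

text \<open>A common eigenvector of all \<open>opT i j\<close>: applying words in the \<open>xhat\<close> to it recovers the words in the \<open>x\<close>.\<close>
definition vacuum :: "'a \<Rightarrow> point \<Rightarrow> 'a::ring_1" where
  "vacuum a = (\<lambda>(v, A, b). if b \<subseteq> {0} then a else 0)"

lemma opC_vacuum: "ap (opC 0) (vacuum a) = vacuum a"
  "ap (opC' (Suc i)) (vacuum a) = (\<lambda>p. - ap (opC (Suc i)) (vacuum a) p)"
proof -
  show "ap (opC 0) (vacuum a) = vacuum a"
    by (auto simp: fun_eq_iff opC_def vacuum_def sgn_below_def)
  show "ap (opC' (Suc i)) (vacuum a) = (\<lambda>p. - ap (opC (Suc i)) (vacuum a) p)"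
    by (auto simp: fun_eq_iff opC'_def opN_def opC_def vacuum_def)
qed

lemma ap_uminus: "ap f (\<lambda>i. - x i) = (\<lambda>i. - ap f x i)"
  using ap_diff[of f "\<lambda>_. 0" x] by simp

text \<open>On the vacuum \<open>opC 0\<close> acts as the identity and \<open>opD'\<close> as minus
  \<open>opD\<close>, so \<open>opT\<close> acts as minus the square of \<open>opD\<close>, and that
  square is 2.\<close>

lemma opT_vacuum: "i \<noteq> j \<Longrightarrow> ap (opT i j) (vacuum a) = vacuum (- 2 * a)"
proof -
  assume ij: "i \<noteq> j"
  have "ap (opD' i j) (vacuum a) = (\<lambda>p. - ap (opD i j) (vacuum a) p)"
    by (simp add: opD'_def opD_def opJ_def opJ'_def opC_vacuum fun_eq_iff)
  then have "ap (opT i j) (vacuum a) = (\<lambda>p. - ap (opD i j * opD i j) (vacuum a) p)"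
    by (simp add: opT_def opC_vacuum ap_uminus)
  also have "opD i j * opD i j = (2 :: (point, 'a) operator)"
    by (simp add: opD_def algebra_simps J.square J.anticommute[OF ij])
  also have "(\<lambda>p. - ap 2 (vacuum a) p) = vacuum (- 2 * a)"
  proof -
    have "ap (1 + 1) F p = F p + F p" for F :: "point \<Rightarrow> 'a" and p by (simp only: ap_simps)
    from this[unfolded one_add_one] have "ap 2 F p = F p + F p" for F :: "point \<Rightarrow> 'a" and p .
    then show ?thesis by (auto simp: fun_eq_iff vacuum_def mult_2)
  qed
  finally show ?thesis .
qed

lemma opS_vacuum: "ap (opS i j) (vacuum a) = vacuum a" and opH_vacuum: "ap (opH i j) (vacuum a) = vacuum a"
  and opL_vacuum: "ap (opL c) (vacuum a) = vacuum (c * a)"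
  by (auto simp: fun_eq_iff vacuum_def opS_def opH_def opL_def)

lemma xhat_vacuum: "i \<noteq> j \<Longrightarrow> ap (xhat x i j) (vacuum a) = vacuum (- 2 * (x i j * a))"
  by (simp add: xhat_def opU_def opS_vacuum opH_vacuum opT_vacuum opL_vacuum mult_2 distrib_left right_diff_distrib)

text \<open>\<open>m\<close> is the element of the original ring represented by the coefficient of
  h^D; each of the D letters contributes one eigenvalue -2 of \<open>opT\<close>. The bound on the
  degree is included to make the notion multiplicative.\<close>

definition leading :: "nat \<Rightarrow> (point, 'a::ring_1) operator fps \<Rightarrow> 'a \<Rightarrow> bool" where
  "leading D f m \<longleftrightarrow> (\<forall>d>D. fps_nth f d = 0) \<and> (\<forall>a. ap (fps_nth f D) (vacuum a) = vacuum ((- 2) ^ D * (m * a)))"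

lemma vacuum_add: "vacuum (a + b) = (\<lambda>p. vacuum a p + vacuum b p)"
  and vacuum_diff: "vacuum (a - b) = (\<lambda>p. vacuum a p - vacuum b p)"
  and vacuum_0: "vacuum 0 = (\<lambda>p. 0)"
  by (auto simp: vacuum_def fun_eq_iff)

lemma leading_0: "leading D 0 0"
  by (simp add: leading_def vacuum_0 fun_eq_iff)

lemma leading_1: "leading 0 1 1"
  by (simp add: leading_def fun_eq_iff)

lemma leading_add: "leading D f m \<Longrightarrow> leading D g k \<Longrightarrow> leading D (f + g) (m + k)"
  and leading_diff: "leading D f m \<Longrightarrow> leading D g k \<Longrightarrow> leading D (f - g) (m - k)"
  by (auto simp: leading_def distrib_left distrib_right left_diff_distrib right_diff_distrib vacuum_add vacuum_diff fun_eq_iff)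

lemma leading_mult:
  assumes "leading D f m" "leading E g k"
  shows "leading (D + E) (f * g) (m * k)"
proof -
  have "(- 2) ^ D * (m * ((- 2) ^ E * b)) = (- 2) ^ (D + E) * (m * b)" for b
  proof -
    have c: "m * of_int i = of_int i * m" for i by (rule mult_of_int_commute[symmetric])
    have "m * (- 2) ^ E = (- 2) ^ E * m" using c[of "(- 2) ^ E"] by simp
    then show ?thesis by (simp add: power_add mult.assoc) (simp add: mult.assoc[symmetric])
  qed
  then show ?thesis
    using assms fps_nth_mult_high[of D f E g] by (auto simp: leading_def mult.assoc)
qed

text \<open>In positive degree a constant series has coefficient 0, hence (-2)^D * m = 0, and the
  power of -2 is invertible. Here independence of h turns into an identity in the original
  ring.\<close>

lemma leading_const_0:
  assumes div: "\<And>m::int. m \<noteq> 0 \<Longrightarrow> \<exists>r::'a. of_int m * r = 1"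
    and l: "leading D (fps_const c) m" "D > 0"
  shows "m = (0::'a::ring_1)"
proof -
  have "ap (fps_nth (fps_const c) D) (vacuum 1) = vacuum ((- 2) ^ D * (m * 1))"
    using l(1) unfolding leading_def by blast
  then have "vacuum ((- 2) ^ D * m) = (\<lambda>_. 0)" using l(2) by simp
  then have "vacuum ((- 2) ^ D * m) (1, {}, {}) = 0" by simp
  then have "(- 2) ^ D * m = 0" by (simp add: vacuum_def)
  moreover obtain r :: 'a where "of_int ((- 2) ^ D) * r = 1" using div[of "(- 2) ^ D"] by auto
  moreover have "of_int ((- 2) ^ D) * r = r * of_int ((- 2) ^ D)" by (rule mult_of_int_commute)
  ultimately show ?thesis by (metis mult.assoc mult_1_left mult_zero_right of_int_minus of_int_numeral of_int_power)
qed

lemma leading_prod_list: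
  "(\<And>i. i \<in> set l \<Longrightarrow> leading 1 (u i) (w i)) \<Longrightarrow> leading (length l) (prod_list (map u l)) (prod_list (map w l))"
proof (induction l)
  case (Cons a l)
  then show ?case using leading_mult[of 1 "u a" "w a" "length l" "prod_list (map u l)"] by simp
qed (simp add: leading_1)

lemma leading_omit_prod:
  "(\<And>i. i \<in> set l \<Longrightarrow> leading 1 (u i) (w i)) \<Longrightarrow> leading (length l - 1) (omit_prod u l) (omit_prod w l)"
proof (induction l)
  case (Cons a l)
  have "leading (length l) (u a * omit_prod u l) (w a * omit_prod w l)"
    using Cons leading_mult[of 1 "u a" "w a" "length l - 1" "omit_prod u l"]
    by (cases l) (auto simp: leading_0)
  then show ?case using leading_prod_list[of l u w] Cons.prems by (auto intro: leading_diff)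
qed (simp add: leading_0)

lemma leading_esym:
  "(\<And>i. i \<in> set l \<Longrightarrow> leading 2 (u i) (w i)) \<Longrightarrow> leading (2 * k) (esym k (map u l)) (esym k (map w l))"
proof (induction l arbitrary: k)
  case Nil
  show ?case by (cases k) (auto simp: leading_0 leading_1)
next
  case (Cons a l)
  show ?case
  proof (cases k)
    case (Suc k')
    have "leading (2 * Suc k') (u a * esym k' (map u l)) (w a * esym k' (map w l))"
      using leading_mult[of 2 "u a" "w a" "2 * k'"] Cons by simp
    moreover have "leading (2 * Suc k') (esym (Suc k') (map u l)) (esym (Suc k') (map w l))"
      by (rule Cons.IH) (use Cons.prems in auto)
    ultimately show ?thesis using leading_add Suc by fastforce
  qed (simp add: leading_1)
qed

text \<open>If \<open>S\<close> separates \<open>i\<close> from \<open>j\<close>, then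
  \<open>opH i j\<close> deletes it and the subsequent test for \<open>S\<close> fails; otherwise
  the test is unaffected. Multiplication by this indicator thus sets to zero the elements that join
  \<open>S\<close> to its complement.\<close>

lemma opM_xhat:
  "xhat x i j * opM (\<lambda>v A. S \<in> A) = (if i \<in> S \<longleftrightarrow> j \<in> S then opM (\<lambda>v A. S \<in> A) * xhat x i j else 0)"
proof -
  let ?M = "opM (\<lambda>v A. S \<in> A)"
  have H: "opS i j * opH i j * ?M = (if i \<in> S \<longleftrightarrow> j \<in> S then ?M * (opS i j * opH i j) else 0)"
    by (rule operator_eqI) (auto simp: op_defs)
  have T: "?M * opT i j = opT i j * ?M" by (rule opT_commuteI) (simp_all add: op_commute)
  have "xhat x i j * ?M = opL (x i j) * (opT i j * (opS i j * opH i j * ?M))"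
    by (simp add: xhat_def opU_def mult.assoc)
  also have "\<dots> = (if i \<in> S \<longleftrightarrow> j \<in> S then opL (x i j) * (opT i j * (?M * (opS i j * opH i j))) else 0)"
    unfolding H by simp
  also have "opL (x i j) * (opT i j * (?M * (opS i j * opH i j))) = ?M * xhat x i j"
  proof -
    have "opT i j * (?M * b) = ?M * (opT i j * b)" "opL c * (?M * b) = ?M * (opL c * b)" for b and c :: 'a
      by (simp_all only: mult.assoc[symmetric] T op_commute)
    then show ?thesis by (simp add: xhat_def opU_def)
  qed
  finally show ?thesis .
qed

text \<open>Once all lower coefficients of \<open>f\<close> vanish, the degree d part of h i * f = f
  * h i involves only the constant coefficient of \<open>h i\<close>. This is the commutation that
  \<open>rigidity_step\<close> asks for.\<close>

lemma rigidity:
  fixes f :: "(point, 'a::ring_1) operator fps"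
  assumes div: "\<And>m::int. m \<noteq> 0 \<Longrightarrow> \<exists>r::'a. of_int m * r = 1"
    and P: "finite P" "P \<noteq> {}"
    and f: "filtered P D f" "D < 2 * card P - 2"
    and h: "\<And>i. i \<in> P \<Longrightarrow> fps_nth (h i) 0 = zhat i * zhat i" "\<And>i. i \<in> P \<Longrightarrow> h i * f = f * h i"
    and cut: "\<And>S. S \<subseteq> P \<Longrightarrow> S \<noteq> {} \<Longrightarrow> S \<noteq> P \<Longrightarrow> f * fps_const (opM (\<lambda>v A. S \<in> A)) = 0"
  shows "f = 0"
proof (rule fps_ext)
  fix d show "fps_nth f d = fps_nth 0 d"
  proof (induction d rule: less_induct)
    case (less d)
    show ?case
    proof (cases "d \<le> D")
      case True
      have "fps_nth f d = 0"
      proof (rule rigidity_step[OF div P])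
        show "d < 2 * card P - 2" using True f(2) by simp
        show "local_op P d (fps_nth f d)" using f(1) by (simp add: filtered_def)
        show "fps_nth f d * opM (\<lambda>v A. S \<in> A) = 0" if "S \<subseteq> P" "S \<noteq> {}" "S \<noteq> P" for S
          using arg_cong[OF cut[OF that], of "\<lambda>g. fps_nth g d"] by simp
        show "fps_nth f d * (zhat i * zhat i) = zhat i * zhat i * fps_nth f d" if i: "i \<in> P" for i
        proof -
          have "fps_nth (h i * f) d = (\<Sum>a\<in>{0}. fps_nth (h i) a * fps_nth f (d - a))"
            unfolding fps_mult_nth by (rule sum.mono_neutral_right) (auto simp: less.IH)
          moreover have "fps_nth (f * h i) d = (\<Sum>a\<in>{d}. fps_nth f a * fps_nth (h i) (d - a))"
            unfolding fps_mult_nth by (rule sum.mono_neutral_right) (auto simp: less.IH)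
          ultimately show ?thesis using h[OF i] by simp
        qed
      qed
      then show ?thesis by simp
    qed (use f(1) in \<open>auto simp: filtered_def\<close>)
  qed
qed

section \<open>Induction over the index set\<close>

context quadratic_relations
begin

interpretation hat: equivariant_relations "xhat x" zhat
  by (rule equivariant_hat)

abbreviation (input) "zc i \<equiv> fps_const (zhat i :: (point, 'a) operator)"
abbreviation (input) "cut_op S \<equiv> fps_const (opM (\<lambda>v A. S \<in> A) :: (point, 'a) operator)"

lemma zhat_opM: "zhat i * opM Q = opM Q * (zhat i :: (point, 'a) operator)"
proof -
  have "opM Q * (opZ i * b) = opZ i * (opM Q * b)" for b :: "(point, 'a) operator"
    by (simp only: mult.assoc[symmetric] op_commute)
  then show ?thesis by (simp add: zhat_def opJ_def mult.assoc op_commute)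
qed

lemma zhat_cut: "zc i * cut_op S = cut_op S * zc i"
  by (simp add: zhat_opM)

lemma deformed_cut:
  assumes "finite P" "i \<in> P" "S \<subseteq> P"
  shows "hat.deformed P i * cut_op S = cut_op S * hat.deformed (if i \<in> S then S else P - S) i"
proof -
  let ?B = "if i \<in> S then S else P - S"
  have "hat.dunkl P i * opM (\<lambda>v A. S \<in> A) = (\<Sum>j\<in>P - {i}. if i \<in> S \<longleftrightarrow> j \<in> S then opM (\<lambda>v A. S \<in> A) * xhat x i j else 0)"
    by (simp add: hat.dunkl_def sum_distrib_right opM_xhat)
  also have "\<dots> = (\<Sum>j\<in>?B - {i}. opM (\<lambda>v A. S \<in> A) * xhat x i j)"
    by (rule sum.mono_neutral_cong_right) (use assms in auto)
  finally have *: "hat.dunkl P i * opM (\<lambda>v A. S \<in> A) = opM (\<lambda>v A. S \<in> A) * hat.dunkl ?B i"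
    by (simp add: hat.dunkl_def sum_distrib_left)
  have X: "fps_const a * (fps_X * b) = fps_X * (fps_const a * b)" for a :: "(point, 'a) operator" and b
    by (metis fps_mult_fps_X_commute mult.assoc)
  show ?thesis unfolding hat.deformed_def distrib_left distrib_right X fps_const_mult mult.assoc zhat_opM * ..
qed

definition deformation_trivial :: "nat set \<Rightarrow> bool" where
  "deformation_trivial P \<longleftrightarrow> (\<forall>l. distinct l \<longrightarrow> set l = P \<longrightarrow>
    prod_list (map (hat.deformed P) l) = prod_list (map zc l) \<and>
    omit_prod (hat.deformed P) l = omit_prod zc l \<and>
    (\<forall>k. esym k (map (\<lambda>i. hat.deformed P i * hat.deformed P i) l) = esym k (map (\<lambda>i. zc i * zc i) l)))"

lemma zc_anticommuting: "anticommuting_on I zc"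
  unfolding anticommuting_on_def
proof (intro ballI impI)
  fix i j :: nat assume "i \<noteq> j"
  show "zc i * zc j = - (zc j * zc i)"
    by (simp only: fps_const_mult fps_const_neg hat.z_anticommute[OF \<open>i \<noteq> j\<close>])
qed

lemma deformed_anticommuting: "finite P \<Longrightarrow> anticommuting_on P (hat.deformed P)"
  unfolding anticommuting_on_def using hat.deformed_anticommute by blast

text \<open>The two blocks are deformed separately but still anticommute with each other. Making
  them contiguous in the list costs the same sign for \<open>u\<close> and for the undeformed
  family, and \<open>omit_prod_append\<close> and \<open>esym_append\<close> then express everything
  through the single blocks.\<close>

lemma deformation_blocks:
  assumes P: "finite P" "S \<subseteq> P" and S: "deformation_trivial S" and T: "deformation_trivial (P - S)"
    and l: "distinct l" "set l = P"
  defines "u \<equiv> \<lambda>i. hat.deformed (if i \<in> S then S else P - S) i"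
  shows "prod_list (map u l) = prod_list (map zc l)"
    and "omit_prod u l = omit_prod zc l"
    and "esym k (map (\<lambda>i. u i * u i) l) = esym k (map (\<lambda>i. zc i * zc i) l)"
proof -
  define a where "a = filter (\<lambda>i. i \<in> S) l"
  define b where "b = filter (\<lambda>i. i \<notin> S) l"
  have ab: "distinct a" "distinct b" "set a = S" "set b = P - S"
    using l P by (auto simp: a_def b_def)
  have m: "mset l = mset (a @ b)" by (simp add: a_def b_def)
  have u: "anticommuting_on (set l) u"
    unfolding anticommuting_on_def
  proof (intro ballI impI)
    fix i j assume ij: "i \<in> set l" "j \<in> set l" "i \<noteq> j"
    have fin: "finite S" "finite (P - S)" using P finite_subset by auto
    show "u i * u j = - (u j * u i)"
    proof (cases "i \<in> S"; cases "j \<in> S")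
      assume "i \<in> S" "j \<in> S"
      then have "u i = hat.deformed S i" "u j = hat.deformed S j" by (simp_all add: u_def)
      then show ?thesis using hat.deformed_anticommute[OF fin(1) \<open>i \<in> S\<close> \<open>j \<in> S\<close> ij(3)] by (simp only:)
    next
      assume "i \<notin> S" "j \<notin> S"
      then have "u i = hat.deformed (P - S) i" "u j = hat.deformed (P - S) j" "i \<in> P - S" "j \<in> P - S"
        using ij l by (simp_all add: u_def)
      then show ?thesis using hat.deformed_anticommute[OF fin(2) _ _ ij(3)] by (simp only:)
    next
      assume "i \<in> S" "j \<notin> S"
      then have "u i = hat.deformed S i" "u j = hat.deformed (P - S) j" "j \<in> P - S"
        using ij l by (simp_all add: u_def)
      then show ?thesis using hat.deformed_disjoint_anticommute[of S "P - S" i j] \<open>i \<in> S\<close>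
        by (simp only: Diff_disjoint)
    next
      assume "i \<notin> S" "j \<in> S"
      then have "u i = hat.deformed (P - S) i" "u j = hat.deformed S j" "i \<in> P - S"
        using ij l by (simp_all add: u_def)
      moreover have "(P - S) \<inter> S = {}" by auto
      ultimately show ?thesis using hat.deformed_disjoint_anticommute[of "P - S" S i j] \<open>j \<in> S\<close>
        by (simp only:)
    qed
  qed
  have ua: "map u a = map (hat.deformed S) a" "map u b = map (hat.deformed (P - S)) b"
    using ab by (auto simp: u_def)
  have Sa: "prod_list (map u a) = prod_list (map zc a)" "omit_prod u a = omit_prod zc a"
    "esym k (map (\<lambda>i. u i * u i) a) = esym k (map (\<lambda>i. zc i * zc i) a)" for k
  proof -
    have "map (\<lambda>i. u i * u i) a = map (\<lambda>i. hat.deformed S i * hat.deformed S i) a" using ua(1) by simp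
    moreover note t = S[unfolded deformation_trivial_def, rule_format, of a]
    ultimately show "prod_list (map u a) = prod_list (map zc a)" "omit_prod u a = omit_prod zc a"
      "esym k (map (\<lambda>i. u i * u i) a) = esym k (map (\<lambda>i. zc i * zc i) a)"
      using ab by (simp_all only: ua(1) omit_prod_cong[OF ua(1)] t)
  qed
  have Tb: "prod_list (map u b) = prod_list (map zc b)" "omit_prod u b = omit_prod zc b"
    "esym k (map (\<lambda>i. u i * u i) b) = esym k (map (\<lambda>i. zc i * zc i) b)" for k
  proof -
    have "map (\<lambda>i. u i * u i) b = map (\<lambda>i. hat.deformed (P - S) i * hat.deformed (P - S) i) b" using ua(2) by simp
    moreover note t = T[unfolded deformation_trivial_def, rule_format, of b]
    ultimately show "prod_list (map u b) = prod_list (map zc b)" "omit_prod u b = omit_prod zc b"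
      "esym k (map (\<lambda>i. u i * u i) b) = esym k (map (\<lambda>i. zc i * zc i) b)"
      using ab by (simp_all only: ua(2) omit_prod_cong[OF ua(2)] t)
  qed
  have m': "mset (a @ b) = mset l" and d: "distinct (a @ b)" using m l(1) ab by auto
  obtain c where c: "\<forall>u :: nat \<Rightarrow> (point, 'a) operator fps. anticommuting_on (set (a @ b)) u \<longrightarrow>
    prod_list (map u l) = of_int c * prod_list (map u (a @ b)) \<and> omit_prod u l = of_int c * omit_prod u (a @ b)"
    using anticommuting_reorder[OF m' d, where ?'a = "(point, 'a) operator fps"] by blast
  have s: "set (a @ b) = set l" using m by (metis mset_eq_setD)
  have cu: "prod_list (map u l) = of_int c * prod_list (map u (a @ b))" "omit_prod u l = of_int c * omit_prod u (a @ b)"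
    using c u s by auto
  have cz: "prod_list (map zc l) = of_int c * prod_list (map zc (a @ b))" "omit_prod zc l = of_int c * omit_prod zc (a @ b)"
    using c zc_anticommuting by auto
  show "prod_list (map u l) = prod_list (map zc l)" unfolding cu cz using Sa Tb by simp
  show "omit_prod u l = omit_prod zc l" unfolding cu cz omit_prod_append Sa Tb ..
  have sq: "w i * w i * (w j * w j) = w j * w j * (w i * w i)"
    if "anticommuting_on (set l) w" "i \<in> set l" "j \<in> set l" for w :: "nat \<Rightarrow> (point, 'a) operator fps" and i j
  proof (cases "i = j")
    case False
    note * = anticommuting_onD[OF that False]
    have "w i * (w j * e) = - (w j * (w i * e))" for e by (simp only: mult.assoc[symmetric] * mult_minus_left)
    then show ?thesis by (simp add: mult.assoc *)
  qed simp
  have es: "esym k (map (\<lambda>i. w i * w i) l) = esym k (map (\<lambda>i. w i * w i) (a @ b))"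
    if "anticommuting_on (set l) w" for w :: "nat \<Rightarrow> (point, 'a) operator fps"
    by (rule esym_mset) (use m sq[OF that] in auto)
  show "esym k (map (\<lambda>i. u i * u i) l) = esym k (map (\<lambda>i. zc i * zc i) l)"
    unfolding es[OF u] es[OF zc_anticommuting] map_append esym_append Sa Tb ..
qed

lemma filtered_deformed: "i \<in> P \<Longrightarrow> filtered P 1 (hat.deformed P i)"
proof -
  assume i: "i \<in> P"
  have d: "local_op P 1 (hat.dunkl P i)"
    unfolding hat.dunkl_def by (rule local_op_sum) (use i local_op_xhat in auto)
  have "local_op P n (fps_nth (hat.deformed P i) n) \<and> (n > 1 \<longrightarrow> fps_nth (hat.deformed P i) n = 0)" for n
  proof -
    consider "n = 0" | "n = Suc 0" | m where "n = Suc (Suc m)" by (metis not0_implies_Suc)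
    then show ?thesis using d by cases (simp_all add: hat.deformed_nth local_op_zhat)
  qed
  then show ?thesis by (simp add: filtered_def)
qed

lemma leading_deformed: "leading 1 (hat.deformed P i) (dunkl P i)"
proof -
  have "ap (hat.dunkl P i) (vacuum a) = vacuum (- 2 * (dunkl P i * a))" for a
  proof -
    have *: "ap (hat.dunkl P i) (vacuum a) p = (\<Sum>j\<in>P - {i}. vacuum (- 2 * (x i j * a)) p)" for p
      unfolding hat.dunkl_def ap_sum by (intro sum.cong refl) (auto simp: xhat_vacuum)
    have "(\<Sum>j\<in>P - {i}. vacuum (c j) p) = vacuum (\<Sum>j\<in>P - {i}. c j) p" for c :: "nat \<Rightarrow> 'a" and p
      by (cases p) (simp add: vacuum_def)
    then show ?thesis unfolding fun_eq_iff * by (simp add: dunkl_def sum_distrib_left sum_distrib_right)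
  qed
  moreover have "fps_nth (hat.deformed P i) d = 0" if "d > 1" for d
  proof -
    have "d = Suc (Suc (d - 2))" using that by simp
    then show ?thesis by (metis hat.deformed_nth(3))
  qed
  ultimately show ?thesis unfolding leading_def by (simp add: hat.deformed_nth)
qed

theorem deformation_is_trivial:
  assumes div: "\<And>m::int. m \<noteq> 0 \<Longrightarrow> \<exists>r::'a. of_int m * r = 1"
  shows "finite P \<Longrightarrow> deformation_trivial P"
proof (induction "card P" arbitrary: P rule: less_induct)
  case less
  note fin = less.prems
  show ?case
  proof (cases "card P \<le> 1")
    case True
    have "hat.deformed P i = zc i" if "i \<in> P" for i
    proof -
      have "P - {i} = {}" using True fin that card_le_Suc0_iff_eq[OF fin] by auto
      then show ?thesis unfolding hat.deformed_def hat.dunkl_def by (simp only:) simp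
    qed
    then have *: "map (hat.deformed P) l = map zc l"
      "map (\<lambda>i. hat.deformed P i * hat.deformed P i) l = map (\<lambda>i. zc i * zc i) l" if "set l = P" for l
      using that by auto
    show ?thesis
      unfolding deformation_trivial_def by (intro allI impI) (simp only: * omit_prod_cong[OF *(1)] simp_thms)
  next
    case False
    then have card: "2 \<le> card P" and ne: "P \<noteq> {}" by auto
    have blocks: "deformation_trivial S" "deformation_trivial (P - S)" if "S \<subseteq> P" "S \<noteq> {}" "S \<noteq> P" for S
    proof -
      have "S \<subset> P" "P - S \<subset> P" using that by auto
      then have "card S < card P" "card (P - S) < card P" using psubset_card_mono[OF fin] by auto
      then show "deformation_trivial S" "deformation_trivial (P - S)"
        using less.hyps fin that(1) finite_subset by auto
    qed
    define h where "h = (\<lambda>i. hat.deformed P i * hat.deformed P i)"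
    have hi: "h i = hat.deformed P i * hat.deformed P i" for i by (simp add: h_def)
    have h0: "fps_nth (h i) 0 = zhat i * zhat i" for i
      by (simp add: h_def hat.deformed_nth)
    have hd: "h i * hat.deformed P j = hat.deformed P j * h i" if "i \<in> P" "j \<in> P" for i j
      unfolding h_def by (rule hat.deformed_square_commute_deformed[OF fin that])
    have hh: "h i * h j = h j * h i" if "i \<in> P" "j \<in> P" for i j
      unfolding hi[of j] mult.assoc[symmetric] hd[OF that] unfolding mult.assoc hd[OF that] ..
    show ?thesis
      unfolding deformation_trivial_def
    proof (intro allI impI)
      fix l :: "nat list" assume l: "distinct l" "set l = P"
      have len: "length l = card P" using l distinct_card by metis
      have fl: "filtered P 1 (hat.deformed P i)" if "i \<in> set l" for i
        using filtered_deformed l(2) that by blast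
      have fh: "filtered P 2 a" if "a \<in> set (map h l)" for a
      proof -
        from that obtain i where "i \<in> P" "a = h i" using l(2) by auto
        then show ?thesis using filtered_mult[OF filtered_deformed[of i P] filtered_deformed[of i P]] by (simp add: h_def numeral_2_eq_2)
      qed
      have zl: "local_op P 0 (prod_list (map zhat m))" for m :: "nat list"
      proof (induction m)
        case (Cons a m)
        then show ?case using local_op_mult[OF local_op_zhat Cons] by simp
      qed (simp add: local_op_basic)
      have zo: "local_op P 0 (omit_prod zhat m)" for m :: "nat list"
      proof (induction m)
        case (Cons a m)
        then show ?case using local_op_mult[OF local_op_zhat Cons] zl by (auto intro: local_op_diff)
      qed simp
      have ze: "local_op P 0 (esym k (map (\<lambda>i. zhat i * zhat i) m))" for k and m :: "nat list"
      proof (induction m arbitrary: k)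
        case Nil
        show ?case by (cases k) (simp_all add: local_op_basic)
      next
        case (Cons a m)
        show ?case
        proof (cases k)
          case (Suc k')
          then show ?thesis
            using local_op_mult[OF local_op_mult[OF local_op_zhat local_op_zhat] Cons[of k']] Cons[of "Suc k'"]
            by (auto intro: local_op_add)
        qed (simp add: local_op_basic)
      qed
      have zcsq: "zc i * zc i = fps_const (zhat i * zhat i)" for i by simp
      have P1: "prod_list (map zc l) = fps_const (prod_list (map zhat l))" by (rule fps_const_prod_list)
      have P2: "omit_prod zc l = fps_const (omit_prod zhat l)" by (rule fps_const_omit_prod)
      have P3: "esym k (map (\<lambda>i. zc i * zc i) l) = fps_const (esym k (map (\<lambda>i. zhat i * zhat i) l))" for k
        unfolding zcsq by (rule fps_const_esym)
      have rigid: "f = 0" if "filtered P D f" "D < 2 * card P - 2" "\<And>i. i \<in> P \<Longrightarrow> h i * f = f * h i"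
        "\<And>S. S \<subseteq> P \<Longrightarrow> S \<noteq> {} \<Longrightarrow> S \<noteq> P \<Longrightarrow> f * cut_op S = 0" for f D
        by (rule rigidity[OF div fin ne that(1,2) h0 that(3,4)])
      have A: "prod_list (map (hat.deformed P) l) = prod_list (map zc l)"
      proof (cases "card P = 2")
        case True
        then obtain i j where ij: "l = [i, j]" using len by (metis One_nat_def Suc_1 length_0_conv length_Suc_conv)
        then have "i \<noteq> j" "P = {i, j}" using l by auto
        then have d: "hat.dunkl P i = xhat x i j" "hat.dunkl P j = xhat x i j"
          by (auto simp: hat.dunkl_def hat.sym[of j i] insert_Diff_if)
        have "zhat i * xhat x i j + xhat x i j * zhat j = 0" using hat.x_z_same(2)[OF \<open>i \<noteq> j\<close>] by simp
        then show ?thesis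
          by (simp add: ij hat.deformed_product d hat.square_zero[OF \<open>i \<noteq> j\<close>])
      next
        case False
        have "prod_list (map (hat.deformed P) l) - prod_list (map zc l) = 0"
        proof (rule rigid)
          show "filtered P (card P) (prod_list (map (hat.deformed P) l) - prod_list (map zc l))"
            using filtered_prod_list[of l P, OF fl] filtered_mono[OF filtered_const[OF zl]]
            unfolding P1 len by (intro filtered_diff) auto
          show "card P < 2 * card P - 2" using False card by simp
        next
          fix i assume i: "i \<in> P"
          have "h i * prod_list (map (hat.deformed P) l) = prod_list (map (hat.deformed P) l) * h i"
            by (rule commute_prod_list) (use hd[OF i] l(2) in auto)
          then show "h i * (prod_list (map (hat.deformed P) l) - prod_list (map zc l)) =
              (prod_list (map (hat.deformed P) l) - prod_list (map zc l)) * h i"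
            using hat.deformed_square_z_words(1)[OF l i] unfolding P1 h_def
            by (simp only: left_diff_distrib right_diff_distrib)
        next
          fix S assume S: "S \<subseteq> P" "S \<noteq> {}" "S \<noteq> P"
          have "prod_list (map (hat.deformed P) l) * cut_op S
              = cut_op S * prod_list (map (\<lambda>i. hat.deformed (if i \<in> S then S else P - S) i) l)"
            by (rule prod_list_intertwine) (use deformed_cut[OF fin _ S(1)] l(2) in blast)
          moreover have "prod_list (map zc l) * cut_op S = cut_op S * prod_list (map zc l)"
            by (rule prod_list_intertwine) (rule zhat_cut)
          ultimately show "(prod_list (map (hat.deformed P) l) - prod_list (map zc l)) * cut_op S = 0"
            unfolding left_diff_distrib using deformation_blocks(1)[OF fin S(1) blocks[OF S] l] by simp
        qed
        then show ?thesis by simp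
      qed
      have B: "omit_prod (hat.deformed P) l = omit_prod zc l"
      proof -
        have "omit_prod (hat.deformed P) l - omit_prod zc l = 0"
        proof (rule rigid)
          show "filtered P (card P - 1) (omit_prod (hat.deformed P) l - omit_prod zc l)"
            using filtered_omit_prod[of l P, OF fl] filtered_mono[OF filtered_const[OF zo]]
            unfolding P2 len by (intro filtered_diff) auto
          show "card P - 1 < 2 * card P - 2" using card by simp
        next
          fix i assume i: "i \<in> P"
          have "h i * omit_prod (hat.deformed P) l = omit_prod (hat.deformed P) l * h i"
            by (rule commute_omit_prod) (use hd[OF i] l(2) in auto)
          then show "h i * (omit_prod (hat.deformed P) l - omit_prod zc l) =
              (omit_prod (hat.deformed P) l - omit_prod zc l) * h i"
            using hat.deformed_square_z_words(2)[OF l i] unfolding P2 h_def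
            by (simp only: left_diff_distrib right_diff_distrib)
        next
          fix S assume S: "S \<subseteq> P" "S \<noteq> {}" "S \<noteq> P"
          have "omit_prod (hat.deformed P) l * cut_op S
              = cut_op S * omit_prod (\<lambda>i. hat.deformed (if i \<in> S then S else P - S) i) l"
            by (rule omit_prod_intertwine) (use deformed_cut[OF fin _ S(1)] l(2) in blast)
          moreover have "omit_prod zc l * cut_op S = cut_op S * omit_prod zc l"
            by (rule omit_prod_intertwine) (rule zhat_cut)
          ultimately show "(omit_prod (hat.deformed P) l - omit_prod zc l) * cut_op S = 0"
            unfolding left_diff_distrib using deformation_blocks(2)[OF fin S(1) blocks[OF S] l] by simp
        qed
        then show ?thesis by simp
      qed
      have acP: "anticommuting_on (set l) (hat.deformed P)" unfolding l(2) by (rule deformed_anticommuting[OF fin])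
      have C: "esym k (map h l) = esym k (map (\<lambda>i. zc i * zc i) l)" for k
      proof -
        \<comment> \<open>The degree 2 k is below 2 * card P - 2 exactly if k + 2 <= card P. The
          indices card P and card P - 1 follow from the squares of \<open>A\<close> and
          \<open>B\<close>; beyond that both sides are 0.\<close>
        consider "k = card P" | "k = card P - 1" | "k > card P" | "k + 2 \<le> card P" using card by linarith
        then show ?thesis
        proof cases
          case 1
          have "of_int (square_sign (card P)) * esym k (map h l) = of_int (square_sign (card P)) * esym k (map (\<lambda>i. zc i * zc i) l)"
            unfolding h_def 1 len[symmetric] prod_list_square[OF acP l(1), symmetric]
              prod_list_square[OF zc_anticommuting l(1), symmetric] A ..
          then show ?thesis by (rule of_int_sign_cancel[OF square_sign_cases])
        next
          case 2
          have "l \<noteq> []" using len card by auto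
          have "of_int (square_sign (card P - 1)) * esym k (map h l) = of_int (square_sign (card P - 1)) * esym k (map (\<lambda>i. zc i * zc i) l)"
            unfolding h_def 2 len[symmetric] omit_prod_square[OF acP l(1) \<open>l \<noteq> []\<close>, symmetric]
              omit_prod_square[OF zc_anticommuting l(1) \<open>l \<noteq> []\<close>, symmetric] B ..
          then show ?thesis by (rule of_int_sign_cancel[OF square_sign_cases])
        next
          case 3
          then show ?thesis by (simp add: esym_eq_0 len)
        next
          case 4
          have "esym k (map h l) - esym k (map (\<lambda>i. zc i * zc i) l) = 0"
          proof (rule rigid)
            show "filtered P (2 * k) (esym k (map h l) - esym k (map (\<lambda>i. zc i * zc i) l))"
              using filtered_esym[of "map h l" P, OF fh] filtered_mono[OF filtered_const[OF ze]]
              unfolding P3 by (intro filtered_diff) auto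
            show "2 * k < 2 * card P - 2" using 4 by simp
          next
            fix i assume i: "i \<in> P"
            have "h i * esym k (map h l) = esym k (map h l) * h i"
              by (rule commute_esym) (use hh[OF i] l(2) in auto)
            then show "h i * (esym k (map h l) - esym k (map (\<lambda>i. zc i * zc i) l)) =
                (esym k (map h l) - esym k (map (\<lambda>i. zc i * zc i) l)) * h i"
              using hat.deformed_square_z_words(3)[OF l i, of k] unfolding P3 hi[of i]
              by (simp only: left_diff_distrib right_diff_distrib)
          next
            fix S assume S: "S \<subseteq> P" "S \<noteq> {}" "S \<noteq> P"
            let ?u = "\<lambda>i. hat.deformed (if i \<in> S then S else P - S) i"
            have "esym k (map h l) * cut_op S = cut_op S * esym k (map (\<lambda>i. ?u i * ?u i) l)"
            proof (rule esym_intertwine)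
              fix i assume "i \<in> set l"
              then have *: "hat.deformed P i * cut_op S = cut_op S * ?u i"
                using deformed_cut[OF fin _ S(1)] l(2) by blast
              show "h i * cut_op S = cut_op S * (?u i * ?u i)"
                unfolding h_def mult.assoc * unfolding mult.assoc[symmetric] * ..
            qed
            moreover have "esym k (map (\<lambda>i. zc i * zc i) l) * cut_op S = cut_op S * esym k (map (\<lambda>i. zc i * zc i) l)"
            proof (rule esym_intertwine)
              fix i show "zc i * zc i * cut_op S = cut_op S * (zc i * zc i)"
                unfolding mult.assoc zhat_cut unfolding mult.assoc[symmetric] zhat_cut ..
            qed
            ultimately show "(esym k (map h l) - esym k (map (\<lambda>i. zc i * zc i) l)) * cut_op S = 0"
              unfolding left_diff_distrib using deformation_blocks(3)[OF fin S(1) blocks[OF S] l] by simp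
          qed
          then show ?thesis by simp
        qed
      qed
      show "prod_list (map (hat.deformed P) l) = prod_list (map zc l) \<and>
        omit_prod (hat.deformed P) l = omit_prod zc l \<and>
        (\<forall>k. esym k (map (\<lambda>i. hat.deformed P i * hat.deformed P i) l) = esym k (map (\<lambda>i. zc i * zc i) l))"
        using A B C unfolding h_def by blast
    qed
  qed
qed

text \<open>Each deformed expression is constant in h, while its coefficient of h^D represents the
  same expression in the elements \<open>dunkl\<close>; D is \<open>length l\<close>,
  \<open>length l - 1\<close> or 2 k. The side conditions say that D is positive.\<close>

theorem dunkl_identities:
  assumes div: "\<And>m::int. m \<noteq> 0 \<Longrightarrow> \<exists>r::'a. of_int m * r = 1"
    and l: "distinct l"
  shows "l \<noteq> [] \<Longrightarrow> prod_list (map (dunkl (set l)) l) = 0"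
    and "length l \<ge> 2 \<Longrightarrow> omit_prod (dunkl (set l)) l = 0"
    and "k > 0 \<Longrightarrow> esym k (map (\<lambda>i. dunkl (set l) i * dunkl (set l) i) l) = 0"
proof -
  have t: "prod_list (map (hat.deformed (set l)) l) = fps_const (prod_list (map zhat l))"
    "omit_prod (hat.deformed (set l)) l = fps_const (omit_prod zhat l)"
    "esym k (map (\<lambda>i. hat.deformed (set l) i * hat.deformed (set l) i) l) = fps_const (esym k (map (\<lambda>i. zhat i * zhat i) l))" for k
    using deformation_is_trivial[OF div finite_set] l fps_const_prod_list[of zhat l] fps_const_omit_prod[of zhat l]
      fps_const_esym[of k "\<lambda>i. zhat i * zhat i" l]
    unfolding deformation_trivial_def by auto
  have d: "leading 1 (hat.deformed (set l) i) (dunkl (set l) i)" for i by (rule leading_deformed)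
  show "l \<noteq> [] \<Longrightarrow> prod_list (map (dunkl (set l)) l) = 0"
    using leading_prod_list[of l "hat.deformed (set l)" "dunkl (set l)", OF d] leading_const_0[OF div]
    unfolding t by auto
  show "length l \<ge> 2 \<Longrightarrow> omit_prod (dunkl (set l)) l = 0"
    using leading_omit_prod[of l "hat.deformed (set l)" "dunkl (set l)", OF d] leading_const_0[OF div]
    unfolding t by auto
  have "leading 2 (hat.deformed (set l) i * hat.deformed (set l) i) (dunkl (set l) i * dunkl (set l) i)" for i
    using leading_mult[OF d d] by (simp add: numeral_2_eq_2)
  from leading_esym[of l "\<lambda>i. hat.deformed (set l) i * hat.deformed (set l) i" "\<lambda>i. dunkl (set l) i * dunkl (set l) i" k, OF this]
  show "k > 0 \<Longrightarrow> esym k (map (\<lambda>i. dunkl (set l) i * dunkl (set l) i) l) = 0"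
    using leading_const_0[OF div] unfolding t by auto
qed

end

section \<open>The quadratic algebra of type D\<close>

text \<open>The algebra endomorphism of the free algebra that sends the letters outside
  \<open>X\<close> to 0.\<close>

lift_definition restrict_letters :: "'a set \<Rightarrow> ('a word \<Rightarrow>\<^sub>0 'k::comm_ring_1) \<Rightarrow> ('a word \<Rightarrow>\<^sub>0 'k)"
  is "\<lambda>X f w. f w when set (letters w) \<subseteq> X"
  by (erule finite_subset[rotated]) (auto simp: when_def)

lemma restrict_letters_add: "restrict_letters X (p + q) = restrict_letters X p + restrict_letters X q"
  and restrict_letters_diff: "restrict_letters X (p - q) = restrict_letters X p - restrict_letters X q"
  and restrict_letters_0 [simp]: "restrict_letters X 0 = 0"
  by (transfer; auto simp: fun_eq_iff when_def)+

lemma restrict_letters_1 [simp]: "restrict_letters X 1 = 1"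
  by transfer (auto simp: fun_eq_iff when_def zero_word_def)

lemma restrict_letters_mult: "restrict_letters X (p * q) = restrict_letters X p * restrict_letters X q"
proof (rule poly_mapping_eqI)
  fix k
  let ?ok = "\<lambda>w :: 'a word. set (letters w) \<subseteq> X"
  have ok: "?ok (l + m) \<longleftrightarrow> ?ok l \<and> ?ok m" for l m by (simp add: plus_word_def)
  have r: "Poly_Mapping.lookup (restrict_letters X f) w = (Poly_Mapping.lookup f w when ?ok w)" for f :: "'a word \<Rightarrow>\<^sub>0 'b" and w
    by (simp add: restrict_letters.rep_eq)
  have *: "(Poly_Mapping.lookup p l when ?ok l) * (\<Sum>m. (Poly_Mapping.lookup q m when ?ok m) when k = l + m)
      = (Poly_Mapping.lookup p l * (\<Sum>m. Poly_Mapping.lookup q m when k = l + m) when ?ok k)" for l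
  proof (cases "?ok l")
    case True
    then have "((Poly_Mapping.lookup q m when ?ok m) when k = l + m) = ((Poly_Mapping.lookup q m when k = l + m) when ?ok k)" for m
      using ok[of l m] by (auto simp: when_def)
    then show ?thesis using True by (cases "?ok k") simp_all
  next
    case False
    then have "?ok k \<Longrightarrow> k \<noteq> l + m" for m using ok by auto
    then show ?thesis using False by (cases "?ok k") simp_all
  qed
  show "Poly_Mapping.lookup (restrict_letters X (p * q)) k = Poly_Mapping.lookup (restrict_letters X p * restrict_letters X q) k"
    unfolding r lookup_mult * by (cases "?ok k") simp_all
qed

lemma restrict_letters_carrier: "restrict_letters X p \<in> carrier (free_algebra X)"
  by (auto simp: free_algebra_def in_keys_iff restrict_letters.rep_eq when_def split: if_splits)

lemma restrict_letters_id: "p \<in> carrier (free_algebra X) \<Longrightarrow> restrict_letters X p = p"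
  by (rule poly_mapping_eqI) (auto simp: free_algebra_def in_keys_iff restrict_letters.rep_eq when_def)

lemma restrict_letters_letter: "restrict_letters X (letter a) = (if a \<in> X then letter a else 0)"
  by (rule poly_mapping_eqI) (auto simp: letter_def restrict_letters.rep_eq when_def lookup_single)

lemma ideal_closed:
  fixes p q :: "reflection word \<Rightarrow>\<^sub>0 'k::comm_ring_1"
  shows "(0 :: reflection word \<Rightarrow>\<^sub>0 'k) \<in> quad_ideal_D n"
    and "p \<in> quad_ideal_D n \<Longrightarrow> q \<in> quad_ideal_D n \<Longrightarrow> p + q \<in> quad_ideal_D n"
    and "p \<in> quad_ideal_D n \<Longrightarrow> - p \<in> quad_ideal_D n"
    and "p \<in> quad_ideal_D n \<Longrightarrow> q \<in> carrier (free_algebra (reflections_D n)) \<Longrightarrow> q * p \<in> quad_ideal_D n"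
    and "p \<in> quad_ideal_D n \<Longrightarrow> q \<in> carrier (free_algebra (reflections_D n)) \<Longrightarrow> p * q \<in> quad_ideal_D n"
proof -
  interpret I: ideal "quad_ideal_D n :: (reflection word \<Rightarrow>\<^sub>0 'k) set" "free_algebra (reflections_D n)"
    by (rule ideal_quad_ideal_D)
  show "(0 :: reflection word \<Rightarrow>\<^sub>0 'k) \<in> quad_ideal_D n"
    using additive_subgroup.zero_closed[OF ideal.axioms(1)[OF I.ideal_axioms]] by (simp add: free_algebra_def)
  show "p \<in> quad_ideal_D n \<Longrightarrow> q \<in> quad_ideal_D n \<Longrightarrow> p + q \<in> quad_ideal_D n"
    using additive_subgroup.a_closed[OF ideal.axioms(1)[OF I.ideal_axioms], of p q] by (simp add: free_algebra_def)
  show l: "p \<in> quad_ideal_D n \<Longrightarrow> q \<in> carrier (free_algebra (reflections_D n)) \<Longrightarrow> q * p \<in> quad_ideal_D n"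
    for p q :: "reflection word \<Rightarrow>\<^sub>0 'k"
    using I.I_l_closed[of p q] by (simp add: free_algebra_def)
  show "p \<in> quad_ideal_D n \<Longrightarrow> q \<in> carrier (free_algebra (reflections_D n)) \<Longrightarrow> p * q \<in> quad_ideal_D n"
    using I.I_r_closed[of p q] by (simp add: free_algebra_def)
  have "- 1 \<in> carrier (free_algebra (reflections_D n) :: (reflection word \<Rightarrow>\<^sub>0 'k) ring)"
    by (simp add: free_algebra_def zero_word_def)
  from l[OF _ this] show "p \<in> quad_ideal_D n \<Longrightarrow> - p \<in> quad_ideal_D n" by simp
qed

text \<open>A single type for all ranks: an element is trivial if all its restrictions to finitely many
  indices are, and restriction is multiplicative.\<close>
definition null_relations :: "(reflection word \<Rightarrow>\<^sub>0 'k::comm_ring_1) set" where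
  "null_relations = {p. \<forall>n. restrict_letters (reflections_D n) p \<in> quad_ideal_D n}"

lemma null_relations_closed:
  "0 \<in> null_relations"
  "p \<in> null_relations \<Longrightarrow> q \<in> null_relations \<Longrightarrow> p + q \<in> null_relations"
  "p \<in> null_relations \<Longrightarrow> - p \<in> null_relations"
  "p \<in> null_relations \<Longrightarrow> q * p \<in> null_relations"
  "p \<in> null_relations \<Longrightarrow> p * q \<in> null_relations"
proof -
  have "restrict_letters X (- p) = - restrict_letters X p" for X
    using restrict_letters_diff[of X 0 p] by simp
  then show "p \<in> null_relations \<Longrightarrow> - p \<in> null_relations" by (simp add: null_relations_def ideal_closed)
qed (simp_all add: null_relations_def restrict_letters_add restrict_letters_mult ideal_closed restrict_letters_carrier)

text \<open>In rank 0 there are no relators, so the ideal is zero. This gives the inequality of 0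
  and 1 that the class \<open>ring_1\<close> demands of the quotient.\<close>

lemma one_not_null: "(1 :: reflection word \<Rightarrow>\<^sub>0 'k::comm_ring_1) \<notin> null_relations"
proof
  let ?F = "free_algebra (reflections_D 0) :: (reflection word \<Rightarrow>\<^sub>0 'k) ring"
  assume "(1 :: reflection word \<Rightarrow>\<^sub>0 'k) \<in> null_relations"
  then have "(1 :: reflection word \<Rightarrow>\<^sub>0 'k) \<in> quad_ideal_D 0"
    unfolding null_relations_def using restrict_letters_1 by (metis (mono_tags, lifting) mem_Collect_eq)
  moreover have "quad_ideal_D 0 \<subseteq> {\<zero>\<^bsub>?F\<^esub>}"
    unfolding quad_ideal_D_def
    by (rule ring.genideal_minimal[OF ring_free_algebra ring.zeroideal[OF ring_free_algebra]])
      (simp add: quad_relators_D_def)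
  ultimately show False by (auto simp: free_algebra_def)
qed

quotient_type (overloaded) 'k lambda = "reflection word \<Rightarrow>\<^sub>0 'k::field_char_0" / "\<lambda>p q. p - q \<in> null_relations"
proof (rule equivpI)
  show "reflp (\<lambda>p q :: reflection word \<Rightarrow>\<^sub>0 'k. p - q \<in> null_relations)"
    by (rule reflpI) (simp add: null_relations_closed)
  show "symp (\<lambda>p q :: reflection word \<Rightarrow>\<^sub>0 'k. p - q \<in> null_relations)"
  proof (rule sympI)
    fix p q :: "reflection word \<Rightarrow>\<^sub>0 'k"
    show "p - q \<in> null_relations \<Longrightarrow> q - p \<in> null_relations"
      using null_relations_closed(3)[of "p - q"] by simp
  qed
  show "transp (\<lambda>p q :: reflection word \<Rightarrow>\<^sub>0 'k. p - q \<in> null_relations)"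
  proof (rule transpI)
    fix p q r :: "reflection word \<Rightarrow>\<^sub>0 'k"
    show "p - q \<in> null_relations \<Longrightarrow> q - r \<in> null_relations \<Longrightarrow> p - r \<in> null_relations"
      using null_relations_closed(2)[of "p - q" "q - r"] by simp
  qed
qed

instantiation lambda :: (field_char_0) ring_1
begin

lift_definition zero_lambda :: "'a lambda" is 0 .
lift_definition one_lambda :: "'a lambda" is 1 .
lift_definition plus_lambda :: "'a lambda \<Rightarrow> 'a lambda \<Rightarrow> 'a lambda" is "(+)"
proof -
  fix p p' q q' :: "reflection word \<Rightarrow>\<^sub>0 'a"
  assume "p - p' \<in> null_relations" "q - q' \<in> null_relations"
  then show "p + q - (p' + q') \<in> null_relations"
    using null_relations_closed(2)[of "p - p'" "q - q'"] by (simp add: algebra_simps)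
qed
lift_definition uminus_lambda :: "'a lambda \<Rightarrow> 'a lambda" is uminus
proof -
  fix p p' :: "reflection word \<Rightarrow>\<^sub>0 'a"
  assume "p - p' \<in> null_relations"
  then show "- p - - p' \<in> null_relations"
    using null_relations_closed(3)[of "p - p'"] by simp
qed
lift_definition times_lambda :: "'a lambda \<Rightarrow> 'a lambda \<Rightarrow> 'a lambda" is "(*)"
proof -
  fix p p' q q' :: "reflection word \<Rightarrow>\<^sub>0 'a"
  assume "p - p' \<in> null_relations" "q - q' \<in> null_relations"
  then have "(p - p') * q + p' * (q - q') \<in> null_relations"
    by (intro null_relations_closed)
  then show "p * q - p' * q' \<in> null_relations" by (simp add: algebra_simps)
qed
definition minus_lambda :: "'a lambda \<Rightarrow> 'a lambda \<Rightarrow> 'a lambda" where "minus_lambda p q = p + - q"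

instance
proof
  show "(0 :: 'a lambda) \<noteq> 1"
    by transfer (use one_not_null null_relations_closed(3)[of "- 1"] in auto)
qed (unfold minus_lambda_def, (transfer; simp add: algebra_simps null_relations_closed)+)

end

definition cls :: "(reflection word \<Rightarrow>\<^sub>0 'k::field_char_0) \<Rightarrow> 'k lambda" where
  "cls = abs_lambda"

lemma cls_hom:
  "cls 0 = 0" "cls 1 = 1" "cls (p + q) = cls p + cls q" "cls (- p) = - cls p" "cls (p * q) = cls p * cls q"
  by (simp_all add: cls_def zero_lambda_def one_lambda_def plus_lambda.abs_eq uminus_lambda.abs_eq times_lambda.abs_eq)

lemma cls_sum: "cls (sum f A) = (\<Sum>a\<in>A. cls (f a))"
  by (induction A rule: infinite_finite_induct) (simp_all add: cls_hom)

lemma cls_prod_list: "cls (prod_list (map f l)) = prod_list (map (\<lambda>a. cls (f a)) l)"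
  by (induction l) (simp_all add: cls_hom)

lemma cls_eq_0: "cls p = 0 \<longleftrightarrow> p \<in> null_relations"
  by (simp add: cls_def zero_lambda_def lambda.abs_eq_iff)

definition sym_letter :: "nat \<Rightarrow> nat \<Rightarrow> reflection word \<Rightarrow>\<^sub>0 'k::comm_ring_1" where
  "sym_letter i j = px i j + bx i j"

lemma restrict_sym_letter:
  "i \<noteq> j \<Longrightarrow> restrict_letters (reflections_D n) (sym_letter i j)
    = (if i \<in> {1..n} \<and> j \<in> {1..n} then sym_letter i j else 0)"
  by (auto simp: sym_letter_def px_def bx_def restrict_letters_add restrict_letters_letter reflections_D_def doubleton_eq_iff)

lemma px_sym: "px i j = px j i" and bx_sym: "bx i j = bx j i"
  by (simp_all add: px_def bx_def insert_commute)

lemma relator_in_ideal: "r \<in> quad_relators_D n \<Longrightarrow> r \<in> quad_ideal_D n"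
  unfolding quad_ideal_D_def using ring.genideal_self[OF ring_free_algebra quad_relators_D_carrier] by blast

lemma relators:
  fixes n :: nat and I :: "(reflection word \<Rightarrow>\<^sub>0 'k::comm_ring_1) set"
  defines "I \<equiv> quad_ideal_D n"
  assumes ij: "i \<in> {1..n}" "j \<in> {1..n}"
  shows "i \<noteq> j \<Longrightarrow> px i j * px i j \<in> I" "i \<noteq> j \<Longrightarrow> bx i j * bx i j \<in> I"
    "i \<noteq> j \<Longrightarrow> px i j * bx i j + bx i j * px i j \<in> I"
    "k \<in> {1..n} \<Longrightarrow> l \<in> {1..n} \<Longrightarrow> distinct [i, j, k, l] \<Longrightarrow> px i j * px k l + px k l * px i j \<in> I"
    "k \<in> {1..n} \<Longrightarrow> l \<in> {1..n} \<Longrightarrow> distinct [i, j, k, l] \<Longrightarrow> px i j * bx k l + bx k l * px i j \<in> I"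
    "k \<in> {1..n} \<Longrightarrow> l \<in> {1..n} \<Longrightarrow> distinct [i, j, k, l] \<Longrightarrow> bx i j * bx k l + bx k l * bx i j \<in> I"
    "k \<in> {1..n} \<Longrightarrow> distinct [i, j, k] \<Longrightarrow> px i j * px j k + px j k * px k i + px k i * px i j \<in> I"
    "k \<in> {1..n} \<Longrightarrow> distinct [i, j, k] \<Longrightarrow> bx i k * px i j + px j i * bx j k + bx k j * bx i k \<in> I"
proof -
  have 1: "r \<in> quad_relators_D n" if "i \<noteq> j" "r \<in> {px i j * px i j, bx i j * bx i j, px i j * bx i j + bx i j * px i j}" for r :: "reflection word \<Rightarrow>\<^sub>0 'k"
    unfolding quad_relators_D_def using ij that by (intro UnI1 UN_I[of i] UN_I[of j]) auto
  have 2: "r \<in> quad_relators_D n" if "k \<in> {1..n}" "l \<in> {1..n}" "distinct [i, j, k, l]"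
    "r \<in> {px i j * px k l + px k l * px i j, px i j * bx k l + bx k l * px i j, bx i j * bx k l + bx k l * bx i j}" for r :: "reflection word \<Rightarrow>\<^sub>0 'k"
    unfolding quad_relators_D_def using ij that
    by (intro UnI1[OF UnI2] UN_I[of i] UN_I[of j] UN_I[of k] UN_I[of l]) auto
  have 3: "r \<in> quad_relators_D n" if "k \<in> {1..n}" "distinct [i, j, k]"
    "r \<in> {px i j * px j k + px j k * px k i + px k i * px i j, bx i k * px i j + px j i * bx j k + bx k j * bx i k}" for r :: "reflection word \<Rightarrow>\<^sub>0 'k"
    unfolding quad_relators_D_def using ij that
    by (intro UnI2 UN_I[of i] UN_I[of j] UN_I[of k]) auto
  show "i \<noteq> j \<Longrightarrow> px i j * px i j \<in> I" "i \<noteq> j \<Longrightarrow> bx i j * bx i j \<in> I"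
    "i \<noteq> j \<Longrightarrow> px i j * bx i j + bx i j * px i j \<in> I"
    unfolding I_def by (rule relator_in_ideal, rule 1; simp)+
  show "k \<in> {1..n} \<Longrightarrow> l \<in> {1..n} \<Longrightarrow> distinct [i, j, k, l] \<Longrightarrow> px i j * px k l + px k l * px i j \<in> I"
    "k \<in> {1..n} \<Longrightarrow> l \<in> {1..n} \<Longrightarrow> distinct [i, j, k, l] \<Longrightarrow> px i j * bx k l + bx k l * px i j \<in> I"
    "k \<in> {1..n} \<Longrightarrow> l \<in> {1..n} \<Longrightarrow> distinct [i, j, k, l] \<Longrightarrow> bx i j * bx k l + bx k l * bx i j \<in> I"
    unfolding I_def by (rule relator_in_ideal, rule 2; simp)+
  show "k \<in> {1..n} \<Longrightarrow> distinct [i, j, k] \<Longrightarrow> px i j * px j k + px j k * px k i + px k i * px i j \<in> I"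
    "k \<in> {1..n} \<Longrightarrow> distinct [i, j, k] \<Longrightarrow> bx i k * px i j + px j i * bx j k + bx k j * bx i k \<in> I"
    unfolding I_def by (rule relator_in_ideal, rule 3; simp)+
qed

text \<open>Every monomial of a relation contains all indices that occur in the relation, so
  restriction to rank n either keeps the relation whole or kills all of it. In the first case it is
  a sum of plain, barred and mixed relators.\<close>

lemma sym_letter_relations:
  fixes s :: "nat \<Rightarrow> nat \<Rightarrow> reflection word \<Rightarrow>\<^sub>0 'k::comm_ring_1"
  defines "s \<equiv> sym_letter"
  shows
  "i \<noteq> j \<Longrightarrow> s i j * s i j \<in> null_relations"
  "distinct [i, j, k, l] \<Longrightarrow> s i j * s k l + s k l * s i j \<in> null_relations"
  "distinct [i, j, k] \<Longrightarrow> s i j * s j k + s j k * s k i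
      + s k i * s i j \<in> null_relations"
proof -
  show "s i j * s i j \<in> null_relations" if d: "i \<noteq> j"
  proof -
    have "s i j * s i j \<in> quad_ideal_D n" if "i \<in> {1..n}" "j \<in> {1..n}" for n
    proof -
      have "s i j * s i j = px i j * px i j + bx i j * bx i j + (px i j * bx i j + bx i j * px i j)"
        by (simp add: s_def sym_letter_def algebra_simps)
      also have "\<dots> \<in> quad_ideal_D n" by (intro ideal_closed relators that d)
      finally show ?thesis .
    qed
    then show ?thesis
      unfolding null_relations_def s_def by (auto simp: restrict_letters_mult restrict_sym_letter[OF d] ideal_closed)
  qed
  show "s i j * s k l + s k l * s i j \<in> null_relations" if d: "distinct [i, j, k, l]"
  proof -
    have *: "s i j * s k l + s k l * s i j \<in> quad_ideal_D n"
      if "i \<in> {1..n}" "j \<in> {1..n}" "k \<in> {1..n}" "l \<in> {1..n}" for n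
    proof -
      have d': "distinct [k, l, i, j]" using d by auto
      have "s i j * s k l + s k l * s i j =
         (px i j * px k l + px k l * px i j) + (px i j * bx k l + bx k l * px i j)
         + (px k l * bx i j + bx i j * px k l) + (bx i j * bx k l + bx k l * bx i j)"
        by (simp add: s_def sym_letter_def algebra_simps)
      also have "\<dots> \<in> quad_ideal_D n" by (intro ideal_closed relators that d d')
      finally show ?thesis .
    qed
    have "i \<noteq> j" "k \<noteq> l" using d by auto
    with *[unfolded s_def] show ?thesis
      unfolding null_relations_def s_def
      by (auto simp: restrict_letters_mult restrict_letters_add restrict_sym_letter ideal_closed)
  qed
  show "s i j * s j k + s j k * s k i + s k i * s i j \<in> null_relations"
    if d: "distinct [i, j, k]"
  proof -
    have *: "s i j * s j k + s j k * s k i + s k i * s i j \<in> quad_ideal_D n"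
      if n: "i \<in> {1..n}" "j \<in> {1..n}" "k \<in> {1..n}" for n
    proof -
      have d': "distinct [j, k, i]" "distinct [k, i, j]" using d by auto
      \<comment> \<open>The twelve products are the three of the plain triangle relator and the nine
        of the mixed relator in its three cyclic rotations.\<close>
      have "s i j * s j k + s j k * s k i + s k i * s i j =
         (px i j * px j k + px j k * px k i + px k i * px i j)
         + (bx i k * px i j + px j i * bx j k + bx k j * bx i k)
         + (bx j i * px j k + px k j * bx k i + bx i k * bx j i)
         + (bx k j * px k i + px i k * bx i j + bx j i * bx k j)"
        unfolding s_def sym_letter_def px_sym[of j i] px_sym[of k i] px_sym[of k j] bx_sym[of j i] bx_sym[of k i] bx_sym[of k j]
        by (simp add: algebra_simps)
      also have "\<dots> \<in> quad_ideal_D n" by (intro ideal_closed relators n d d')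
      finally show ?thesis .
    qed
    have "i \<noteq> j" "j \<noteq> k" "k \<noteq> i" using d by auto
    with *[unfolded s_def] show ?thesis
      unfolding null_relations_def s_def
      by (auto simp: restrict_letters_mult restrict_letters_add restrict_sym_letter ideal_closed)
  qed
qed

interpretation lambda: quadratic_relations "\<lambda>i j. cls (sym_letter i j :: reflection word \<Rightarrow>\<^sub>0 'k::field_char_0)"
proof
  fix i j k l :: nat
  show "cls (sym_letter i j) = (cls (sym_letter j i) :: 'k lambda)"
    by (simp add: sym_letter_def px_sym[of i j] bx_sym[of i j])
  show "i \<noteq> j \<Longrightarrow> cls (sym_letter i j) * cls (sym_letter i j) = (0 :: 'k lambda)"
    unfolding cls_hom(5)[symmetric] cls_eq_0 by (rule sym_letter_relations)
  show "distinct [i, j, k, l] \<Longrightarrow> cls (sym_letter i j) * cls (sym_letter k l) = - (cls (sym_letter k l) * cls (sym_letter i j) :: 'k lambda)"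
    unfolding eq_neg_iff_add_eq_0 cls_hom(5)[symmetric] cls_hom(3)[symmetric] cls_eq_0 by (rule sym_letter_relations)
  show "distinct [i, j, k] \<Longrightarrow> cls (sym_letter i j) * cls (sym_letter j k) + cls (sym_letter j k) * cls (sym_letter k i)
      + cls (sym_letter k i) * cls (sym_letter i j) = (0 :: 'k lambda)"
    unfolding cls_hom(5)[symmetric] cls_hom(3)[symmetric] cls_eq_0 by (rule sym_letter_relations)
qed

text \<open>The inverse is taken among the constants, whose classes multiply like scalars. This is
  where characteristic zero enters.\<close>

lemma lambda_div: "m \<noteq> 0 \<Longrightarrow> \<exists>r::'k::field_char_0 lambda. of_int m * r = 1"
proof -
  assume "m \<noteq> 0"
  let ?c = "\<lambda>a::'k. cls (Poly_Mapping.single 0 a)"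
  have c1: "?c 1 = 1" by (simp add: cls_hom)
  have ca: "?c (a + b) = ?c a + ?c b" for a b by (simp add: single_add cls_hom)
  have cm: "?c (a * b) = ?c a * ?c b" for a b by (simp add: mult_single cls_hom flip: cls_hom(5))
  have cn: "cls (of_nat k :: reflection word \<Rightarrow>\<^sub>0 'k) = of_nat k" for k by (induction k) (simp_all add: cls_hom)
  have cu: "?c (- a) = - ?c a" for a using ca[of a "- a"] by (simp add: cls_hom eq_neg_iff_add_eq_0 add.commute)
  have "?c (of_int m) = of_int m"
    by (cases m rule: int_cases2) (simp_all add: cn cu cls_hom)
  then have "of_int m * ?c (inverse (of_int m)) = ?c (of_int m * inverse (of_int m))" by (simp only: cm)
  also have "\<dots> = 1" using \<open>m \<noteq> 0\<close> by (simp add: cls_hom)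
  finally show ?thesis by blast
qed

section \<open>Sums over subsets and over omitted factors in list form\<close>

lemma esym_map_eq_sum:
  fixes l :: "'i::linorder list" and f :: "'i \<Rightarrow> 'a::ring_1"
  assumes "sorted l" "distinct l"
  shows "esym k (map f l) = (\<Sum>S | S \<subseteq> set l \<and> card S = k. prod_list (map f (sorted_list_of_set S)))"
  using assms
proof (induction l arbitrary: k)
  case Nil
  have "{S. S \<subseteq> set ([] :: 'i list) \<and> card S = k} = (if k = 0 then {{}} else {})" by auto
  show ?case unfolding \<open>_ = (if k = 0 then _ else _)\<close> by (cases k) simp_all
next
  case (Cons a l)
  have a: "\<forall>b\<in>set l. a < b" "a \<notin> set l" using Cons.prems by (auto simp: less_le)
  show ?case
  proof (cases k)
    case 0
    have "{S. S \<subseteq> set (a # l) \<and> card S = 0} = {{}}"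
      using finite_subset[OF _ finite_set[of "a # l"]] by auto
    then show ?thesis using 0 by simp
  next
    case (Suc k')
    let ?g = "\<lambda>S. prod_list (map f (sorted_list_of_set S))"
    let ?A = "{S. S \<subseteq> set l \<and> card S = k'}" and ?B = "{S. S \<subseteq> set l \<and> card S = Suc k'}"
    have fin: "finite ?A" "finite ?B" by (auto intro: finite_subset[of _ "Pow (set l)"])
    have finS: "finite S" if "S \<subseteq> set l" for S using that finite_subset by blast
    have split: "{S. S \<subseteq> set (a # l) \<and> card S = Suc k'} = insert a ` ?A \<union> ?B"
    proof (intro equalityI subsetI)
      fix S assume S: "S \<in> {S. S \<subseteq> set (a # l) \<and> card S = Suc k'}"
      show "S \<in> insert a ` ?A \<union> ?B"
      proof (cases "a \<in> S")
        case True
        then have "S = insert a (S - {a})" "S - {a} \<subseteq> set l" "card (S - {a}) = k'" using S by auto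
        then show ?thesis by blast
      qed (use S in auto)
    next
      fix S assume "S \<in> insert a ` ?A \<union> ?B"
      then show "S \<in> {S. S \<subseteq> set (a # l) \<and> card S = Suc k'}"
      proof
        assume "S \<in> insert a ` ?A"
        then obtain R where R: "S = insert a R" "R \<subseteq> set l" "card R = k'" by auto
        then have "a \<notin> R" using a by auto
        then show ?thesis using R finS[OF R(2)] by auto
      qed auto
    qed
    have "inj_on (insert a) ?A" using a by (intro inj_onI) (metis (mono_tags, lifting) insert_ident mem_Collect_eq subsetD)
    moreover have "insert a ` ?A \<inter> ?B = {}" using a by auto
    ultimately have "(\<Sum>S | S \<subseteq> set (a # l) \<and> card S = Suc k'. ?g S) = (\<Sum>S\<in>?A. ?g (insert a S)) + (\<Sum>S\<in>?B. ?g S)"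
      unfolding split using fin by (subst sum.union_disjoint) (auto simp: sum.reindex)
    also have "(\<Sum>S\<in>?A. ?g (insert a S)) = (\<Sum>S\<in>?A. f a * ?g S)"
    proof (intro sum.cong refl)
      fix S assume "S \<in> ?A"
      then have S: "S \<subseteq> set l" by simp
      have "sorted_list_of_set (insert a S) = a # sorted_list_of_set S"
      proof (rule sorted_list_of_set_unique[THEN iffD1])
        show "finite (insert a S)" using finS[OF S] by simp
        show "sorted_wrt (<) (a # sorted_list_of_set S) \<and> set (a # sorted_list_of_set S) = insert a S
            \<and> length (a # sorted_list_of_set S) = card (insert a S)"
          using S a finS[OF S] by (auto simp: card_insert_if)
      qed
      then show "?g (insert a S) = f a * ?g S" by simp
    qed
    finally show ?thesis using Suc Cons by (simp add: sum_distrib_left)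
  qed
qed

lemma omit_prod_upt:
  "omit_prod u [a..<b] = (\<Sum>i\<in>{a..<b}. (- 1) ^ (i - a) * prod_list (map u ([a..<i] @ [Suc i..<b])))"
proof (induction "b - a" arbitrary: a)
  case 0
  then show ?case by simp
next
  case (Suc m)
  then have ab: "a < b" by simp
  then have l: "[a..<b] = a # [Suc a..<b]" by (rule upt_conv_Cons)
  have IH: "omit_prod u [Suc a..<b] = (\<Sum>i\<in>{Suc a..<b}. (- 1) ^ (i - Suc a) * prod_list (map u ([Suc a..<i] @ [Suc i..<b])))"
    by (rule Suc.hyps(1)) (use Suc.hyps(2) in simp)
  have "(\<Sum>i\<in>{a..<b}. (- 1) ^ (i - a) * prod_list (map u ([a..<i] @ [Suc i..<b])))
      = prod_list (map u [Suc a..<b]) + (\<Sum>i\<in>{Suc a..<b}. (- 1) ^ (i - a) * prod_list (map u ([a..<i] @ [Suc i..<b])))"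
    by (subst sum.atLeast_Suc_lessThan[OF ab]) simp
  also have "(\<Sum>i\<in>{Suc a..<b}. (- 1) ^ (i - a) * prod_list (map u ([a..<i] @ [Suc i..<b])))
      = (\<Sum>i\<in>{Suc a..<b}. - (u a * ((- 1) ^ (i - Suc a) * prod_list (map u ([Suc a..<i] @ [Suc i..<b])))))"
  proof (intro sum.cong refl)
    fix i assume "i \<in> {Suc a..<b}"
    then have "[a..<i] = a # [Suc a..<i]" "i - a = Suc (i - Suc a)" by (auto simp: upt_conv_Cons)
    then show "(- 1) ^ (i - a) * prod_list (map u ([a..<i] @ [Suc i..<b]))
        = - (u a * ((- 1) ^ (i - Suc a) * prod_list (map u ([Suc a..<i] @ [Suc i..<b]))))"
      by (cases "even (i - Suc a)") (simp_all add: mult.assoc)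
  qed
  also have "\<dots> = - (u a * omit_prod u [Suc a..<b])"
    unfolding IH sum_negf sum_distrib_left ..
  finally show ?case unfolding l by simp
qed

section \<open>Transfer to the quotient ring of rank n\<close>

context
  fixes n :: nat and K :: "'k::field_char_0 itself"
begin

interpretation I: ideal "quad_ideal_D n :: (reflection word \<Rightarrow>\<^sub>0 'k) set" "free_algebra (reflections_D n)"
  by (rule ideal_quad_ideal_D)

abbreviation (input) "LQ \<equiv> Lambda_quad_D K n"
abbreviation (input) "FA \<equiv> free_algebra (reflections_D n) :: (reflection word \<Rightarrow>\<^sub>0 'k) ring"

interpretation L: ring LQ by (rule ring_Lambda_quad_D)

definition pr :: "(reflection word \<Rightarrow>\<^sub>0 'k) \<Rightarrow> (reflection word \<Rightarrow>\<^sub>0 'k) set" where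
  "pr p = Lambda_class n p"

lemma pr_hom: "pr \<in> ring_hom FA LQ"
  using I.rcos_ring_hom by (simp add: Lambda_quad_D_def pr_def[abs_def] Lambda_class_def[abs_def])

lemma FA_closed: "p \<in> carrier FA \<Longrightarrow> q \<in> carrier FA \<Longrightarrow> p + q \<in> carrier FA"
  "p \<in> carrier FA \<Longrightarrow> q \<in> carrier FA \<Longrightarrow> p * q \<in> carrier FA"
  "0 \<in> carrier FA" "1 \<in> carrier FA" "p \<in> carrier FA \<Longrightarrow> - p \<in> carrier FA"
  using keys_add[of p q] keys_mult_letters[of p "reflections_D n" q]
  by (auto simp: free_algebra_def zero_word_def)

lemma FA_sum: "(\<And>a. a \<in> A \<Longrightarrow> f a \<in> carrier FA) \<Longrightarrow> sum f A \<in> carrier FA"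
  by (induction A rule: infinite_finite_induct) (simp_all add: FA_closed)

lemma FA_prod_list: "(\<And>a. a \<in> set l \<Longrightarrow> f a \<in> carrier FA) \<Longrightarrow> prod_list (map f l) \<in> carrier FA"
  by (induction l) (simp_all add: FA_closed)

lemma pr_closed: "p \<in> carrier FA \<Longrightarrow> pr p \<in> carrier LQ"
  using ring_hom_closed[OF pr_hom] .

lemma pr_mult: "p \<in> carrier FA \<Longrightarrow> q \<in> carrier FA \<Longrightarrow> pr p \<otimes>\<^bsub>LQ\<^esub> pr q = pr (p * q)"
  using ring_hom_mult[OF pr_hom, of p q] by (simp add: free_algebra_def)

lemma pr_add: "p \<in> carrier FA \<Longrightarrow> q \<in> carrier FA \<Longrightarrow> pr p \<oplus>\<^bsub>LQ\<^esub> pr q = pr (p + q)"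
  using ring_hom_add[OF pr_hom, of p q] by (simp add: free_algebra_def)

lemma pr_one: "pr 1 = \<one>\<^bsub>LQ\<^esub>"
  using ring_hom_one[OF pr_hom] by (simp add: free_algebra_def)

lemma pr_zero: "pr 0 = \<zero>\<^bsub>LQ\<^esub>"
  using ring_hom_zero[OF pr_hom ring_free_algebra ring_Lambda_quad_D] by (simp add: free_algebra_def)

lemma pr_sum:
  assumes "finite A" "\<And>a. a \<in> A \<Longrightarrow> f a \<in> carrier FA"
  shows "(\<Oplus>\<^bsub>LQ\<^esub> a\<in>A. pr (f a)) = pr (sum f A)"
  using assms
proof (induction A)
  case empty
  show ?case by (simp add: pr_zero)
next
  case (insert a A)
  then have "(\<lambda>a. pr (f a)) \<in> A \<rightarrow> carrier LQ" "pr (f a) \<in> carrier LQ" by (auto intro: pr_closed)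
  then have "(\<Oplus>\<^bsub>LQ\<^esub> a\<in>insert a A. pr (f a)) = pr (f a) \<oplus>\<^bsub>LQ\<^esub> (\<Oplus>\<^bsub>LQ\<^esub> a\<in>A. pr (f a))"
    using insert by (intro L.finsum_insert) auto
  then show ?case using insert by (simp add: pr_add FA_sum)
qed

lemma pr_foldr:
  "(\<And>a. a \<in> set l \<Longrightarrow> f a \<in> carrier FA) \<Longrightarrow>
    foldr (\<otimes>\<^bsub>LQ\<^esub>) (map (\<lambda>a. pr (f a)) l) \<one>\<^bsub>LQ\<^esub> = pr (prod_list (map f l))"
  by (induction l) (simp_all add: pr_one pr_mult FA_prod_list)

text \<open>Restriction to rank n fixes the elements of the free algebra of rank n, so one that
  vanishes in the common quotient of all ranks lies in the ideal of rank n.\<close>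

lemma pr_eq_zeroI:
  assumes "p \<in> carrier FA" "cls p = 0"
  shows "pr p = \<zero>\<^bsub>LQ\<^esub>"
proof -
  have "p \<in> quad_ideal_D n"
    using assms unfolding cls_eq_0 null_relations_def
    by (metis (mono_tags, lifting) mem_Collect_eq restrict_letters_id)
  then have "pr p = quad_ideal_D n"
    unfolding pr_def Lambda_class_def by (rule I.a_rcos_const)
  then show ?thesis by (simp add: Lambda_quad_D_def FactRing_def)
qed

definition theta_lift :: "nat \<Rightarrow> reflection word \<Rightarrow>\<^sub>0 'k" where
  "theta_lift i = (\<Sum>j\<in>{1..n} - {i}. sym_letter i j)"

lemma letters_carrier:
  assumes "i \<in> {1..n}" "j \<in> {1..n} - {i}"
  shows "(px i j :: reflection word \<Rightarrow>\<^sub>0 'k) \<in> carrier FA" "(bx i j :: reflection word \<Rightarrow>\<^sub>0 'k) \<in> carrier FA"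
  using assms by (auto simp: free_algebra_def px_def bx_def letter_def reflections_D_def)

lemma theta_lift_carrier: "i \<in> {1..n} \<Longrightarrow> theta_lift i \<in> carrier FA"
  unfolding theta_lift_def sym_letter_def by (intro FA_sum FA_closed letters_carrier)

lemma theta_pr: "i \<in> {1..n} \<Longrightarrow> theta_D K n i = pr (theta_lift i)"
proof -
  assume i: "i \<in> {1..n}"
  have "theta_D K n i = (\<Oplus>\<^bsub>LQ\<^esub> j\<in>{1..n} - {i}. pr (sym_letter i j))"
    unfolding theta_D_def
  proof (rule L.finsum_cong')
    show "(\<lambda>j. pr (sym_letter i j)) \<in> {1..n} - {i} \<rightarrow> carrier LQ"
      unfolding sym_letter_def using letters_carrier[OF i] by (auto intro!: pr_closed FA_closed)
    show "Lambda_class n (px i j) \<oplus>\<^bsub>LQ\<^esub> Lambda_class n (bx i j) = pr (sym_letter i j)"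
      if "j \<in> {1..n} - {i}" for j
      using pr_add[OF letters_carrier[OF i that]] by (simp add: pr_def sym_letter_def)
  qed simp
  also have "\<dots> = pr (theta_lift i)"
    unfolding theta_lift_def sym_letter_def
    by (rule pr_sum) (use letters_carrier[OF i] in \<open>auto intro!: FA_closed\<close>)
  finally show ?thesis .
qed

lemma cls_theta_lift: "cls (theta_lift i) = lambda.dunkl (set [1..<Suc n]) i"
proof -
  have "set [1..<Suc n] = {1..n}" by auto
  then show ?thesis by (simp add: theta_lift_def lambda.dunkl_def cls_sum)
qed

lemma ordered_prod_pr:
  assumes "S \<subseteq> {1..n}" "\<And>i. i \<in> {1..n} \<Longrightarrow> g i = pr (f i)" "\<And>i. i \<in> {1..n} \<Longrightarrow> f i \<in> carrier FA"
  shows "ordered_prod LQ g S = pr (prod_list (map f (sorted_list_of_set S)))"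
    and "prod_list (map f (sorted_list_of_set S)) \<in> carrier FA"
proof -
  have "finite S" using finite_subset[OF assms(1)] by simp
  then have S: "set (sorted_list_of_set S) = S" by simp
  then have "map g (sorted_list_of_set S) = map (\<lambda>i. pr (f i)) (sorted_list_of_set S)"
    using assms by auto
  moreover have "foldr (\<otimes>\<^bsub>LQ\<^esub>) (map (\<lambda>i. pr (f i)) (sorted_list_of_set S)) \<one>\<^bsub>LQ\<^esub>
      = pr (prod_list (map f (sorted_list_of_set S)))"
    by (rule pr_foldr) (use S assms in auto)
  ultimately show "ordered_prod LQ g S = pr (prod_list (map f (sorted_list_of_set S)))"
    unfolding ordered_prod_def by (simp only:)
  show "prod_list (map f (sorted_list_of_set S)) \<in> carrier FA"
    by (rule FA_prod_list) (use S assms in auto)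
qed

lemma elem_sym_vanishes:
  assumes "k \<ge> 1"
  shows "elem_sym LQ n k (\<lambda>i. theta_D K n i [^]\<^bsub>LQ\<^esub> (2::nat)) = \<zero>\<^bsub>LQ\<^esub>"
proof -
  let ?f = "\<lambda>i. theta_lift i * theta_lift i"
  let ?A = "{S. S \<subseteq> {1..n} \<and> card S = k}"
  have f: "?f i \<in> carrier FA" if "i \<in> {1..n}" for i using theta_lift_carrier[OF that] by (intro FA_closed)
  have g: "theta_D K n i [^]\<^bsub>LQ\<^esub> (2::nat) = pr (?f i)" if "i \<in> {1..n}" for i
    using theta_lift_carrier[OF that] pr_closed[OF theta_lift_carrier[OF that]]
    by (simp add: theta_pr[OF that] numeral_2_eq_2 pr_mult)
  have fin: "finite ?A" by (rule finite_subset[of _ "Pow {1..n}"]) auto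
  have "elem_sym LQ n k (\<lambda>i. theta_D K n i [^]\<^bsub>LQ\<^esub> (2::nat))
      = (\<Oplus>\<^bsub>LQ\<^esub> S\<in>?A. pr (prod_list (map ?f (sorted_list_of_set S))))"
    unfolding elem_sym_def
    by (rule L.finsum_cong') (use ordered_prod_pr[OF _ g f] pr_closed in auto)
  also have "\<dots> = pr (\<Sum>S\<in>?A. prod_list (map ?f (sorted_list_of_set S)))"
    by (rule pr_sum[OF fin]) (use ordered_prod_pr(2)[OF _ g f] in auto)
  also have "\<dots> = \<zero>\<^bsub>LQ\<^esub>"
  proof (rule pr_eq_zeroI)
    show "(\<Sum>S\<in>?A. prod_list (map ?f (sorted_list_of_set S))) \<in> carrier FA"
      by (rule FA_sum) (use ordered_prod_pr(2)[OF _ g f] in auto)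
    have "set [1..<Suc n] = {1..n}" by auto
    then have "cls (\<Sum>S\<in>?A. prod_list (map ?f (sorted_list_of_set S)))
        = esym k (map (\<lambda>i. cls (theta_lift i) * cls (theta_lift i)) [1..<Suc n])"
      by (subst esym_map_eq_sum) (simp_all add: cls_sum cls_prod_list cls_hom del: upt_Suc)
    also have "\<dots> = 0"
      unfolding cls_theta_lift by (rule lambda.dunkl_identities(3)[OF lambda_div]) (use assms in auto)
    finally show "cls (\<Sum>S\<in>?A. prod_list (map ?f (sorted_list_of_set S))) = 0" .
  qed
  finally show ?thesis .
qed

lemma sorted_list_upt: "sorted_list_of_set {1..n} = [1..<Suc n]"
  by (metis atLeastLessThanSuc_atLeastAtMost sorted_list_of_set_range)

lemma ordered_prod_vanishes:
  assumes "n \<ge> 1"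
  shows "ordered_prod LQ (theta_D K n) {1..n} = \<zero>\<^bsub>LQ\<^esub>"
proof -
  have "cls (prod_list (map theta_lift [1..<Suc n])) = 0"
    unfolding cls_prod_list cls_theta_lift
    by (rule lambda.dunkl_identities(1)[OF lambda_div]) (use assms in auto)
  then show ?thesis
    using ordered_prod_pr[of "{1..n}", OF subset_refl theta_pr theta_lift_carrier]
    unfolding sorted_list_upt by (simp add: pr_eq_zeroI del: upt_Suc)
qed

lemma minus_one_pow_pr: "(\<ominus>\<^bsub>LQ\<^esub> \<one>\<^bsub>LQ\<^esub>) [^]\<^bsub>LQ\<^esub> (m::nat) = pr ((- 1) ^ m)" and minus_one_pow_carrier: "(- 1) ^ m \<in> carrier FA"
proof -
  have c: "- 1 \<in> carrier FA" by (intro FA_closed)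
  show pc: "(- 1) ^ m \<in> carrier FA" for m by (induction m) (simp_all add: FA_closed c)
  have "pr (- 1) \<oplus>\<^bsub>LQ\<^esub> \<one>\<^bsub>LQ\<^esub> = \<zero>\<^bsub>LQ\<^esub>"
    using pr_add[OF c FA_closed(4)] by (simp add: pr_one pr_zero)
  then have m: "\<ominus>\<^bsub>LQ\<^esub> \<one>\<^bsub>LQ\<^esub> = pr (- 1)"
    using L.minus_equality[OF _ L.one_closed pr_closed[OF c]] by simp
  show "(\<ominus>\<^bsub>LQ\<^esub> \<one>\<^bsub>LQ\<^esub>) [^]\<^bsub>LQ\<^esub> (m::nat) = pr ((- 1) ^ m)"
  proof (induction m)
    case (Suc m)
    then show ?case unfolding m by (simp add: pr_mult pc c power_commutes del: power_Suc add: power_Suc2)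
  qed (simp add: pr_one)
qed

lemma omitted_sum_vanishes:
  assumes "n \<ge> 2"
  shows "(\<Oplus>\<^bsub>LQ\<^esub> i\<in>{1..n}. ((\<ominus>\<^bsub>LQ\<^esub> \<one>\<^bsub>LQ\<^esub>) [^]\<^bsub>LQ\<^esub> (i + 1))
      \<otimes>\<^bsub>LQ\<^esub> ordered_prod LQ (theta_D K n) ({1..n} - {i})) = \<zero>\<^bsub>LQ\<^esub>"
proof -
  let ?w = "\<lambda>i. prod_list (map theta_lift (sorted_list_of_set ({1..n} - {i})))"
  have w: "ordered_prod LQ (theta_D K n) ({1..n} - {i}) = pr (?w i)" "?w i \<in> carrier FA" for i
    using ordered_prod_pr[of "{1..n} - {i}", OF _ theta_pr theta_lift_carrier] by auto
  have s: "sorted_list_of_set ({1..n} - {i}) = [1..<i] @ [Suc i..<Suc n]" if "i \<in> {1..n}" for i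
  proof (rule sorted_list_of_set_unique[THEN iffD1])
    show "sorted_wrt (<) ([1..<i] @ [Suc i..<Suc n]) \<and> set ([1..<i] @ [Suc i..<Suc n]) = {1..n} - {i}
        \<and> length ([1..<i] @ [Suc i..<Suc n]) = card ({1..n} - {i})"
      using that by (auto simp: sorted_wrt_append simp del: upt_Suc)
  qed simp
  have t: "(- 1) ^ (i + 1) * ?w i \<in> carrier FA" for i by (intro FA_closed minus_one_pow_carrier w)
  have "(\<Oplus>\<^bsub>LQ\<^esub> i\<in>{1..n}. ((\<ominus>\<^bsub>LQ\<^esub> \<one>\<^bsub>LQ\<^esub>) [^]\<^bsub>LQ\<^esub> (i + 1))
      \<otimes>\<^bsub>LQ\<^esub> ordered_prod LQ (theta_D K n) ({1..n} - {i})) = (\<Oplus>\<^bsub>LQ\<^esub> i\<in>{1..n}. pr ((- 1) ^ (i + 1) * ?w i))"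
    unfolding minus_one_pow_pr w(1) pr_mult[OF minus_one_pow_carrier w(2)] ..
  also have "\<dots> = pr (\<Sum>i\<in>{1..n}. (- 1) ^ (i + 1) * ?w i)"
    by (rule pr_sum) (use t in auto)
  also have "\<dots> = \<zero>\<^bsub>LQ\<^esub>"
  proof (rule pr_eq_zeroI)
    show "(\<Sum>i\<in>{1..n}. (- 1) ^ (i + 1) * ?w i) \<in> carrier FA" by (rule FA_sum) (rule t)
    have c: "cls ((- 1) ^ m) = (- 1) ^ m" for m by (induction m) (simp_all add: cls_hom)
    have "cls (\<Sum>i\<in>{1..n}. (- 1) ^ (i + 1) * ?w i)
        = (\<Sum>i\<in>{1..<Suc n}. (- 1) ^ (i - 1) * prod_list (map (\<lambda>i. cls (theta_lift i)) ([1..<i] @ [Suc i..<Suc n])))"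
      unfolding cls_sum
    proof (rule sum.cong)
      fix i assume i: "i \<in> {1..<Suc n}"
      \<comment> \<open>The index starts at 1, so \<open>i + 1\<close> and the truncated difference
        \<open>i - 1\<close> have the same parity.\<close>
      then have "(- 1 :: 'k lambda) ^ (i + 1) = (- 1) ^ (i - 1)" by (cases i) simp_all
      then show "cls ((- 1) ^ (i + 1) * ?w i)
          = (- 1) ^ (i - 1) * prod_list (map (\<lambda>i. cls (theta_lift i)) ([1..<i] @ [Suc i..<Suc n]))"
        using s[of i] i by (simp only: cls_hom(5) c cls_prod_list) (simp add: atLeastLessThanSuc_atLeastAtMost)
    qed auto
    also have "\<dots> = omit_prod (\<lambda>i. cls (theta_lift i)) [1..<Suc n]" by (rule omit_prod_upt[symmetric])
    also have "\<dots> = 0"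
      unfolding cls_theta_lift by (rule lambda.dunkl_identities(2)[OF lambda_div]) (use assms in auto)
    finally show "cls (\<Sum>i\<in>{1..n}. (- 1) ^ (i + 1) * ?w i) = 0" .
  qed
  finally show ?thesis .
qed

end

theorem corollary5p2:
  fixes n :: nat and K :: "'k::field_char_0 itself"
  assumes "n \<ge> 2"
  shows "(\<forall>k\<in>{1..n}.
        elem_sym (Lambda_quad_D K n) n k (\<lambda>i. theta_D K n i [^]\<^bsub>Lambda_quad_D K n\<^esub> (2::nat))
          = \<zero>\<^bsub>Lambda_quad_D K n\<^esub>)
    \<and> ordered_prod (Lambda_quad_D K n) (theta_D K n) {1..n} = \<zero>\<^bsub>Lambda_quad_D K n\<^esub>
    \<and> (\<Oplus>\<^bsub>Lambda_quad_D K n\<^esub> i\<in>{1..n}.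
          ((\<ominus>\<^bsub>Lambda_quad_D K n\<^esub> \<one>\<^bsub>Lambda_quad_D K n\<^esub>) [^]\<^bsub>Lambda_quad_D K n\<^esub> (i + 1))
            \<otimes>\<^bsub>Lambda_quad_D K n\<^esub> ordered_prod (Lambda_quad_D K n) (theta_D K n) ({1..n} - {i}))
        = \<zero>\<^bsub>Lambda_quad_D K n\<^esub>"
  using assms
  by (intro conjI ballI elem_sym_vanishes ordered_prod_vanishes omitted_sum_vanishes) simp_all

end
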